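(* Let $k$ be an algebraically closed field of characteristic zero and let $\mathfrak{g}$ be a finite dimensional Lie algebra over $k$. (1) $c(\mathfrak{h})\le c(\mathfrak{g})$ for any Lie subalgebra $\mathfrak{h}$ of $\mathfrak{g}$. (2) Assume that $\mathrm{trdeg}_k Y(\mathfrak{g})=i(\mathfrak{g})$. Then $$c(\mathfrak{g})-c(F(\mathfrak{g}))\le \deg p_{\mathfrak{g}}.$$ So $c(\mathfrak{g})=c(F(\mathfrak{g}))$ if $\mathfrak{g}$ is nonsingular; in particular, in that case any complete Poisson commutative subalgebra of $S(F(\mathfrak{g}))$ is also complete in $S(\mathfrak{g})$. If in addition $F(\mathfrak{g})$ is commutative (with $\mathfrak{g}$ nonsingular), then $F(\mathfrak{g})$ is the only commutative polarization of $\mathfrak{g}$. (3) Strict inequality can occur in (2): there exists $\mathfrak{g}$ with $\mathrm{trdeg}_k Y(\mathfrak{g})=i(\mathfrak{g})$ and $c(\mathfrak{g})-c(F(\mathfrak{g}))<\deg p_{\mathfrak{g}}$.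
   Context: For $\xi\in\mathfrak{g}^*$ let $\mathfrak{g}(\xi)=\{x\in\mathfrak{g}\mid \xi([x,y])=0\ \forall y\in\mathfrak{g}\}$. The index is $i(\mathfrak{g})=\min_{\xi}\dim\mathfrak{g}(\xi)$, and $c(\mathfrak{g})=(\dim\mathfrak{g}+i(\mathfrak{g}))/2$ (the same definition applies to any Lie algebra, e.g. $\mathfrak{h}$ or $F(\mathfrak{g})$). $\mathfrak{g}^*_{\mathrm{reg}}$ is the set of $\xi\in\mathfrak{g}^*$ with $\dim\mathfrak{g}(\xi)=i(\mathfrak{g})$, and $\mathfrak{g}^*_{\mathrm{sing}}=\mathfrak{g}^*\setminus\mathfrak{g}^*_{\mathrm{reg}}$. $\mathfrak{g}$ is singular if $\mathrm{codim}\,\mathfrak{g}^*_{\mathrm{sing}}=1$ and nonsingular otherwise. The Frobenius semi-radical is $F(\mathfrak{g})=\sum_{\xi\in\mathfrak{g}^*_{\mathrm{reg}}}\mathfrak{g}(\xi)$, a characteristic ideal of $\mathfrak{g}$. $S(\mathfrak{g})=k[x_1,\dots,x_n]$ (with $x_1,\dots,x_n$ a basis of $\mathfrak{g}$) carries the Poisson bracket $\{f,g\}=\sum_{i,j}[x_i,x_j]\frac{\partial f}{\partial x_i}\frac{\partial g}{\partial x_j}$; its Poisson center is $Y(\mathfrak{g})=S(\mathfrak{g})^{\mathfrak{g}}$. A subalgebra $A$ is Poisson commutative if $\{f,g\}=0$ for all $f,g\in A$; then $\mathrm{trdeg}_k A\le c(\mathfrak{g})$, and $A$ is complete (in $S(\mathfrak{g})$)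 if equality holds. A commutative polarization (CP) of $\mathfrak{g}$ is a commutative Lie subalgebra $\mathfrak{h}$ with $\dim\mathfrak{h}=c(\mathfrak{g})$. The fundamental semi-invariant $p_{\mathfrak{g}}\in S(\mathfrak{g})$: put $t=\dim\mathfrak{g}-i(\mathfrak{g})$, the rank of the structure matrix $B=([x_i,x_j])$ over the quotient field of $S(\mathfrak{g})$; $p_{\mathfrak{g}}$ is the greatest common divisor of the Pfaffians of the principal $t\times t$ minors of $B$ (defined up to nonzero scalar; $p_{\mathfrak{g}}=1$ if $\mathfrak{g}$ is abelian). *)

theory Defs
  imports
    Complex_Main
    "HOL-Library.FuncSet"
    "HOL-Library.Extended_Nat"
    "HOL-Library.Poly_Mapping"
    "HOL-Combinatorics.Permutations"
    "HOL-Computational_Algebra.Polynomial"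
begin

section \<open>Polynomials in several variables\<close>

text \<open>
  Polynomials in the variables \<open>x\<^sub>0, x\<^sub>1, \<dots>\<close>; a monomial is its finitely supported exponent map.
\<close>

type_synonym 'k mpol = "(nat \<Rightarrow>\<^sub>0 nat) \<Rightarrow>\<^sub>0 'k"

definition mconst :: "'k::comm_ring_1 \<Rightarrow> 'k mpol" where
  "mconst c = Poly_Mapping.single 0 c"

definition mvar :: "nat \<Rightarrow> 'k::comm_ring_1 mpol" where
  "mvar i = Poly_Mapping.single (Poly_Mapping.single i 1) 1"

definition mpols_below :: "nat \<Rightarrow> 'k::comm_ring_1 mpol set" where
  "mpols_below n = {f. \<forall>m\<in>Poly_Mapping.keys f. Poly_Mapping.keys m \<subseteq> {..<n}}"

definition total_degree :: "'k::comm_ring_1 mpol \<Rightarrow> nat" where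
  "total_degree f =
     Max (insert 0 ((\<lambda>m. \<Sum>i\<in>Poly_Mapping.keys m. Poly_Mapping.lookup m i) ` Poly_Mapping.keys f))"

definition mpol_eval ::
  "('k::comm_ring_1 \<Rightarrow> 'r::comm_ring_1) \<Rightarrow> (nat \<Rightarrow> 'r) \<Rightarrow> 'k mpol \<Rightarrow> 'r" where
  "mpol_eval \<iota> v f =
     (\<Sum>m\<in>Poly_Mapping.keys f. \<iota> (Poly_Mapping.lookup f m) *
        (\<Prod>i\<in>Poly_Mapping.keys m. v i ^ Poly_Mapping.lookup m i))"

text \<open>
  The subtraction of exponent maps is truncated, but it only truncates where the coefficient
  vanishes.
\<close>

definition mpol_deriv :: "nat \<Rightarrow> 'k::comm_ring_1 mpol \<Rightarrow> 'k mpol" where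
  "mpol_deriv i f =
     (\<Sum>m\<in>Poly_Mapping.keys f.
        Poly_Mapping.single (m - Poly_Mapping.single i 1)
          (of_nat (Poly_Mapping.lookup m i) * Poly_Mapping.lookup f m))"

definition mpol_subalgebra :: "'k::comm_ring_1 mpol set \<Rightarrow> bool" where
  "mpol_subalgebra A \<longleftrightarrow>
     range mconst \<subseteq> A \<and> (\<forall>f\<in>A. \<forall>g\<in>A. f + g \<in> A \<and> f * g \<in> A)"

definition alg_independent :: "nat \<Rightarrow> (nat \<Rightarrow> 'k::comm_ring_1 mpol) \<Rightarrow> bool" where
  "alg_independent r f \<longleftrightarrow>
     (\<forall>P\<in>mpols_below r. mpol_eval mconst f P = 0 \<longrightarrow> P = 0)"

text \<open>
  The supremum is taken in the natural numbers. It is attained whenever only finitely many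
  variables occur in \<open>A\<close>, their number being an upper bound.
\<close>

definition trdeg :: "'k::field mpol set \<Rightarrow> nat" where
  "trdeg A = Sup {r. \<exists>f. (\<forall>i<r. f i \<in> A) \<and> alg_independent r f}"

text \<open>The Pfaffian of an alternating \<open>2m \<times> 2m\<close> matrix.\<close>

definition pfaffian :: "nat \<Rightarrow> (nat \<Rightarrow> nat \<Rightarrow> 'k::field_char_0 mpol) \<Rightarrow> 'k mpol" where
  "pfaffian m M =
     mconst (1 / (2 ^ m * fact m)) *
     (\<Sum>\<sigma> | \<sigma> permutes {..<2 * m}.
        of_int (sign \<sigma>) * (\<Prod>i<m. M (\<sigma> (2 * i)) (\<sigma> (2 * i + 1))))"


section \<open>Lie algebras, the index and the Frobenius semi-radical\<close>

text \<open>
  A Lie algebra is a finite dimensional subspace \<open>G\<close> of an ambient vector space, with a bracket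
  that is only constrained on \<open>G\<close>.
\<close>

locale lie_algebra = vector_space s
  for s :: "'k::field \<Rightarrow> 'a::ab_group_add \<Rightarrow> 'a" +
  fixes br :: "'a \<Rightarrow> 'a \<Rightarrow> 'a" and G :: "'a set"
  assumes subspace_G: "subspace G"
    and finite_dim_G: "\<exists>B. finite B \<and> span B = G"
    and br_closed: "x \<in> G \<Longrightarrow> y \<in> G \<Longrightarrow> br x y \<in> G"
    and br_add_left: "x \<in> G \<Longrightarrow> y \<in> G \<Longrightarrow> z \<in> G \<Longrightarrow> br (x + y) z = br x z + br y z"
    and br_add_right: "x \<in> G \<Longrightarrow> y \<in> G \<Longrightarrow> z \<in> G \<Longrightarrow> br x (y + z) = br x y + br x z"
    and br_scale_left: "x \<in> G \<Longrightarrow> y \<in> G \<Longrightarrow> br (s c x) y = s c (br x y)"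
    and br_scale_right: "x \<in> G \<Longrightarrow> y \<in> G \<Longrightarrow> br x (s c y) = s c (br x y)"
    and br_self: "x \<in> G \<Longrightarrow> br x x = 0"
    and jacobi: "x \<in> G \<Longrightarrow> y \<in> G \<Longrightarrow> z \<in> G \<Longrightarrow>
      br x (br y z) + br y (br z x) + br z (br x y) = 0"

definition lie_subalgebra ::
  "('k::field \<Rightarrow> 'a::ab_group_add \<Rightarrow> 'a) \<Rightarrow> ('a \<Rightarrow> 'a \<Rightarrow> 'a) \<Rightarrow> 'a set \<Rightarrow> 'a set \<Rightarrow> bool" where
  "lie_subalgebra s br G H \<longleftrightarrow>
     module.subspace s H \<and> H \<subseteq> G \<and> (\<forall>x\<in>H. \<forall>y\<in>H. br x y \<in> H)"

definition lie_commutative :: "('a::ab_group_add \<Rightarrow> 'a \<Rightarrow> 'a) \<Rightarrow> 'a set \<Rightarrow> bool" where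
  "lie_commutative br H \<longleftrightarrow> (\<forall>x\<in>H. \<forall>y\<in>H. br x y = 0)"

definition dual_space ::
  "('k::field \<Rightarrow> 'a::ab_group_add \<Rightarrow> 'a) \<Rightarrow> 'a set \<Rightarrow> ('a \<Rightarrow> 'k) set" where
  "dual_space s W =
     {\<xi> \<in> extensional W. (\<forall>x\<in>W. \<forall>y\<in>W. \<xi> (x + y) = \<xi> x + \<xi> y) \<and>
                        (\<forall>c. \<forall>x\<in>W. \<xi> (s c x) = c * \<xi> x)}"

definition stabilizer ::
  "('a::ab_group_add \<Rightarrow> 'a \<Rightarrow> 'a) \<Rightarrow> 'a set \<Rightarrow> ('a \<Rightarrow> 'k::field) \<Rightarrow> 'a set" where
  "stabilizer br W \<xi> = {x \<in> W. \<forall>y\<in>W. \<xi> (br x y) = 0}"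

definition lie_index ::
  "('k::field \<Rightarrow> 'a::ab_group_add \<Rightarrow> 'a) \<Rightarrow> ('a \<Rightarrow> 'a \<Rightarrow> 'a) \<Rightarrow> 'a set \<Rightarrow> nat" where
  "lie_index s br W = (INF \<xi>\<in>dual_space s W. vector_space.dim s (stabilizer br W \<xi>))"

definition lie_c ::
  "('k::field \<Rightarrow> 'a::ab_group_add \<Rightarrow> 'a) \<Rightarrow> ('a \<Rightarrow> 'a \<Rightarrow> 'a) \<Rightarrow> 'a set \<Rightarrow> real" where
  "lie_c s br W = (real (vector_space.dim s W) + real (lie_index s br W)) / 2"

definition dual_reg ::
  "('k::field \<Rightarrow> 'a::ab_group_add \<Rightarrow> 'a) \<Rightarrow> ('a \<Rightarrow> 'a \<Rightarrow> 'a) \<Rightarrow> 'a set \<Rightarrow> ('a \<Rightarrow> 'k) set" where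
  "dual_reg s br W =
     {\<xi> \<in> dual_space s W. vector_space.dim s (stabilizer br W \<xi>) = lie_index s br W}"

definition dual_sing ::
  "('k::field \<Rightarrow> 'a::ab_group_add \<Rightarrow> 'a) \<Rightarrow> ('a \<Rightarrow> 'a \<Rightarrow> 'a) \<Rightarrow> 'a set \<Rightarrow> ('a \<Rightarrow> 'k) set" where
  "dual_sing s br W = dual_space s W - dual_reg s br W"

definition frobenius_semiradical ::
  "('k::field \<Rightarrow> 'a::ab_group_add \<Rightarrow> 'a) \<Rightarrow> ('a \<Rightarrow> 'a \<Rightarrow> 'a) \<Rightarrow> 'a set \<Rightarrow> 'a set" where
  "frobenius_semiradical s br W = module.span s (\<Union>\<xi>\<in>dual_reg s br W. stabilizer br W \<xi>)"

definition commutative_polarization ::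
  "('k::field \<Rightarrow> 'a::ab_group_add \<Rightarrow> 'a) \<Rightarrow> ('a \<Rightarrow> 'a \<Rightarrow> 'a) \<Rightarrow> 'a set \<Rightarrow> 'a set \<Rightarrow> bool" where
  "commutative_polarization s br G H \<longleftrightarrow>
     lie_subalgebra s br G H \<and> lie_commutative br H \<and> real (vector_space.dim s H) = lie_c s br G"


section \<open>The symmetric algebra\<close>

definition ordered_basis ::
  "('k::field \<Rightarrow> 'a::ab_group_add \<Rightarrow> 'a) \<Rightarrow> 'a set \<Rightarrow> 'a list \<Rightarrow> bool" where
  "ordered_basis s G xs \<longleftrightarrow>
     distinct xs \<and> \<not> module.dependent s (set xs) \<and> module.span s (set xs) = G"

text \<open>The embedding of the span of \<open>xs\<close> as linear forms, sending \<open>xs ! i\<close> to the variable \<open>x\<^sub>i\<close>.\<close>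

definition lin_form ::
  "('k::field \<Rightarrow> 'a::ab_group_add \<Rightarrow> 'a) \<Rightarrow> 'a list \<Rightarrow> 'a \<Rightarrow> 'k mpol" where
  "lin_form s xs v =
     (\<Sum>i<length xs. mconst (module.representation s (set xs) v (xs ! i)) * mvar i)"

text \<open>
  For a subspace \<open>W\<close> of the Lie algebra \<open>G\<close> with basis \<open>xs\<close>, \<open>S(W)\<close> is taken inside \<open>S(G)\<close>, as the
  subalgebra generated by \<open>W\<close>. For \<open>W = G\<close> this is the full polynomial ring, see
  \<open>sym_alg_eq_mpols_below\<close> below.
\<close>

definition sym_alg ::
  "('k::field \<Rightarrow> 'a::ab_group_add \<Rightarrow> 'a) \<Rightarrow> 'a list \<Rightarrow> 'a set \<Rightarrow> 'k mpol set" where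
  "sym_alg s xs W = \<Inter>{A. mpol_subalgebra A \<and> lin_form s xs ` W \<subseteq> A}"

definition structure_matrix ::
  "('k::field \<Rightarrow> 'a::ab_group_add \<Rightarrow> 'a) \<Rightarrow> ('a \<Rightarrow> 'a \<Rightarrow> 'a) \<Rightarrow> 'a list \<Rightarrow> nat \<Rightarrow> nat \<Rightarrow> 'k mpol" where
  "structure_matrix s br xs i j = lin_form s xs (br (xs ! i) (xs ! j))"

definition poisson ::
  "('k::field \<Rightarrow> 'a::ab_group_add \<Rightarrow> 'a) \<Rightarrow> ('a \<Rightarrow> 'a \<Rightarrow> 'a) \<Rightarrow> 'a list \<Rightarrow> 'k mpol \<Rightarrow> 'k mpol \<Rightarrow> 'k mpol" where
  "poisson s br xs f g =
     (\<Sum>i<length xs. \<Sum>j<length xs. structure_matrix s br xs i j * mpol_deriv i f * mpol_deriv j g)"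

definition poisson_center ::
  "('k::field \<Rightarrow> 'a::ab_group_add \<Rightarrow> 'a) \<Rightarrow> ('a \<Rightarrow> 'a \<Rightarrow> 'a) \<Rightarrow> 'a set \<Rightarrow> 'a list \<Rightarrow> 'k mpol set" where
  "poisson_center s br G xs =
     {f \<in> sym_alg s xs G. \<forall>g\<in>sym_alg s xs G. poisson s br xs f g = 0}"

text \<open>
  For a subalgebra \<open>W\<close> of \<open>G\<close>: \<open>A\<close> is a complete Poisson commutative subalgebra of \<open>S(W)\<close>. The
  Poisson bracket of \<open>S(W)\<close> is the restriction of the one of \<open>S(G)\<close>.
\<close>

definition complete_poisson_commutative ::
  "('k::field \<Rightarrow> 'a::ab_group_add \<Rightarrow> 'a) \<Rightarrow> ('a \<Rightarrow> 'a \<Rightarrow> 'a) \<Rightarrow> 'a list \<Rightarrow> 'a set \<Rightarrow> 'k mpol set \<Rightarrow> bool" where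
  "complete_poisson_commutative s br xs W A \<longleftrightarrow>
     mpol_subalgebra A \<and> A \<subseteq> sym_alg s xs W \<and>
     (\<forall>f\<in>A. \<forall>g\<in>A. poisson s br xs f g = 0) \<and>
     real (trdeg A) = lie_c s br W"

definition principal_pfaffians ::
  "('k::field_char_0 \<Rightarrow> 'a::ab_group_add \<Rightarrow> 'a) \<Rightarrow> ('a \<Rightarrow> 'a \<Rightarrow> 'a) \<Rightarrow> 'a set \<Rightarrow> 'a list \<Rightarrow> 'k mpol set" where
  "principal_pfaffians s br G xs =
     (let t = vector_space.dim s G - lie_index s br G in
      (\<lambda>J. pfaffian (t div 2) (\<lambda>a b. structure_matrix s br xs
              (sorted_list_of_set J ! a) (sorted_list_of_set J ! b))) `
        {J. J \<subseteq> {..<length xs} \<and> card J = t})"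

text \<open>\<open>p\<close> is a greatest common divisor, which is unique up to a nonzero scalar.\<close>

definition fundamental_semi_invariant ::
  "('k::field_char_0 \<Rightarrow> 'a::ab_group_add \<Rightarrow> 'a) \<Rightarrow> ('a \<Rightarrow> 'a \<Rightarrow> 'a) \<Rightarrow> 'a set \<Rightarrow> 'a list \<Rightarrow> 'k mpol \<Rightarrow> bool" where
  "fundamental_semi_invariant s br G xs p \<longleftrightarrow>
     p \<in> sym_alg s xs G \<and>
     (\<forall>f\<in>principal_pfaffians s br G xs. p dvd f) \<and>
     (\<forall>q\<in>sym_alg s xs G. (\<forall>f\<in>principal_pfaffians s br G xs. q dvd f) \<longrightarrow> q dvd p)"


section \<open>The Zariski topology on the dual space\<close>

definition zariski_closed ::
  "('k::field \<Rightarrow> 'a::ab_group_add \<Rightarrow> 'a) \<Rightarrow> 'a set \<Rightarrow> 'a list \<Rightarrow> ('a \<Rightarrow> 'k) set \<Rightarrow> bool" where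
  "zariski_closed s G xs Z \<longleftrightarrow>
     (\<exists>I \<subseteq> sym_alg s xs G.
        Z = {\<xi> \<in> dual_space s G. \<forall>f\<in>I. mpol_eval id (\<lambda>i. \<xi> (xs ! i)) f = 0})"

definition irreducible_closed ::
  "('k::field \<Rightarrow> 'a::ab_group_add \<Rightarrow> 'a) \<Rightarrow> 'a set \<Rightarrow> 'a list \<Rightarrow> ('a \<Rightarrow> 'k) set \<Rightarrow> bool" where
  "irreducible_closed s G xs Z \<longleftrightarrow>
     zariski_closed s G xs Z \<and> Z \<noteq> {} \<and>
     (\<forall>Z1 Z2. zariski_closed s G xs Z1 \<and> zariski_closed s G xs Z2 \<and> Z = Z1 \<union> Z2
        \<longrightarrow> Z = Z1 \<or> Z = Z2)"

text \<open>
  The codimension of an irreducible closed set is the supremum of the lengths of the chains of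
  irreducible closed sets starting at it; the codimension of a closed set is the infimum of those
  of its irreducible closed subsets, in particular it is \<open>\<infinity>\<close> for the empty set.
\<close>

definition codim_irreducible ::
  "('k::field \<Rightarrow> 'a::ab_group_add \<Rightarrow> 'a) \<Rightarrow> 'a set \<Rightarrow> 'a list \<Rightarrow> ('a \<Rightarrow> 'k) set \<Rightarrow> enat" where
  "codim_irreducible s G xs Z =
     Sup {enat r |r. \<exists>C. C 0 = Z \<and> (\<forall>i\<le>r. irreducible_closed s G xs (C i)) \<and>
                        (\<forall>i<r. C i \<subset> C (Suc i))}"

definition codim ::
  "('k::field \<Rightarrow> 'a::ab_group_add \<Rightarrow> 'a) \<Rightarrow> 'a set \<Rightarrow> 'a list \<Rightarrow> ('a \<Rightarrow> 'k) set \<Rightarrow> enat" where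
  "codim s G xs Y = (INF Z\<in>{Z. irreducible_closed s G xs Z \<and> Z \<subseteq> Y}. codim_irreducible s G xs Z)"

definition lie_singular ::
  "('k::field \<Rightarrow> 'a::ab_group_add \<Rightarrow> 'a) \<Rightarrow> ('a \<Rightarrow> 'a \<Rightarrow> 'a) \<Rightarrow> 'a set \<Rightarrow> 'a list \<Rightarrow> bool" where
  "lie_singular s br G xs \<longleftrightarrow> codim s G xs (dual_sing s br G) = 1"

abbreviation lie_nonsingular ::
  "('k::field \<Rightarrow> 'a::ab_group_add \<Rightarrow> 'a) \<Rightarrow> ('a \<Rightarrow> 'a \<Rightarrow> 'a) \<Rightarrow> 'a set \<Rightarrow> 'a list \<Rightarrow> bool" where
  "lie_nonsingular s br G xs \<equiv> \<not> lie_singular s br G xs"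


section \<open>The symmetric algebra as a polynomial ring\<close>

lemma mpol_subalgebra_sum:
  assumes "mpol_subalgebra A" "\<And>i. i \<in> I \<Longrightarrow> f i \<in> A"
  shows "sum f I \<in> A"
proof -
  have "0 \<in> A"
    using assms(1) unfolding mpol_subalgebra_def mconst_def by (metis range_subsetD single_zero)
  with assms(2) show ?thesis
    by (induction I rule: infinite_finite_induct) (use assms(1) in \<open>auto simp: mpol_subalgebra_def\<close>)
qed

lemma mpol_subalgebra_prod:
  assumes "mpol_subalgebra A" "\<And>i. i \<in> I \<Longrightarrow> f i \<in> A"
  shows "prod f I \<in> A"
proof -
  have "1 \<in> A"
    using assms(1) unfolding mpol_subalgebra_def mconst_def by (metis range_subsetD single_one)
  with assms(2) show ?thesis
    by (induction I rule: infinite_finite_induct) (use assms(1) in \<open>auto simp: mpol_subalgebra_def\<close>)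
qed

lemma single_eq_prod_mvar:
  "Poly_Mapping.single m (c::'k::comm_ring_1) =
     mconst c * (\<Prod>i\<in>Poly_Mapping.keys m. \<Prod>_<Poly_Mapping.lookup m i. mvar i)"
proof -
  have pow: "(mvar i :: 'k mpol) ^ n = Poly_Mapping.single (Poly_Mapping.single i n) 1" for i n
    by (induction n) (simp_all add: mvar_def mult_single flip: single_add)
  have "(\<Prod>i\<in>I. Poly_Mapping.single (f i) (1::'k)) = Poly_Mapping.single (sum f I) 1"
    if "finite I" for I :: "nat set" and f :: "nat \<Rightarrow> nat \<Rightarrow>\<^sub>0 nat"
    using that by induction (simp_all add: mult_single)
  moreover have "(\<Sum>i\<in>Poly_Mapping.keys m. Poly_Mapping.single i (Poly_Mapping.lookup m i)) = m"
    by (rule poly_mapping_eqI)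
       (simp add: lookup_sum lookup_single when_def not_in_keys_iff_lookup_eq_zero)
  ultimately show ?thesis
    by (simp add: pow mconst_def mult_single)
qed

lemma mpol_subalgebra_mpols_below: "mpol_subalgebra (mpols_below n :: 'k::comm_ring_1 mpol set)"
proof -
  have "f + g \<in> mpols_below n" "f * g \<in> mpols_below n"
    if "f \<in> mpols_below n" "g \<in> mpols_below n" for f g :: "'k mpol"
  proof -
    show "f + g \<in> mpols_below n"
      using that keys_add[of f g] unfolding mpols_below_def by blast
    show "f * g \<in> mpols_below n"
      unfolding mpols_below_def
    proof safe
      fix m i assume "m \<in> Poly_Mapping.keys (f * g)" "i \<in> Poly_Mapping.keys m"
      moreover obtain a b where "m = a + b" "a \<in> Poly_Mapping.keys f" "b \<in> Poly_Mapping.keys g"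
        using keys_mult[of f g] calculation(1) by blast
      ultimately show "i < n"
        using that keys_add[of a b] unfolding mpols_below_def by blast
    qed
  qed
  moreover have "mconst c \<in> mpols_below n" for c :: 'k
    by (simp add: mpols_below_def mconst_def)
  ultimately show ?thesis
    by (simp add: mpol_subalgebra_def image_subset_iff)
qed

lemma (in vector_space) lin_form_basis:
  assumes "ordered_basis scale G xs" "i < length xs"
  shows "lin_form scale xs (xs ! i) = mvar i"
proof -
  have "representation (set xs) (xs ! i) (xs ! j) = (if j = i then 1 else 0)" if "j < length xs" for j
    using assms that by (auto simp: ordered_basis_def representation_basis nth_eq_iff_index_eq)
  then have "lin_form scale xs (xs ! i) = (\<Sum>j<length xs. if j = i then mvar j else 0)"
    unfolding lin_form_def by (intro sum.cong) (auto simp: mconst_def)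
  then show ?thesis using assms(2) by simp
qed

lemma (in vector_space) sym_alg_eq_mpols_below:
  assumes xs: "ordered_basis scale G xs"
  shows "sym_alg scale xs G = mpols_below (length xs)"
proof
  have "mvar i \<in> mpols_below (length xs)" if "i < length xs" for i
    using that by (auto simp: mpols_below_def mvar_def)
  then have "lin_form scale xs v \<in> mpols_below (length xs)" for v
    unfolding lin_form_def using mpol_subalgebra_mpols_below[of "length xs"]
    by (intro mpol_subalgebra_sum) (auto simp: mpol_subalgebra_def)
  then show "sym_alg scale xs G \<subseteq> mpols_below (length xs)"
    unfolding sym_alg_def using mpol_subalgebra_mpols_below by blast
next
  have "f \<in> A" if A: "mpol_subalgebra A" "lin_form scale xs ` G \<subseteq> A"
    and f: "f \<in> mpols_below (length xs)" for f A
  proof -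
    have var: "mvar i \<in> A" if "i < length xs" for i
    proof -
      have "xs ! i \<in> G" using xs that span_base[of "xs ! i" "set xs"] by (auto simp: ordered_basis_def)
      then show ?thesis using lin_form_basis[OF xs that] A(2) by (metis image_subset_iff)
    qed
    have monomial: "Poly_Mapping.single m c \<in> A" if "Poly_Mapping.keys m \<subseteq> {..<length xs}" for m c
    proof -
      have "(\<Prod>i\<in>Poly_Mapping.keys m. \<Prod>_<Poly_Mapping.lookup m i. mvar i) \<in> A"
        using var that by (intro mpol_subalgebra_prod A(1)) auto
      then show ?thesis
        using A(1) by (simp add: single_eq_prod_mvar[of m c] mpol_subalgebra_def image_subset_iff)
    qed
    have "(\<Sum>m\<in>Poly_Mapping.keys f. Poly_Mapping.single m (Poly_Mapping.lookup f m)) = f"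
      by (rule poly_mapping_eqI)
         (simp add: lookup_sum lookup_single when_def not_in_keys_iff_lookup_eq_zero)
    moreover have "(\<Sum>m\<in>Poly_Mapping.keys f. Poly_Mapping.single m (Poly_Mapping.lookup f m)) \<in> A"
      using f by (intro mpol_subalgebra_sum[OF A(1)]) (auto simp: mpols_below_def intro: monomial)
    ultimately show "f \<in> A" by simp
  qed
  then show "mpols_below (length xs) \<subseteq> sym_alg scale xs G"
    unfolding sym_alg_def by blast
qed

end

theory Submission
  imports Defs
begin

text \<open>
  For \<open>\<xi> \<in> G\<^sup>*\<close> let \<open>\<omega> = \<xi>([\<cdot>,\<cdot>])\<close> and let \<open>F\<close> be the Frobenius semi-radical. For a regular \<open>\<xi>\<close>, the form
  \<open>\<omega>\<^sup>m\<close> with \<open>2m = dim G - i(G)\<close> has the kernel \<open>G(\<xi>) \<subseteq> F\<close>, and its coordinates are the Pfaffians that define \<open>p\<^sub>G\<close>.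
  A second form with the same kernel is obtained from the power \<open>(dim F - i(F)) / 2\<close> of \<open>\<omega>\<close> by wedging with
  \<open>i(F) - i(G)\<close> forms \<open>\<xi>([X\<^sub>j,\<cdot>])\<close> and with linear forms that cut out \<open>F\<close>; its coordinates are polynomials of
  degree \<open>(dim F - i(F)) / 2 + i(F) - i(G) = m - (c(G) - c(F))\<close> in \<open>\<xi>\<close>. The two forms are proportional, so by unique
  factorisation the Pfaffians have a common divisor of degree at least \<open>c(G) - c(F)\<close>. A nonconstant common divisor
  of the Pfaffians vanishes on a hypersurface of singular functionals, so it does not exist if \<open>G\<close> is nonsingular.
  The inequality is strict for the Borel subalgebra of \<open>sl\<^sub>2\<close> acting on the abelian Lie algebra \<open>sl\<^sub>2\<close>.
\<close>

section \<open>Pfaffians of forms with additional covectors\<close>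

text \<open>Forms are handled through their values on tuples of vectors, as signed sums over
  permutations. For two forms that factor through the same quotient and have its dimension as
  degree, proportionality then means that passing to another tuple multiplies both by the same
  determinant. The factor of proportionality depends on \<xi>, so only the cross-multiplied identity
  between products of polynomials is used; it also holds at a singular \<xi>, where all the
  Pfaffians vanish. The \<open>X\<^sub>j\<close> and the equations of \<open>F\<close> are chosen at
  a single functional, regular for both \<open>G\<close> and \<open>F\<close>, and stay fixed while
  \<xi> varies: this makes the coordinates of the second form polynomial in \<xi>. Regularity gives
  \<open>G(\<xi>) \<subseteq> F\<close>, hence the equations of \<open>F\<close> vanish on the
  kernel. The comparison needs a form on \<open>F\<close>, so \<open>F\<close> must be closed under
  the bracket. It is shown to be an ideal by deforming \<xi> to first order along
  \<open>\<xi> \<circ> ad X\<close>, in place of an argument with exponentials of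
  derivations.\<close>

definition omega :: "nat \<Rightarrow> nat \<Rightarrow> 'r::comm_ring_1" where
  "omega a b = (if even a \<and> b = Suc a then 1 else if even b \<and> a = Suc b then - 1 else 0)"

text \<open>Up to a factor, the top coefficient of \<open>B\<^sup>q \<and> L\<^sub>0 \<and> \<dots> \<and> L\<^sub>r\<^sub>-\<^sub>1\<close>, where \<open>B\<close> is alternating.\<close>

definition mixpf :: "nat \<Rightarrow> nat \<Rightarrow> (nat \<Rightarrow> nat \<Rightarrow> 'r::comm_ring_1) \<Rightarrow> (nat \<Rightarrow> nat \<Rightarrow> 'r) \<Rightarrow> 'r" where
  "mixpf q r B L = (\<Sum>\<sigma> | \<sigma> permutes {..<2 * q + r}. of_int (sign \<sigma>) *
     ((\<Prod>i<q. B (\<sigma> (2 * i)) (\<sigma> (2 * i + 1))) * (\<Prod>j<r. L j (\<sigma> (2 * q + j)))))"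

lemma permutes_lessThan: "\<sigma> permutes {..<N} \<Longrightarrow> \<sigma> k < N \<longleftrightarrow> k < (N::nat)"
  using permutes_in_image[of \<sigma> "{..<N}" k] by simp

lemma mixpf_cong:
  assumes "\<And>j k. j < 2 * q + r \<Longrightarrow> k < 2 * q + r \<Longrightarrow> B j k = B' j k"
    and "\<And>i j. i < r \<Longrightarrow> j < 2 * q + r \<Longrightarrow> L i j = L' i j"
  shows "mixpf q r B L = mixpf q r B' L'"
  unfolding mixpf_def
proof (intro sum.cong refl, safe)
  fix \<sigma> assume "\<sigma> permutes {..<2 * q + r}"
  note * = permutes_lessThan[OF this]
  show "of_int (sign \<sigma>) * ((\<Prod>i<q. B (\<sigma> (2 * i)) (\<sigma> (2 * i + 1))) * (\<Prod>j<r. L j (\<sigma> (2 * q + j)))) =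
        of_int (sign \<sigma>) * ((\<Prod>i<q. B' (\<sigma> (2 * i)) (\<sigma> (2 * i + 1))) * (\<Prod>j<r. L' j (\<sigma> (2 * q + j))))"
    by (intro arg_cong2[where f="(*)"] refl prod.cong assms) (auto simp: *)
qed

lemma mixpf_permute:
  assumes \<pi>: "\<pi> permutes {..<2 * q + r}"
  shows "mixpf q r (\<lambda>j k. B (\<pi> j) (\<pi> k)) (\<lambda>i j. L i (\<pi> j)) = of_int (sign \<pi>) * mixpf q r B L"
proof -
  let ?S = "{\<sigma>. \<sigma> permutes {..<2 * q + r}}"
  let ?F = "\<lambda>\<sigma>. (\<Prod>i<q. B (\<sigma> (2 * i)) (\<sigma> (2 * i + 1))) * (\<Prod>j<r. L j (\<sigma> (2 * q + j)))"
  have "mixpf q r B L = (\<Sum>\<sigma>\<in>?S. of_int (sign (\<pi> \<circ> \<sigma>)) * ?F (\<pi> \<circ> \<sigma>))"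
    unfolding mixpf_def by (rule setum_permutations_compose_left[OF \<pi>])
  also have "\<dots> = (\<Sum>\<sigma>\<in>?S. of_int (sign \<pi>) * (of_int (sign \<sigma>) * ?F (\<pi> \<circ> \<sigma>)))"
  proof (intro sum.cong refl)
    fix \<sigma> assume "\<sigma> \<in> ?S"
    then have "sign (\<pi> \<circ> \<sigma>) = sign \<pi> * sign \<sigma>"
      using \<pi> by (auto intro!: sign_compose permutation_permutes[THEN iffD2])
    then show "of_int (sign (\<pi> \<circ> \<sigma>)) * ?F (\<pi> \<circ> \<sigma>) = of_int (sign \<pi>) * (of_int (sign \<sigma>) * ?F (\<pi> \<circ> \<sigma>))"
      by (simp add: mult.assoc)
  qed
  also have "\<dots> = of_int (sign \<pi>) * mixpf q r (\<lambda>j k. B (\<pi> j) (\<pi> k)) (\<lambda>i j. L i (\<pi> j))"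
    by (simp add: mixpf_def sum_distrib_left)
  finally have "of_int (sign \<pi>) * mixpf q r B L =
      of_int (sign \<pi> * sign \<pi>) * mixpf q r (\<lambda>j k. B (\<pi> j) (\<pi> k)) (\<lambda>i j. L i (\<pi> j))"
    by (simp only: of_int_mult mult.assoc)
  then show ?thesis by simp
qed

text \<open>Swapping two positions with equal value of \<open>f\<close> changes the sign but not the
  arguments, so the value equals its own negative. The coefficient ring has characteristic
  zero.\<close>

lemma mixpf_repeat:
  fixes B :: "nat \<Rightarrow> nat \<Rightarrow> 'r::{idom, ring_char_0}"
  assumes "\<not> inj_on f {..<2 * q + r}"
  shows "mixpf q r (\<lambda>j k. B (f j) (f k)) (\<lambda>i j. L i (f j)) = 0"
proof -
  obtain a b where ab: "a < 2 * q + r" "b < 2 * q + r" "a \<noteq> b" "f a = f b"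
    using assms by (auto simp: inj_on_def)
  let ?\<pi> = "transpose a b"
  have \<pi>: "?\<pi> permutes {..<2 * q + r}"
    using ab by (intro permutes_swap_id) auto
  have f: "f (?\<pi> j) = f j" for j
    using ab by (auto simp: transpose_def)
  show ?thesis
    using mixpf_permute[OF \<pi>, of "\<lambda>j k. B (f j) (f k)" "\<lambda>i j. L i (f j)"] ab
    by (simp add: f sign_swap_id)
qed

lemma sum_PiE_Suc:
  "(\<Sum>f\<in>PiE {..<Suc N} (\<lambda>_. A). h f) = (\<Sum>a\<in>A. \<Sum>f\<in>PiE {..<N} (\<lambda>_. A). h (f(N := a)))"
proof -
  have "PiE {..<Suc N} (\<lambda>_. A) = (\<lambda>(a, f). f(N := a)) ` (A \<times> PiE {..<N} (\<lambda>_. A))"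
    by (simp add: lessThan_Suc PiE_insert_eq)
  moreover have "inj_on (\<lambda>(a, f). f(N := a)) (A \<times> PiE {..<N} (\<lambda>_. A))"
    using inj_combinator[of N "{..<N}" "\<lambda>_. A"] by simp
  ultimately show ?thesis
    by (simp add: sum.reindex sum.cartesian_product case_prod_unfold)
qed

text \<open>Multilinear expansion of the summand for the identity permutation. A summation index is
  attached to each position, so that the choices form a single function \<open>f\<close> on the
  \<open>2 * q + r\<close> positions. The other permutations are reduced to this case by
  reindexing.\<close>

lemma prod_expand:
  fixes B0 c L0 :: "nat \<Rightarrow> nat \<Rightarrow> 'r::comm_ring_1" and A :: "nat set" and q r :: nat
  shows "(\<Prod>i<q. \<Sum>a\<in>A. \<Sum>b\<in>A. c (2 * i) a * c (2 * i + 1) b * B0 a b) *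
         (\<Prod>j<r. \<Sum>a\<in>A. c (2 * q + j) a * L0 j a) =
    (\<Sum>f\<in>PiE {..<2 * q + r} (\<lambda>_. A). (\<Prod>j<2 * q + r. c j (f j)) *
       ((\<Prod>i<q. B0 (f (2 * i)) (f (2 * i + 1))) * (\<Prod>j<r. L0 j (f (2 * q + j)))))"
proof (induction r)
  case 0
  show ?case
  proof (induction q)
    case (Suc q)
    let ?P = "PiE {..<2 * q} (\<lambda>_. A)"
    let ?g = "\<lambda>a b. c (2 * q) a * c (2 * q + 1) b * B0 a b"
    let ?h = "\<lambda>f. (\<Prod>j<2 * q. c j (f j)) * (\<Prod>i<q. B0 (f (2 * i)) (f (2 * i + 1)))"
    have "(\<Prod>i<Suc q. \<Sum>a\<in>A. \<Sum>b\<in>A. c (2 * i) a * c (2 * i + 1) b * B0 a b) =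
       (\<Sum>f\<in>?P. ?h f) * (\<Sum>a\<in>A. \<Sum>b\<in>A. ?g a b)"
      using Suc.IH by simp
    also have "\<dots> = (\<Sum>b\<in>A. \<Sum>a\<in>A. \<Sum>f\<in>?P. ?h f * ?g a b)"
      by (subst sum.swap) (simp add: sum_distrib_left sum_distrib_right sum_product)
    also have "\<dots> = (\<Sum>b\<in>A. \<Sum>a\<in>A. \<Sum>f\<in>?P. (\<Prod>j<2 * Suc q. c j ((f(2 * q := a, Suc (2 * q) := b)) j)) *
         (\<Prod>i<Suc q. B0 ((f(2 * q := a, Suc (2 * q) := b)) (2 * i)) ((f(2 * q := a, Suc (2 * q) := b)) (2 * i + 1))))"
    proof (intro sum.cong refl)
      fix a b f
      have "(\<Prod>j<2 * q. c j ((f(2 * q := a, Suc (2 * q) := b)) j)) = (\<Prod>j<2 * q. c j (f j))"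
        by (intro prod.cong) auto
      moreover have "(\<Prod>i<q. B0 ((f(2 * q := a, Suc (2 * q) := b)) (2 * i)) ((f(2 * q := a, Suc (2 * q) := b)) (2 * i + 1))) =
          (\<Prod>i<q. B0 (f (2 * i)) (f (2 * i + 1)))"
        by (intro prod.cong) auto
      ultimately show "?h f * ?g a b = (\<Prod>j<2 * Suc q. c j ((f(2 * q := a, Suc (2 * q) := b)) j)) *
         (\<Prod>i<Suc q. B0 ((f(2 * q := a, Suc (2 * q) := b)) (2 * i)) ((f(2 * q := a, Suc (2 * q) := b)) (2 * i + 1)))"
        by (simp add: mult_ac)
    qed
    also have "\<dots> = (\<Sum>f\<in>PiE {..<Suc (Suc (2 * q))} (\<lambda>_. A). (\<Prod>j<2 * Suc q. c j (f j)) *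
       (\<Prod>i<Suc q. B0 (f (2 * i)) (f (2 * i + 1))))"
      by (simp only: sum_PiE_Suc)
    finally show ?case by simp
  qed simp
next
  case (Suc r)
  let ?N = "2 * q + r"
  let ?P = "PiE {..<?N} (\<lambda>_. A)"
  let ?h = "\<lambda>f. (\<Prod>j<?N. c j (f j)) * ((\<Prod>i<q. B0 (f (2 * i)) (f (2 * i + 1))) * (\<Prod>j<r. L0 j (f (2 * q + j))))"
  have "(\<Prod>i<q. \<Sum>a\<in>A. \<Sum>b\<in>A. c (2 * i) a * c (2 * i + 1) b * B0 a b) *
      (\<Prod>j<Suc r. \<Sum>a\<in>A. c (2 * q + j) a * L0 j a) =
     (\<Sum>f\<in>?P. ?h f) * (\<Sum>a\<in>A. c ?N a * L0 r a)"
    using Suc.IH by (simp add: mult.assoc[symmetric])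
  also have "\<dots> = (\<Sum>a\<in>A. \<Sum>f\<in>?P. ?h f * (c ?N a * L0 r a))"
    by (subst sum.swap) (simp add: sum_product)
  also have "\<dots> = (\<Sum>a\<in>A. \<Sum>f\<in>?P. (\<Prod>j<Suc ?N. c j ((f(?N := a)) j)) *
       ((\<Prod>i<q. B0 ((f(?N := a)) (2 * i)) ((f(?N := a)) (2 * i + 1))) * (\<Prod>j<Suc r. L0 j ((f(?N := a)) (2 * q + j)))))"
  proof (intro sum.cong refl)
    fix a f
    have "(\<Prod>j<?N. c j ((f(?N := a)) j)) = (\<Prod>j<?N. c j (f j))"
      by (intro prod.cong) auto
    moreover have "(\<Prod>i<q. B0 ((f(?N := a)) (2 * i)) ((f(?N := a)) (2 * i + 1))) = (\<Prod>i<q. B0 (f (2 * i)) (f (2 * i + 1)))"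
      by (intro prod.cong) auto
    moreover have "(\<Prod>j<r. L0 j ((f(?N := a)) (2 * q + j))) = (\<Prod>j<r. L0 j (f (2 * q + j)))"
      by (intro prod.cong) auto
    ultimately show "?h f * (c ?N a * L0 r a) = (\<Prod>j<Suc ?N. c j ((f(?N := a)) j)) *
       ((\<Prod>i<q. B0 ((f(?N := a)) (2 * i)) ((f(?N := a)) (2 * i + 1))) * (\<Prod>j<Suc r. L0 j ((f(?N := a)) (2 * q + j))))"
      by (simp add: mult_ac)
  qed
  also have "\<dots> = (\<Sum>f\<in>PiE {..<Suc ?N} (\<lambda>_. A). (\<Prod>j<Suc ?N. c j (f j)) *
       ((\<Prod>i<q. B0 (f (2 * i)) (f (2 * i + 1))) * (\<Prod>j<Suc r. L0 j (f (2 * q + j)))))"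
    by (simp only: sum_PiE_Suc)
  finally show ?case by simp
qed

text \<open>The Cauchy-Binet formula before grouping: \<open>f\<close> runs over all functions, and
  its non-injective members contribute zero by \<open>mixpf_repeat\<close>. The same coefficients
  \<open>c\<close> occur for \<open>B\<close> and \<open>L\<close>, because both are pulled back
  along one linear map.\<close>

lemma mixpf_expand:
  fixes B :: "nat \<Rightarrow> nat \<Rightarrow> 'r::comm_ring_1" and A :: "nat set"
  assumes B: "\<And>j k. j < 2 * q + r \<Longrightarrow> k < 2 * q + r \<Longrightarrow> B j k = (\<Sum>a\<in>A. \<Sum>b\<in>A. c j a * c k b * B0 a b)"
    and L: "\<And>i j. i < r \<Longrightarrow> j < 2 * q + r \<Longrightarrow> L i j = (\<Sum>a\<in>A. c j a * L0 i a)"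
  shows "mixpf q r B L = (\<Sum>f\<in>PiE {..<2 * q + r} (\<lambda>_. A). (\<Prod>j<2 * q + r. c j (f j)) *
            mixpf q r (\<lambda>j k. B0 (f j) (f k)) (\<lambda>i j. L0 i (f j)))"
proof -
  let ?N = "2 * q + r" and ?P = "PiE {..<2 * q + r} (\<lambda>_. A)"
  let ?S = "{\<sigma>. \<sigma> permutes {..<?N}}"
  let ?F = "\<lambda>f. (\<Prod>i<q. B0 (f (2 * i)) (f (2 * i + 1))) * (\<Prod>j<r. L0 j (f (2 * q + j)))"
  have *: "(\<Prod>i<q. B (\<sigma> (2 * i)) (\<sigma> (2 * i + 1))) * (\<Prod>j<r. L j (\<sigma> (2 * q + j))) =
      (\<Sum>f\<in>?P. (\<Prod>j<?N. c j (f j)) * ?F (f \<circ> \<sigma>))" if \<sigma>: "\<sigma> permutes {..<?N}" for \<sigma>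
  proof -
    have "(\<Prod>i<q. B (\<sigma> (2 * i)) (\<sigma> (2 * i + 1))) * (\<Prod>j<r. L j (\<sigma> (2 * q + j))) =
      (\<Prod>i<q. \<Sum>a\<in>A. \<Sum>b\<in>A. c (\<sigma> (2 * i)) a * c (\<sigma> (2 * i + 1)) b * B0 a b) *
         (\<Prod>j<r. \<Sum>a\<in>A. c (\<sigma> (2 * q + j)) a * L0 j a)"
      by (intro arg_cong2[where f="(*)"] prod.cong refl B L) (auto simp: permutes_lessThan[OF \<sigma>])
    also have "\<dots> = (\<Sum>f\<in>?P. (\<Prod>j<?N. c (\<sigma> j) (f j)) * ?F f)"
      by (rule prod_expand)
    \<comment> \<open>Replacing \<open>f\<close> by \<open>f \<circ> \<sigma>\<close> puts the
      coefficients \<open>c\<close> back into the order of the positions; the dependence on \<sigma>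
      then sits in \<open>?F\<close> alone.\<close>
    also have "\<dots> = (\<Sum>f\<in>?P. (\<Prod>j<?N. c (\<sigma> j) ((f \<circ> \<sigma>) j)) * ?F (f \<circ> \<sigma>))"
    proof (rule sum.reindex_bij_witness[of _ "\<lambda>f. f \<circ> \<sigma>" "\<lambda>f. f \<circ> inv \<sigma>"])
      have [simp]: "\<sigma> (inv \<sigma> x) = x" "inv \<sigma> (\<sigma> x) = x" for x
        using permutes_inverses[OF \<sigma>] by auto
      fix f assume f: "f \<in> ?P"
      show "(f \<circ> inv \<sigma>) \<circ> \<sigma> = f" "(f \<circ> \<sigma>) \<circ> inv \<sigma> = f" by (simp_all add: fun_eq_iff)
      show "f \<circ> \<sigma> \<in> ?P"
        using f permutes_lessThan[OF \<sigma>] by (auto simp: PiE_iff extensional_def)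
      show "f \<circ> inv \<sigma> \<in> ?P"
        using f permutes_lessThan[OF permutes_inv[OF \<sigma>]] by (auto simp: PiE_iff extensional_def)
      show "(\<Prod>j<?N. c (\<sigma> j) ((f \<circ> inv \<sigma> \<circ> \<sigma>) j)) * ?F (f \<circ> inv \<sigma> \<circ> \<sigma>) = (\<Prod>j<?N. c (\<sigma> j) (f j)) * ?F f"
        by simp
    qed
    also have "\<dots> = (\<Sum>f\<in>?P. (\<Prod>j<?N. c j (f j)) * ?F (f \<circ> \<sigma>))"
    proof (intro sum.cong refl arg_cong2[where f="(*)"])
      fix f
      show "(\<Prod>j<?N. c (\<sigma> j) ((f \<circ> \<sigma>) j)) = (\<Prod>j<?N. c j (f j))"
        using prod.permute[OF \<sigma>, of "\<lambda>j. c j (f j)"] by simp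
    qed
    finally show ?thesis .
  qed
  have "mixpf q r B L = (\<Sum>\<sigma>\<in>?S. of_int (sign \<sigma>) * (\<Sum>f\<in>?P. (\<Prod>j<?N. c j (f j)) * ?F (f \<circ> \<sigma>)))"
    unfolding mixpf_def by (intro sum.cong refl arg_cong2[where f="(*)"] *) auto
  also have "\<dots> = (\<Sum>f\<in>?P. (\<Prod>j<?N. c j (f j)) * (\<Sum>\<sigma>\<in>?S. of_int (sign \<sigma>) * ?F (f \<circ> \<sigma>)))"
    by (subst (2) sum_distrib_left, subst sum_distrib_left, subst sum.swap) (simp add: mult_ac)
  finally show ?thesis by (simp add: mixpf_def)
qed

text \<open>Pigeonhole: no function from \<open>2 * q + r\<close> positions to fewer basis indices
  is injective, so all terms of the expansion vanish.\<close>

lemma mixpf_rank_less: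
  fixes B :: "nat \<Rightarrow> nat \<Rightarrow> 'r::{idom, ring_char_0}"
  assumes B: "\<And>j k. j < 2 * q + r \<Longrightarrow> k < 2 * q + r \<Longrightarrow> B j k = (\<Sum>a<T. \<Sum>b<T. c j a * c k b * B0 a b)"
    and L: "\<And>i j. i < r \<Longrightarrow> j < 2 * q + r \<Longrightarrow> L i j = (\<Sum>a<T. c j a * L0 i a)"
    and T: "T < 2 * q + r"
  shows "mixpf q r B L = 0"
proof -
  have "mixpf q r (\<lambda>j k. B0 (f j) (f k)) (\<lambda>i j. L0 i (f j)) = 0"
    if "f \<in> PiE {..<2 * q + r} (\<lambda>_. {..<T})" for f
  proof -
    have "\<not> inj_on f {..<2 * q + r}"
    proof
      assume "inj_on f {..<2 * q + r}"
      moreover have "f ` {..<2 * q + r} \<subseteq> {..<T}" using that by auto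
      ultimately have "card {..<2 * q + r} \<le> card {..<T}"
        by (intro card_inj_on_le) auto
      then show False using T by simp
    qed
    then show ?thesis by (rule mixpf_repeat)
  qed
  then show ?thesis
    by (subst mixpf_expand[OF B L]) simp_all
qed

text \<open>The determinant, as a sum over all functions because it arises from expanding a product of sums.\<close>

definition detc :: "nat \<Rightarrow> (nat \<Rightarrow> nat \<Rightarrow> 'r::comm_ring_1) \<Rightarrow> 'r" where
  "detc N c = (\<Sum>f\<in>PiE {..<N} (\<lambda>_. {..<N}). (\<Prod>j<N. c j (f j)) *
      (if inj_on f {..<N} then of_int (sign (\<lambda>j. if j < N then f j else j)) else 0))"

text \<open>Only bijections survive in the expansion, and each contributes a sign. The resulting
  factor involves \<open>c\<close> and \<open>N\<close> only, not \<open>q\<close>,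
  \<open>r\<close>, \<open>B0\<close> or \<open>L0\<close>; hence two mixed Pfaffians of different
  types on the same number of vectors scale alike.\<close>

lemma mixpf_rank_eq:
  fixes B :: "nat \<Rightarrow> nat \<Rightarrow> 'r::{idom, ring_char_0}"
  assumes N: "N = 2 * q + r"
    and B: "\<And>j k. j < N \<Longrightarrow> k < N \<Longrightarrow> B j k = (\<Sum>a<N. \<Sum>b<N. c j a * c k b * B0 a b)"
    and L: "\<And>i j. i < r \<Longrightarrow> j < N \<Longrightarrow> L i j = (\<Sum>a<N. c j a * L0 i a)"
  shows "mixpf q r B L = detc N c * mixpf q r B0 L0"
proof -
  have "mixpf q r (\<lambda>j k. B0 (f j) (f k)) (\<lambda>i j. L0 i (f j)) =
     (if inj_on f {..<N} then of_int (sign (\<lambda>j. if j < N then f j else j)) else 0) * mixpf q r B0 L0"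
    if f: "f \<in> PiE {..<N} (\<lambda>_. {..<N})" for f
  proof (cases "inj_on f {..<N}")
    case True
    \<comment> \<open>A function in \<open>PiE\<close> is undefined off its domain, while a
      permutation must be the identity there.\<close>
    let ?\<pi> = "\<lambda>j. if j < N then f j else j"
    have "f ` {..<N} = {..<N}"
      using True f by (intro endo_inj_surj) auto
    then have "bij_betw ?\<pi> {..<N} {..<N}"
      using True by (auto simp: bij_betw_def inj_on_def)
    then have "?\<pi> permutes {..<2 * q + r}"
      using N by (intro bij_imp_permutes) auto
    from mixpf_permute[OF this, of B0 L0]
    have "mixpf q r (\<lambda>j k. B0 (?\<pi> j) (?\<pi> k)) (\<lambda>i j. L0 i (?\<pi> j)) = of_int (sign ?\<pi>) * mixpf q r B0 L0" .
    moreover have "mixpf q r (\<lambda>j k. B0 (?\<pi> j) (?\<pi> k)) (\<lambda>i j. L0 i (?\<pi> j)) =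
        mixpf q r (\<lambda>j k. B0 (f j) (f k)) (\<lambda>i j. L0 i (f j))"
      by (intro mixpf_cong) (auto simp: N)
    ultimately show ?thesis using True by simp
  next
    case False
    then show ?thesis using mixpf_repeat[of f q r B0 L0] N by simp
  qed
  then show ?thesis
    using mixpf_expand[where A="{..<N}" and B=B and L=L and c=c and B0=B0 and L0=L0 and q=q and r=r] B L
    by (simp add: detc_def sum_distrib_right mult.assoc flip: N)
qed

text \<open>A nonzero term of the expansion comes from an injective \<open>f\<close>. Its image is
  \<open>J\<close>, and passing from \<open>f\<close> to the increasing enumeration of
  \<open>J\<close> costs only the sign of a permutation.\<close>

lemma mixpf_minor_nonzero:
  fixes B :: "nat \<Rightarrow> nat \<Rightarrow> 'r::{idom, ring_char_0}" and n N :: nat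
  assumes N: "N = 2 * q + r"
    and B: "\<And>j k. j < N \<Longrightarrow> k < N \<Longrightarrow> B j k = (\<Sum>a<n. \<Sum>b<n. c j a * c k b * B0 a b)"
    and L: "\<And>i j. i < r \<Longrightarrow> j < N \<Longrightarrow> L i j = (\<Sum>a<n. c j a * L0 i a)"
    and nz: "mixpf q r B L \<noteq> 0"
  obtains J where "J \<subseteq> {..<n}" "card J = N"
    "mixpf q r (\<lambda>j k. B0 (sorted_list_of_set J ! j) (sorted_list_of_set J ! k))
       (\<lambda>i j. L0 i (sorted_list_of_set J ! j)) \<noteq> 0"
proof -
  have "mixpf q r B L = (\<Sum>f\<in>PiE {..<2 * q + r} (\<lambda>_. {..<n}). (\<Prod>j<2 * q + r. c j (f j)) *
            mixpf q r (\<lambda>j k. B0 (f j) (f k)) (\<lambda>i j. L0 i (f j)))"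
    using mixpf_expand[where A="{..<n}" and B=B and L=L and c=c and B0=B0 and L0=L0 and q=q and r=r] B L
    by (simp flip: N)
  with nz have "(\<Sum>f\<in>PiE {..<2 * q + r} (\<lambda>_. {..<n}). (\<Prod>j<2 * q + r. c j (f j)) *
            mixpf q r (\<lambda>j k. B0 (f j) (f k)) (\<lambda>i j. L0 i (f j))) \<noteq> 0"
    by simp
  then obtain f where f: "f \<in> PiE {..<2 * q + r} (\<lambda>_. {..<n})"
    and "(\<Prod>j<2 * q + r. c j (f j)) * mixpf q r (\<lambda>j k. B0 (f j) (f k)) (\<lambda>i j. L0 i (f j)) \<noteq> 0"
    by (rule sum.not_neutral_contains_not_neutral)
  then have fnz: "mixpf q r (\<lambda>j k. B0 (f j) (f k)) (\<lambda>i j. L0 i (f j)) \<noteq> 0"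
    by simp
  have inj: "inj_on f {..<N}"
    using fnz mixpf_repeat[of f q r B0 L0] N by auto
  define J where "J = f ` {..<N}"
  have J: "J \<subseteq> {..<n}" "card J = N" "finite J"
    using f inj by (auto simp: J_def card_image N)
  define e where "e = (\<lambda>j. sorted_list_of_set J ! j)"
  have e: "bij_betw e {..<N} J"
    using J bij_betw_nth[of "sorted_list_of_set J" "{..<N}" J] by (auto simp: e_def[abs_def])
  define \<pi> where "\<pi> = (\<lambda>j. if j < N then inv_into {..<N} e (f j) else j)"
  have "bij_betw (inv_into {..<N} e \<circ> f) {..<N} {..<N}"
    by (rule bij_betw_trans[of f _ J]) (use inj bij_betw_inv_into[OF e] in \<open>auto simp: J_def bij_betw_def\<close>)
  then have "bij_betw \<pi> {..<N} {..<N}"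
    by (rule bij_betw_cong[THEN iffD1, rotated]) (simp add: \<pi>_def)
  then have \<pi>: "\<pi> permutes {..<2 * q + r}"
    using N by (intro bij_imp_permutes) (auto simp: \<pi>_def)
  have "e (\<pi> j) = f j" if "j < N" for j
    using that e by (auto simp: \<pi>_def J_def bij_betw_def intro!: f_inv_into_f)
  then have "mixpf q r (\<lambda>j k. B0 (f j) (f k)) (\<lambda>i j. L0 i (f j)) =
      mixpf q r (\<lambda>j k. B0 (e (\<pi> j)) (e (\<pi> k))) (\<lambda>i j. L0 i (e (\<pi> j)))"
    by (intro mixpf_cong) (auto simp: N)
  also have "\<dots> = of_int (sign \<pi>) * mixpf q r (\<lambda>j k. B0 (e j) (e k)) (\<lambda>i j. L0 i (e j))"
    by (rule mixpf_permute[OF \<pi>])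
  finally have "mixpf q r (\<lambda>j k. B0 (e j) (e k)) (\<lambda>i j. L0 i (e j)) \<noteq> 0"
    using fnz by auto
  then show ?thesis using that J by (simp add: e_def)
qed


text \<open>\<open>omega\<close> is the Gram matrix of a symplectic basis. A permutation with
  nonzero product maps each consecutive pair to a consecutive pair, possibly reversed. Permuting the
  pairs is even, and each reversal changes both the sign and one factor of the product. The
  induction moves the pair containing \<open>2 * k\<close> to the last place.\<close>

lemma mixpf_omega_term:
  assumes "\<sigma> permutes {..<2 * q}"
    and "(\<Prod>i<q. omega (\<sigma> (2 * i)) (\<sigma> (2 * i + 1)) :: 'r::idom) \<noteq> 0"
  shows "of_int (sign \<sigma>) * (\<Prod>i<q. omega (\<sigma> (2 * i)) (\<sigma> (2 * i + 1)) :: 'r) = 1"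
  using assms
proof (induction q arbitrary: \<sigma>)
  case 0
  then show ?case by simp
next
  case (Suc k)
  let ?T = "\<lambda>\<sigma>. \<Prod>i<Suc k. omega (\<sigma> (2 * i)) (\<sigma> (2 * i + 1)) :: 'r"
  let ?P = "\<lambda>\<sigma>. \<sigma> permutes {..<2 * Suc k}"
  have perm: "permutation \<sigma>" if "?P \<sigma>" for \<sigma>
    using that by (auto simp: permutation_permutes)
  have fix_last: "of_int (sign \<sigma>) * ?T \<sigma> = 1"
    if \<sigma>: "?P \<sigma>" "?T \<sigma> \<noteq> 0" "\<sigma> (2 * k) = 2 * k" for \<sigma>
  proof -
    have "omega (\<sigma> (2 * k)) (\<sigma> (2 * k + 1)) \<noteq> (0::'r)" using that(2) by simp
    then have s1: "\<sigma> (2 * k + 1) = 2 * k + 1"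
      using that(3) by (auto simp: omega_def split: if_splits) presburger
    have "\<sigma> permutes {..<2 * k}"
      unfolding permutes_def
    proof (intro conjI allI impI)
      fix x assume "x \<notin> {..<2 * k}"
      then show "\<sigma> x = x"
        using \<sigma>(1,3) s1 unfolding permutes_def
        by (cases "x = 2 * k \<or> x = 2 * k + 1") auto
    next
      show "\<exists>!x. \<sigma> x = y" for y using \<sigma>(1) by (auto simp: permutes_def)
    qed
    moreover have "(\<Prod>i<k. omega (\<sigma> (2 * i)) (\<sigma> (2 * i + 1)) :: 'r) \<noteq> 0" using that(2) by simp
    ultimately have "of_int (sign \<sigma>) * (\<Prod>i<k. omega (\<sigma> (2 * i)) (\<sigma> (2 * i + 1)) :: 'r) = 1"
      by (rule Suc.IH)
    then show ?thesis using that(3) s1 by (simp add: omega_def)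
  qed
  \<comment> \<open>The pairs in the places \<open>j\<close> and \<open>k\<close> are exchanged by
    two transpositions, an even permutation that merely reorders the factors.\<close>
  have first: "of_int (sign \<sigma>) * ?T \<sigma> = 1"
    if \<sigma>: "?P \<sigma>" "?T \<sigma> \<noteq> 0" "\<sigma> (2 * j) = 2 * k" "j \<le> k" for \<sigma> j
  proof (cases "j = k")
    case True
    then show ?thesis using fix_last \<sigma> by simp
  next
    case False
    let ?s = "transpose j k"
    let ?\<tau> = "transpose (2 * j) (2 * k) \<circ> transpose (2 * j + 1) (2 * k + 1)"
    have t: "?\<tau> (2 * i) = 2 * ?s i" "?\<tau> (2 * i + 1) = 2 * ?s i + 1" for i
      by (auto simp: transpose_def)
    have "?\<tau> permutes {..<2 * Suc k}"
      using \<sigma>(4) by (intro permutes_compose permutes_swap_id) auto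
    then have p: "?P (\<sigma> \<circ> ?\<tau>)" "permutation ?\<tau>"
      using \<sigma>(1) by (auto intro: permutes_compose perm)
    have sg: "sign ?\<tau> = 1"
      using False by (subst sign_compose) (auto simp: sign_swap_id permutation_swap_id)
    have "?s permutes {..<Suc k}" using \<sigma>(4) by (intro permutes_swap_id) auto
    then have T: "?T (\<sigma> \<circ> ?\<tau>) = ?T \<sigma>"
      using prod.permute[of ?s "{..<Suc k}" "\<lambda>i. omega (\<sigma> (2 * i)) (\<sigma> (2 * i + 1)) :: 'r"]
      by (simp only: o_def t[unfolded o_def])
    have "of_int (sign (\<sigma> \<circ> ?\<tau>)) * ?T (\<sigma> \<circ> ?\<tau>) = 1"
    proof (rule fix_last[OF p(1)])
      show "?T (\<sigma> \<circ> ?\<tau>) \<noteq> 0" unfolding T by (rule \<sigma>(2))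
      show "(\<sigma> \<circ> ?\<tau>) (2 * k) = 2 * k" using t(1)[of k] \<sigma>(3) by (simp only: o_apply transpose_apply_second)
    qed
    moreover have "sign (\<sigma> \<circ> ?\<tau>) = sign \<sigma>"
      using sign_compose[OF perm[OF \<sigma>(1)] p(2)] sg by simp
    ultimately show ?thesis by (simp only: T)
  qed
  obtain x where x: "\<sigma> x = 2 * k" "x < 2 * Suc k"
    using Suc.prems(1) permutes_lessThan[OF permutes_inv[OF Suc.prems(1)], of "2 * k"]
      permutes_inverses(1)[OF Suc.prems(1), of "2 * k"] by auto
  show ?case
  proof (cases "even x")
    case True
    then obtain j where "x = 2 * j" by (elim evenE)
    then show ?thesis using first[OF Suc.prems, of j] x by simp
  next
    case False
    then obtain j where j: "x = 2 * j + 1" by (elim oddE)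
    with x have jk: "j \<le> k" by simp
    have nz: "omega (\<sigma> (2 * i)) (\<sigma> (2 * i + 1)) \<noteq> (0::'r)" if "i < Suc k" for i
      using Suc.prems(2) that by (subst (asm) prod_zero_iff) auto
    have v: "\<sigma> (2 * j) = Suc (2 * k)"
      using nz[of j] jk x j by (auto simp: omega_def split: if_splits) presburger
    \<comment> \<open>The pair is reversed: reversing it back negates the sign of \<sigma> as well
      as the factor with index \<open>j\<close>.\<close>
    let ?\<tau> = "transpose (2 * j) (2 * j + 1)"
    have "?\<tau> permutes {..<2 * Suc k}" using jk by (intro permutes_swap_id) auto
    then have p: "?P (\<sigma> \<circ> ?\<tau>)" "permutation ?\<tau>"
      using Suc.prems(1) by (auto intro: permutes_compose perm)
    have T: "?T (\<sigma> \<circ> ?\<tau>) = - ?T \<sigma>"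
    proof -
      have split: "?T \<rho> = omega (\<rho> (2 * j)) (\<rho> (2 * j + 1)) *
          (\<Prod>i\<in>{..<Suc k} - {j}. omega (\<rho> (2 * i)) (\<rho> (2 * i + 1)))" for \<rho>
        using jk by (intro prod.remove) auto
      have "(\<Prod>i\<in>{..<Suc k} - {j}. omega ((\<sigma> \<circ> ?\<tau>) (2 * i)) ((\<sigma> \<circ> ?\<tau>) (2 * i + 1)) :: 'r) =
          (\<Prod>i\<in>{..<Suc k} - {j}. omega (\<sigma> (2 * i)) (\<sigma> (2 * i + 1)))"
      proof (intro prod.cong refl)
        fix i assume i: "i \<in> {..<Suc k} - {j}"
        then have "2 * i \<noteq> 2 * j" "2 * i + 1 \<noteq> 2 * j + 1" by auto
        moreover have "2 * i \<noteq> 2 * j + 1" "2 * i + 1 \<noteq> 2 * j" by presburger+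
        ultimately show "omega ((\<sigma> \<circ> ?\<tau>) (2 * i)) ((\<sigma> \<circ> ?\<tau>) (2 * i + 1)) = (omega (\<sigma> (2 * i)) (\<sigma> (2 * i + 1)) :: 'r)"
          by (simp only: o_apply transpose_apply_other not_False_eq_True)
      qed
      moreover have "omega ((\<sigma> \<circ> ?\<tau>) (2 * j)) ((\<sigma> \<circ> ?\<tau>) (2 * j + 1)) = (- omega (\<sigma> (2 * j)) (\<sigma> (2 * j + 1)) :: 'r)"
        using v x j by (simp add: omega_def)
      ultimately show ?thesis
        unfolding split by (simp only: minus_mult_left)
    qed
    have "of_int (sign (\<sigma> \<circ> ?\<tau>)) * ?T (\<sigma> \<circ> ?\<tau>) = 1"
    proof (rule first[OF p(1)])
      show "?T (\<sigma> \<circ> ?\<tau>) \<noteq> 0" unfolding T using Suc.prems(2) by (simp only: neg_equal_0_iff_equal not_False_eq_True)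
      show "(\<sigma> \<circ> ?\<tau>) (2 * j) = 2 * k" using x(1) j by (simp only: o_apply transpose_apply_first)
      show "j \<le> k" by (rule jk)
    qed
    moreover have "sign (\<sigma> \<circ> ?\<tau>) = - sign \<sigma>"
      using sign_compose[OF perm[OF Suc.prems(1)] p(2)] by (simp add: sign_swap_id)
    ultimately show ?thesis by (simp only: T) simp
  qed
qed

text \<open>All nonzero terms are equal to 1 and the identity is one of them, so there is no
  cancellation and the value is a positive integer.\<close>

lemma mixpf_omega_nonzero:
  "mixpf q 0 omega (L :: nat \<Rightarrow> nat \<Rightarrow> 'r::{idom, ring_char_0}) \<noteq> 0"
proof -
  let ?t = "\<lambda>\<sigma>. of_int (sign \<sigma>) * (\<Prod>i<q. omega (\<sigma> (2 * i)) (\<sigma> (2 * i + 1)) :: 'r)"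
  let ?S = "{\<sigma>. \<sigma> permutes {..<2 * q}}"
  let ?S1 = "{\<sigma>\<in>?S. ?t \<sigma> \<noteq> 0}"
  have fin: "finite ?S" by (simp add: finite_permutations)
  have "mixpf q 0 omega L = (\<Sum>\<sigma>\<in>?S. ?t \<sigma>)" by (simp add: mixpf_def)
  also have "\<dots> = (\<Sum>\<sigma>\<in>?S1. ?t \<sigma>)"
    by (intro sum.mono_neutral_right fin) auto
  also have "\<dots> = (\<Sum>\<sigma>\<in>?S1. 1)"
    by (intro sum.cong refl mixpf_omega_term) auto
  finally have "mixpf q 0 omega L = of_nat (card ?S1)" by simp
  moreover have "id \<in> ?S1"
    by (auto simp: permutes_id omega_def)
  then have "?S1 \<noteq> {}" by blast
  then have "card ?S1 > 0"
    using fin by (subst card_gt_0_iff) simp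
  ultimately show ?thesis by simp
qed

text \<open>
  In block form: if the last \<open>r\<close> vectors are dual to the \<open>r\<close> linear forms, which vanish on the first
  \<open>2q\<close> vectors, only the permutations of the first \<open>2q\<close> indices contribute.
\<close>

lemma mixpf_block:
  fixes B :: "nat \<Rightarrow> nat \<Rightarrow> 'r::comm_ring_1"
  assumes L: "\<And>i j. i < r \<Longrightarrow> j < 2 * q + r \<Longrightarrow> L i j = (if j = 2 * q + i then 1 else 0)"
  shows "mixpf q r B L = mixpf q 0 B L'"
proof -
  let ?t = "\<lambda>\<sigma>. of_int (sign \<sigma>) *
     ((\<Prod>i<q. B (\<sigma> (2 * i)) (\<sigma> (2 * i + 1))) * (\<Prod>j<r. L j (\<sigma> (2 * q + j))))"
  have sub: "{\<sigma>. \<sigma> permutes {..<2 * q}} \<subseteq> {\<sigma>. \<sigma> permutes {..<2 * q + r}}"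
    by (auto intro: permutes_subset)
  have "mixpf q r B L = (\<Sum>\<sigma> | \<sigma> permutes {..<2 * q}. ?t \<sigma>)"
    unfolding mixpf_def
  proof (intro sum.mono_neutral_right sub ballI)
    show "finite {\<sigma>. \<sigma> permutes {..<2 * q + r}}" by (simp add: finite_permutations)
    fix \<sigma> assume "\<sigma> \<in> {\<sigma>. \<sigma> permutes {..<2 * q + r}} - {\<sigma>. \<sigma> permutes {..<2 * q}}"
    then have \<sigma>: "\<sigma> permutes {..<2 * q + r}" "\<not> \<sigma> permutes {..<2 * q}" by auto
    then obtain x where "\<sigma> x \<noteq> x" "x \<ge> 2 * q"
      unfolding permutes_def by (auto simp: not_less)
    moreover have "x < 2 * q + r" using \<open>\<sigma> x \<noteq> x\<close> \<sigma>(1) by (auto simp: permutes_def not_less[symmetric])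
    ultimately have "x - 2 * q < r \<and> \<sigma> (2 * q + (x - 2 * q)) \<noteq> 2 * q + (x - 2 * q)" by auto
    then obtain j where j: "j < r" "\<sigma> (2 * q + j) \<noteq> 2 * q + j" by blast
    then have "L j (\<sigma> (2 * q + j)) = 0"
      using L[of j "\<sigma> (2 * q + j)"] permutes_lessThan[OF \<sigma>(1)] by simp
    then have "(\<Prod>j<r. L j (\<sigma> (2 * q + j))) = 0" using j by (intro prod_zero) auto
    then show "?t \<sigma> = 0" by simp
  qed
  also have "\<dots> = mixpf q 0 B L'"
    unfolding mixpf_def
  proof (intro sum.cong)
    fix \<sigma> assume "\<sigma> \<in> {\<sigma>. \<sigma> permutes {..<2 * q + 0}}"
    then have "\<sigma> (2 * q + j) = 2 * q + j" for j by (auto simp: permutes_def)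
    then have "(\<Prod>j<r. L j (\<sigma> (2 * q + j))) = 1" using L by (intro prod.neutral) auto
    then show "?t \<sigma> = of_int (sign \<sigma>) *
     ((\<Prod>i<q. B (\<sigma> (2 * i)) (\<sigma> (2 * i + 1))) * (\<Prod>j<0. L' j (\<sigma> (2 * q + j))))" by simp
  qed simp
  finally show ?thesis .
qed

section \<open>Alternating forms on finite dimensional spaces\<close>

text \<open>In contrast to \<open>dual_space\<close> there is no condition outside \<open>V\<close>,
  so that maps such as \<open>\<lambda>x. \<xi> (br X x)\<close> and restrictions to smaller
  subspaces qualify without modification.\<close>

definition linfun :: "('k::field \<Rightarrow> 'a::ab_group_add \<Rightarrow> 'a) \<Rightarrow> 'a set \<Rightarrow> ('a \<Rightarrow> 'k) \<Rightarrow> bool" where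
  "linfun s V f \<longleftrightarrow> (\<forall>x\<in>V. \<forall>y\<in>V. f (x + y) = f x + f y) \<and> (\<forall>c. \<forall>x\<in>V. f (s c x) = c * f x)"

lemma linfun_mono: "linfun s V f \<Longrightarrow> U \<subseteq> V \<Longrightarrow> linfun s U f"
  unfolding linfun_def by blast

definition altform :: "('k::field \<Rightarrow> 'a::ab_group_add \<Rightarrow> 'a) \<Rightarrow> 'a set \<Rightarrow> ('a \<Rightarrow> 'a \<Rightarrow> 'k) \<Rightarrow> bool" where
  "altform s V \<beta> \<longleftrightarrow> (\<forall>x\<in>V. linfun s V (\<beta> x)) \<and> (\<forall>y\<in>V. linfun s V (\<lambda>x. \<beta> x y)) \<and> (\<forall>x\<in>V. \<beta> x x = 0)"

text \<open>
  \<open>U\<close> is the common kernel in \<open>V\<close> of \<open>l\<close> linear forms that have a dual family of vectors, so that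
  \<open>V\<close> is the direct sum of \<open>U\<close> and the span of these vectors.
\<close>

definition dual_system :: "('k::field \<Rightarrow> 'a::ab_group_add \<Rightarrow> 'a) \<Rightarrow> 'a set \<Rightarrow> 'a set \<Rightarrow> nat \<Rightarrow>
    (nat \<Rightarrow> 'a) \<Rightarrow> (nat \<Rightarrow> 'a \<Rightarrow> 'k) \<Rightarrow> bool" where
  "dual_system s V U l y \<zeta> \<longleftrightarrow> (\<forall>j<l. y j \<in> V \<and> linfun s V (\<zeta> j)) \<and>
     (\<forall>j<l. \<forall>k<l. \<zeta> j (y k) = (if j = k then 1 else 0)) \<and> U = {x\<in>V. \<forall>j<l. \<zeta> j x = 0}"

text \<open>The ambient space may be infinite dimensional, so finiteness is a property of each
  subspace.\<close>

definition fin_dim :: "('k::field \<Rightarrow> 'a::ab_group_add \<Rightarrow> 'a) \<Rightarrow> 'a set \<Rightarrow> bool" where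
  "fin_dim s V \<longleftrightarrow> (\<exists>B. finite B \<and> V \<subseteq> module.span s B)"

definition radical :: "'a set \<Rightarrow> ('a \<Rightarrow> 'a \<Rightarrow> 'k::zero) \<Rightarrow> 'a set" where
  "radical V \<beta> = {x\<in>V. \<forall>y\<in>V. \<beta> x y = 0}"

text \<open>The functional dual to \<open>w a\<close> when the Gram matrix of \<open>w\<close> is
  \<open>omega\<close>: pairing with the partner of \<open>w a\<close>, with a sign for odd
  \<open>a\<close>.\<close>

definition darboux_coord :: "('a \<Rightarrow> 'a \<Rightarrow> 'k::comm_ring_1) \<Rightarrow> (nat \<Rightarrow> 'a) \<Rightarrow> nat \<Rightarrow> 'a \<Rightarrow> 'k" where
  "darboux_coord \<beta> w a x = (if even a then \<beta> x (w (a + 1)) else - \<beta> x (w (a - 1)))"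

lemma exists_greatest_nat:
  assumes "P (k::nat)" "\<And>l. P l \<Longrightarrow> l \<le> N"
  shows "\<exists>l. P l \<and> (\<forall>m. P m \<longrightarrow> m \<le> l)"
  using GreatestI_nat[of P k N] Greatest_le_nat[of P _ N] assms by blast

lemma dual_systemD:
  assumes "dual_system s V U l y \<zeta>"
  shows "j < l \<Longrightarrow> y j \<in> V" "j < l \<Longrightarrow> linfun s V (\<zeta> j)"
    "j < l \<Longrightarrow> k < l \<Longrightarrow> \<zeta> j (y k) = (if j = k then 1 else 0)"
    "U = {x\<in>V. \<forall>j<l. \<zeta> j x = 0}"
  using assms by (simp_all add: dual_system_def)

context vector_space begin

lemma fin_dim_subset: "fin_dim scale V \<Longrightarrow> U \<subseteq> V \<Longrightarrow> fin_dim scale U"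
  unfolding fin_dim_def by blast

lemma linfun_zero:
  assumes "subspace V" "linfun scale V f" shows "f 0 = 0"
  using assms subspace_0[of V] unfolding linfun_def by (metis mult_zero_left scale_zero_left)

lemma linfun_minus:
  assumes "subspace V" "linfun scale V f" "x \<in> V" "y \<in> V" shows "f (x - y) = f x - f y"
proof -
  have "f (x + scale (-1) y) = f x + (-1) * f y"
    using assms subspace_scale[OF assms(1)] unfolding linfun_def by (metis (no_types))
  then show ?thesis by simp
qed

lemma linfun_sum:
  assumes V: "subspace V" "linfun scale V f" and y: "\<And>i. i \<in> I \<Longrightarrow> y i \<in> V"
  shows "f (\<Sum>i\<in>I. scale (c i) (y i)) = (\<Sum>i\<in>I. c i * f (y i))"
  using y
proof (induction I rule: infinite_finite_induct)
  case (insert i I)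
  have "(\<Sum>i\<in>I. scale (c i) (y i)) \<in> V" "scale (c i) (y i) \<in> V"
    using insert.prems V(1) by (auto intro!: subspace_sum subspace_scale)
  then show ?case using insert V(2) unfolding linfun_def by simp
qed (simp_all add: linfun_zero[OF V])

lemma independent_card_le:
  assumes "fin_dim scale V" "independent B" "B \<subseteq> V"
  shows "finite B" "card B \<le> dim V"
proof -
  obtain A where A: "A \<subseteq> V" "independent A" "V \<subseteq> span A" "card A = dim V"
    by (rule basis_exists)
  obtain C where C: "finite C" "V \<subseteq> span C" using assms(1) by (auto simp: fin_dim_def)
  have "finite A" using independent_span_bound[OF C(1) A(2)] A(1) C(2) by blast
  then show "finite B" "card B \<le> dim V"
    using independent_span_bound[of A B] A assms by auto
qed

lemma dim_mono_fin: "fin_dim scale V \<Longrightarrow> U \<subseteq> V \<Longrightarrow> dim U \<le> dim V"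
  by (metis basis_exists independent_card_le(2) order_trans)

text \<open>A basis of \<open>U\<close> together with \<open>v\<close> is extended to a basis of the
  whole ambient space; \<open>f\<close> is the coordinate of \<open>v\<close>.\<close>

lemma separating_functional:
  assumes U: "subspace U" and v: "v \<notin> U"
  obtains f where "linfun scale UNIV f" "\<And>u. u \<in> U \<Longrightarrow> f u = 0" "f v = 1"
proof -
  obtain B where B: "B \<subseteq> U" "independent B" "U \<subseteq> span B" using basis_exists[of U] by metis
  have sB: "span B = U" using B U span_subspace by blast
  have "independent (insert v B)" using B(2) v sB by (intro independent_insertI) auto
  then obtain C where C: "insert v B \<subseteq> C" "independent C" "UNIV \<subseteq> span C"
    by (metis maximal_independent_subset_extend subset_UNIV)
  define f where "f = (\<lambda>x. representation C x v)"
  have lin: "linfun scale UNIV f"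
    using C(3) by (auto simp: linfun_def f_def representation_add[OF C(2)] representation_scale[OF C(2)] subset_iff)
  moreover have "f u = 0" if "u \<in> U" for u
  proof -
    have "u \<in> span B" using that sB by simp
    then show ?thesis
    proof (induction rule: span_induct_alt)
      case base
      show ?case by (simp add: f_def representation_zero)
    next
      case (step c x y)
      have "x \<noteq> v" using step(1) B(1) v by auto
      then have "f x = 0" using step(1) C by (auto simp: f_def representation_basis)
      then show ?case using lin step by (simp add: linfun_def)
    qed
  qed
  moreover have "f v = 1" using C by (simp add: f_def representation_basis)
  ultimately show ?thesis using that by blast
qed

lemma subspace_kernels:
  assumes "subspace V" "\<And>j. P j \<Longrightarrow> linfun scale V (f j)"
  shows "subspace {x\<in>V. \<forall>j. P j \<longrightarrow> f j x = 0}"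
  using assms linfun_zero[OF assms(1)]
  by (intro subspaceI) (auto simp: linfun_def subspace_0 subspace_add subspace_scale)

lemma dim_hyperplane:
  assumes V: "subspace V" "fin_dim scale V" and f: "linfun scale V f" and y: "y \<in> V" "f y = 1"
  shows "dim V = dim {x\<in>V. f x = 0} + 1"
proof -
  let ?U = "{x\<in>V. f x = 0}"
  have U: "subspace ?U" using subspace_kernels[of V "\<lambda>_. True" "\<lambda>_. f"] V f by simp
  obtain B where B: "B \<subseteq> ?U" "independent B" "?U \<subseteq> span B" "card B = dim ?U"
    by (rule basis_exists)
  have sB: "span B = ?U" using B U span_subspace by blast
  have fB: "finite B" using independent_card_le[OF V(2) B(2)] B(1) by auto
  have nin: "y \<notin> span B" using y sB by simp
  have ind: "independent (insert y B)" using nin B(2) by (rule independent_insertI)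
  have "x \<in> span (insert y B)" if "x \<in> V" for x
  proof -
    have "f (x - scale (f x) y) = 0"
      using that y V f by (subst linfun_minus[OF V(1) f]) (auto simp: linfun_def subspace_scale)
    then have "x - scale (f x) y \<in> span B"
      using that y V by (simp add: sB subspace_diff subspace_scale)
    then show ?thesis by (auto simp: span_insert)
  qed
  then have "card (insert y B) = dim V"
    using B(1) y ind by (intro basis_card_eq_dim) auto
  moreover have "y \<notin> B" using nin span_base by blast
  ultimately show ?thesis using B(4) fB by simp
qed

lemma dim_dual_system:
  assumes V: "subspace V" "fin_dim scale V" and ds: "dual_system scale V U l y \<zeta>"
  shows "dim V = dim U + l"
  using ds
proof (induction l arbitrary: U)
  case 0
  then show ?case by (simp add: dual_system_def)
next
  case (Suc l)
  let ?W = "{x\<in>V. \<forall>j. j < l \<longrightarrow> \<zeta> j x = 0}"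
  have y: "y j \<in> V" and \<zeta>: "linfun scale V (\<zeta> j)" if "j < Suc l" for j
    using Suc.prems that by (simp_all add: dual_system_def)
  have yy: "\<zeta> j (y k) = (if j = k then 1 else 0)" if "j < Suc l" "k < Suc l" for j k
    using Suc.prems that by (simp add: dual_system_def)
  have U: "U = {x\<in>V. \<forall>j<Suc l. \<zeta> j x = 0}"
    using Suc.prems by (simp add: dual_system_def)
  have "dual_system scale V ?W l y \<zeta>" using y \<zeta> yy by (simp add: dual_system_def)
  then have 1: "dim V = dim ?W + l" by (rule Suc.IH)
  have W: "subspace ?W"
    using \<zeta> by (intro subspace_kernels V) simp
  have "dim ?W = dim {x\<in>?W. \<zeta> l x = 0} + 1"
  proof (rule dim_hyperplane[OF W])
    show "fin_dim scale ?W" using V(2) by (rule fin_dim_subset) auto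
    show "linfun scale ?W (\<zeta> l)"
      by (rule linfun_mono[OF \<zeta>]) auto
    show "y l \<in> ?W" "\<zeta> l (y l) = 1" using y yy by simp_all
  qed
  moreover have "{x\<in>?W. \<zeta> l x = 0} = U"
    unfolding U by (auto simp: less_Suc_eq)
  ultimately show ?case using 1 by simp
qed

text \<open>Each equation lowers the dimension by at most one. The forms may be dependent, so unlike
  in \<open>dim_dual_system\<close> only an inequality remains.\<close>

lemma dim_kernels_ge:
  assumes V: "subspace V" "fin_dim scale V" and f: "\<And>j. j < l \<Longrightarrow> linfun scale V (f j)"
  shows "dim V \<le> dim {x\<in>V. \<forall>j. j < l \<longrightarrow> f j x = 0} + l"
  using f
proof (induction l)
  case (Suc l)
  let ?W = "{x\<in>V. \<forall>j. j < l \<longrightarrow> f j x = 0}"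
  have 1: "dim V \<le> dim ?W + l" using Suc by simp
  have W: "subspace ?W"
    using Suc.prems by (intro subspace_kernels V) auto
  have lf: "linfun scale ?W (f l)" using Suc.prems[of l] by (rule linfun_mono) auto
  have fd: "fin_dim scale ?W" using V(2) by (rule fin_dim_subset) auto
  have eq: "{x\<in>?W. f l x = 0} = {x\<in>V. \<forall>j. j < Suc l \<longrightarrow> f j x = 0}"
    by (auto simp: less_Suc_eq)
  have "dim ?W \<le> dim {x\<in>?W. f l x = 0} + 1"
  proof (cases "\<forall>x\<in>?W. f l x = 0")
    case True
    then have "{x\<in>?W. f l x = 0} = ?W" by blast
    then show ?thesis by (simp only: le_add1)
  next
    case False
    then obtain x where x: "x \<in> ?W" "f l x \<noteq> 0" by blast
    have "scale (1 / f l x) x \<in> ?W" using x(1) by (rule subspace_scale[OF W])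
    moreover have "f l (scale (1 / f l x) x) = (1 / f l x) * f l x"
      using lf x unfolding linfun_def by blast
    then have "f l (scale (1 / f l x) x) = 1" using x(2) by simp
    ultimately have "dim ?W = dim {x\<in>?W. f l x = 0} + 1" by (rule dim_hyperplane[OF W fd lf])
    then show ?thesis by (rule eq_refl)
  qed
  then show ?case using 1 unfolding eq by linarith
qed simp

lemma dual_system_remainder:
  assumes V: "subspace V" and ds: "dual_system scale V U l y \<zeta>" and x: "x \<in> V"
  shows "x - (\<Sum>a<l. scale (\<zeta> a x) (y a)) \<in> U"
proof -
  note y = dual_systemD(1)[OF ds] and \<zeta> = dual_systemD(2)[OF ds] and yy = dual_systemD(3)[OF ds]
  have S: "(\<Sum>a<l. scale (\<zeta> a x) (y a)) \<in> V"
    by (intro subspace_sum subspace_scale V y) simp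
  have "\<zeta> j (x - (\<Sum>a<l. scale (\<zeta> a x) (y a))) = 0" if "j < l" for j
  proof -
    have "\<zeta> j (\<Sum>a<l. scale (\<zeta> a x) (y a)) = (\<Sum>a<l. \<zeta> a x * \<zeta> j (y a))"
      using y by (intro linfun_sum[OF V \<zeta>[OF that]]) simp
    also have "\<dots> = (\<Sum>a<l. if a = j then \<zeta> a x else 0)"
      using that by (intro sum.cong) (simp_all add: yy)
    finally show ?thesis using that x S by (simp add: linfun_minus[OF V \<zeta>[OF that]])
  qed
  moreover have "x - (\<Sum>a<l. scale (\<zeta> a x) (y a)) \<in> V" using S x V by (simp add: subspace_diff)
  ultimately show ?thesis by (simp add: dual_systemD(4)[OF ds])
qed

lemma dual_system_expand:
  assumes V: "subspace V" and ds: "dual_system scale V U l y \<zeta>" and x: "x \<in> V"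
    and f: "linfun scale V f" "\<And>u. u \<in> U \<Longrightarrow> f u = 0"
  shows "f x = (\<Sum>a<l. \<zeta> a x * f (y a))"
proof -
  note y = dual_systemD(1)[OF ds]
  have S: "(\<Sum>a<l. scale (\<zeta> a x) (y a)) \<in> V"
    by (intro subspace_sum subspace_scale V y) simp
  have "f x - f (\<Sum>a<l. scale (\<zeta> a x) (y a)) = 0"
    using f(2)[OF dual_system_remainder[OF V ds x]] by (simp add: linfun_minus[OF V f(1) x S])
  also have "f (\<Sum>a<l. scale (\<zeta> a x) (y a)) = (\<Sum>a<l. \<zeta> a x * f (y a))"
    using y by (intro linfun_sum[OF V f(1)]) simp
  finally show ?thesis by simp
qed

lemma dual_system_expand2:
  assumes V: "subspace V" and ds: "dual_system scale V U l y \<zeta>" and x: "x \<in> V" "x' \<in> V"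
    and \<beta>: "\<And>v. v \<in> V \<Longrightarrow> linfun scale V (\<beta> v)" "\<And>v. v \<in> V \<Longrightarrow> linfun scale V (\<lambda>u. \<beta> u v)"
    and 0: "\<And>u v. u \<in> U \<Longrightarrow> v \<in> V \<Longrightarrow> \<beta> u v = 0" "\<And>u v. u \<in> U \<Longrightarrow> v \<in> V \<Longrightarrow> \<beta> v u = 0"
  shows "\<beta> x x' = (\<Sum>a<l. \<Sum>b<l. \<zeta> a x * \<zeta> b x' * \<beta> (y a) (y b))"
proof -
  have "\<beta> x x' = (\<Sum>a<l. \<zeta> a x * \<beta> (y a) x')"
    using dual_system_expand[OF V ds x(1) \<beta>(2)[OF x(2)]] 0(1) x(2) by simp
  also have "\<dots> = (\<Sum>a<l. \<zeta> a x * (\<Sum>b<l. \<zeta> b x' * \<beta> (y a) (y b)))"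
  proof (intro sum.cong refl)
    fix a assume "a \<in> {..<l}"
    then have "y a \<in> V" using dual_systemD(1)[OF ds] by simp
    then show "\<zeta> a x * \<beta> (y a) x' = \<zeta> a x * (\<Sum>b<l. \<zeta> b x' * \<beta> (y a) (y b))"
      using dual_system_expand[OF V ds x(2) \<beta>(1)] 0(2) by simp
  qed
  finally show ?thesis by (simp add: sum_distrib_left mult.assoc)
qed

text \<open>A dual system with functionals from \<Lambda> of maximal length has the right kernel: a
  functional of \<Lambda> that does not vanish on its kernel could be orthogonalized and appended.
  Closure of \<Lambda> is required only up to agreement on \<open>V\<close>, which suits families
  like \<open>\<beta> u\<close> with \<open>u\<close> in a subspace.\<close>

lemma dual_system_of_functionals:
  assumes V: "subspace V" "fin_dim scale V"
    and \<Lambda>: "\<And>f. f \<in> \<Lambda> \<Longrightarrow> linfun scale V f"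
    and cl: "\<And>f g c d. f \<in> \<Lambda> \<Longrightarrow> g \<in> \<Lambda> \<Longrightarrow> \<exists>h\<in>\<Lambda>. \<forall>x\<in>V. h x = c * f x + d * g x"
  obtains l y \<zeta> where "dual_system scale V {x\<in>V. \<forall>f\<in>\<Lambda>. f x = 0} l y \<zeta>" "\<And>j. j < l \<Longrightarrow> \<zeta> j \<in> \<Lambda>"
proof -
  define P where "P l \<longleftrightarrow> (\<exists>y \<zeta>. dual_system scale V {x\<in>V. \<forall>j<l. \<zeta> j x = 0} l y \<zeta> \<and> (\<forall>j<l. \<zeta> j \<in> \<Lambda>))" for l
  have "P 0" by (simp add: P_def dual_system_def)
  moreover have "l \<le> dim V" if "P l" for l
  proof -
    from that obtain y \<zeta> where "dual_system scale V {x\<in>V. \<forall>j<l. \<zeta> j x = 0} l y \<zeta>"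
      unfolding P_def by blast
    from dim_dual_system[OF V this] show ?thesis by linarith
  qed
  ultimately have "\<exists>l. P l \<and> (\<forall>m. P m \<longrightarrow> m \<le> l)" by (rule exists_greatest_nat)
  then obtain l where "P l" and max: "\<And>k. P k \<Longrightarrow> k \<le> l" by blast
  then obtain y \<zeta> where ds: "dual_system scale V {x\<in>V. \<forall>j<l. \<zeta> j x = 0} l y \<zeta>" and \<zeta>: "\<And>j. j < l \<Longrightarrow> \<zeta> j \<in> \<Lambda>"
    unfolding P_def by blast
  have "f x = 0" if x: "x \<in> V" "\<And>j. j < l \<Longrightarrow> \<zeta> j x = 0" and f: "f \<in> \<Lambda>" for x f
  proof (rule ccontr)
    assume nz: "f x \<noteq> 0"
    \<comment> \<open>The orthogonalized functional is built one summand at a time, since closure of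
      \<Lambda> is given for combinations of two members.\<close>
    have "\<exists>h\<in>\<Lambda>. \<forall>v\<in>V. h v = f v - (\<Sum>j<m. f (y j) * \<zeta> j v)" if "m \<le> l" for m
      using that
    proof (induction m)
      case (Suc m)
      then obtain h where h: "h \<in> \<Lambda>" "\<forall>v\<in>V. h v = f v - (\<Sum>j<m. f (y j) * \<zeta> j v)" by auto
      have "\<zeta> m \<in> \<Lambda>" using Suc.prems by (intro \<zeta>) simp
      from cl[OF h(1) this, of 1 "- f (y m)"]
      obtain h' where "h' \<in> \<Lambda>" "\<forall>v\<in>V. h' v = 1 * h v + - f (y m) * \<zeta> m v" by blast
      then show ?case using h(2) by (intro bexI[of _ h']) simp_all
    qed (use f in auto)
    then obtain h where h: "h \<in> \<Lambda>" "\<And>v. v \<in> V \<Longrightarrow> h v = f v - (\<Sum>j<l. f (y j) * \<zeta> j v)" by blast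
    obtain g where g: "g \<in> \<Lambda>" "\<And>v. v \<in> V \<Longrightarrow> g v = (1 / f x) * h v + 0 * h v"
      using cl[OF h(1) h(1)] by blast
    have gx: "g x = 1" using g(2)[OF x(1)] h(2)[OF x(1)] x(2) nz by simp
    have gy: "g (y k) = 0" if "k < l" for k
    proof -
      have yk: "y k \<in> V" using dual_systemD(1)[OF ds that] .
      have "(\<Sum>j<l. f (y j) * \<zeta> j (y k)) = (\<Sum>j<l. if j = k then f (y j) else 0)"
        using that by (intro sum.cong) (simp_all add: dual_systemD(3)[OF ds])
      then show ?thesis using g(2)[OF yk] h(2)[OF yk] that by simp
    qed
    have "dual_system scale V {x\<in>V. \<forall>j<Suc l. (\<zeta>(l := g)) j x = 0} (Suc l) (y(l := x)) (\<zeta>(l := g))"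
      unfolding dual_system_def
    proof (intro conjI allI impI refl)
      fix j k assume jk: "j < Suc l" "k < Suc l"
      show "(y(l := x)) j \<in> V" using jk dual_systemD(1)[OF ds] x by (auto simp: less_Suc_eq)
      show "linfun scale V ((\<zeta>(l := g)) j)" using jk dual_systemD(2)[OF ds] \<Lambda>[OF g(1)] by (auto simp: less_Suc_eq)
      show "(\<zeta>(l := g)) j ((y(l := x)) k) = (if j = k then 1 else 0)"
        using jk dual_systemD(3)[OF ds, of j k] x gx gy by (auto simp: less_Suc_eq)
    qed
    then have "P (Suc l)" unfolding P_def using \<zeta> g(1)
      by (intro exI[of _ "y(l := x)"] exI[of _ "\<zeta>(l := g)"] conjI) (auto simp: less_Suc_eq)
    from max[OF this] show False by simp
  qed
  then have "{x\<in>V. \<forall>j<l. \<zeta> j x = 0} = {x\<in>V. \<forall>f\<in>\<Lambda>. f x = 0}" using \<zeta> by auto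
  from ds[unfolded this] \<zeta> show ?thesis by (rule that)
qed

lemma dual_system_exists:
  assumes V: "subspace V" "fin_dim scale V" and U: "subspace U" "U \<subseteq> V"
  obtains l y \<zeta> where "dual_system scale V U l y \<zeta>"
proof -
  let ?\<Lambda> = "{f. linfun scale V f \<and> (\<forall>u\<in>U. f u = 0)}"
  have "\<exists>h\<in>?\<Lambda>. \<forall>x\<in>V. h x = c * f x + d * g x" if "f \<in> ?\<Lambda>" "g \<in> ?\<Lambda>" for f g c d
    using that by (intro bexI[of _ "\<lambda>x. c * f x + d * g x"]) (auto simp: linfun_def algebra_simps)
  then obtain l y \<zeta> where ds: "dual_system scale V {x\<in>V. \<forall>f\<in>?\<Lambda>. f x = 0} l y \<zeta>"
    by (rule dual_system_of_functionals[OF V, of ?\<Lambda>, rotated]) auto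
  have "x \<in> U" if "x \<in> V" "\<forall>f\<in>?\<Lambda>. f x = 0" for x
  proof (rule ccontr)
    assume "x \<notin> U"
    then obtain f where "linfun scale UNIV f" "\<And>u. u \<in> U \<Longrightarrow> f u = 0" "f x = 1"
      using separating_functional[OF U(1)] by blast
    then show False using that linfun_mono[of scale UNIV f V] by auto
  qed
  then have "{x\<in>V. \<forall>f\<in>?\<Lambda>. f x = 0} = U" using U(2) by auto
  then show ?thesis using ds that by metis
qed

lemma subspace_eq_dim:
  assumes V: "subspace V" "fin_dim scale V" and U: "subspace U" "U \<subseteq> V" and d: "dim V \<le> dim U"
  shows "U = V"
proof -
  obtain l y \<zeta> where ds: "dual_system scale V U l y \<zeta>" using dual_system_exists[OF V U] .
  then have "l = 0" using dim_dual_system[OF V ds] d by simp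
  then show ?thesis using ds by (simp add: dual_system_def)
qed

section \<open>Darboux bases and isotropic subspaces\<close>

lemma altform_antisym:
  assumes "subspace V" "altform scale V \<beta>" "x \<in> V" "y \<in> V" shows "\<beta> y x = - \<beta> x y"
proof -
  have xy: "x + y \<in> V" using assms by (simp add: subspace_add)
  have "0 = \<beta> (x + y) (x + y)" using assms(2) xy by (simp add: altform_def)
  also have "\<dots> = \<beta> x (x + y) + \<beta> y (x + y)"
    using assms xy unfolding altform_def linfun_def by (metis (no_types, lifting))
  also have "\<dots> = \<beta> x x + \<beta> x y + (\<beta> y x + \<beta> y y)"
    using assms by (simp add: altform_def linfun_def)
  finally show ?thesis using assms by (simp add: altform_def eq_neg_iff_add_eq_0 add.commute)
qed

lemma darboux_dual_system:
  assumes \<beta>: "altform scale V \<beta>" and w: "\<And>a. a < 2 * q \<Longrightarrow> w a \<in> V"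
    and om: "\<And>a b. a < 2 * q \<Longrightarrow> b < 2 * q \<Longrightarrow> \<beta> (w a) (w b) = omega a b"
  shows "dual_system scale V {x\<in>V. \<forall>a<2*q. darboux_coord \<beta> w a x = 0} (2 * q) w (darboux_coord \<beta> w)"
proof -
  have "linfun scale V (darboux_coord \<beta> w a)" if "a < 2 * q" for a
  proof -
    have "a + 1 < 2 * q" if "even a" using \<open>a < 2 * q\<close> that by presburger
    then show ?thesis
      using w that \<beta> by (auto simp: darboux_coord_def linfun_def altform_def)
  qed
  moreover have "darboux_coord \<beta> w a (w b) = (if a = b then 1 else 0)" if "a < 2 * q" "b < 2 * q" for a b
  proof (cases "even a")
    case True
    then have "a + 1 < 2 * q" using that(1) by presburger
    then show ?thesis using True that om by (auto simp: darboux_coord_def omega_def)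
  next
    case False
    then obtain a' where "a = Suc a'" "even a'" by (metis even_Suc not0_implies_Suc even_zero)
    then show ?thesis using that om by (auto simp: darboux_coord_def omega_def)
  qed
  ultimately show ?thesis using w by (auto simp: dual_system_def)
qed

lemma darboux_coord_perp:
  assumes "\<And>a. a < 2 * q \<Longrightarrow> darboux_coord \<beta> w a x = 0" "b < 2 * q"
  shows "\<beta> x (w b) = 0"
proof (cases "even b")
  case True
  then have "b + 1 < 2 * q" using assms(2) by presburger
  then have "darboux_coord \<beta> w (b + 1) x = 0" using assms(1) by blast
  then show ?thesis using True by (simp add: darboux_coord_def)
next
  case False
  then have "odd b" "b - 1 < 2 * q" "Suc (b - 1) = b" using assms(2) by (auto simp: odd_pos)
  moreover from this have "darboux_coord \<beta> w (b - 1) x = 0" using assms(1) by blast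
  ultimately show ?thesis by (simp add: darboux_coord_def)
qed

text \<open>Take a hyperbolic system of maximal length. Its orthogonal complement \<open>?K\<close>
  contains the radical; if it were larger, it would contain two vectors with pairing 1, which
  prolong the system.\<close>

lemma darboux_basis:
  assumes V: "subspace V" "fin_dim scale V" and \<beta>: "altform scale V \<beta>"
  obtains q w where "\<And>a. a < 2 * q \<Longrightarrow> w a \<in> V"
    "\<And>a b. a < 2 * q \<Longrightarrow> b < 2 * q \<Longrightarrow> \<beta> (w a) (w b) = omega a b"
    "dual_system scale V (radical V \<beta>) (2 * q) w (darboux_coord \<beta> w)"
proof -
  define D where "D q w \<longleftrightarrow> (\<forall>a<2*q. w a \<in> V) \<and> (\<forall>a<2*q. \<forall>b<2*q. \<beta> (w a) (w b) = omega a b)" for q w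
  have ds: "dual_system scale V {x\<in>V. \<forall>a<2*q. darboux_coord \<beta> w a x = 0} (2 * q) w (darboux_coord \<beta> w)"
    if "D q w" for q w
    using that by (intro darboux_dual_system \<beta>) (auto simp: D_def)
  have "\<exists>w. D 0 w" by (simp add: D_def)
  moreover have "q \<le> dim V" if "\<exists>w. D q w" for q
    using that dim_dual_system[OF V ds] by fastforce
  ultimately have "\<exists>q. (\<exists>w. D q w) \<and> (\<forall>k. (\<exists>w. D k w) \<longrightarrow> k \<le> q)"
    by (rule exists_greatest_nat)
  then obtain q where "\<exists>w. D q w" and max: "\<And>k. \<exists>w. D k w \<Longrightarrow> k \<le> q" by blast
  then obtain w where w: "D q w" by blast
  let ?K = "{x\<in>V. \<forall>a<2*q. darboux_coord \<beta> w a x = 0}"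
  have perp: "\<beta> x (w b) = 0" if "x \<in> ?K" "b < 2 * q" for x b
  proof -
    have "darboux_coord \<beta> w a x = 0" if "a < 2 * q" for a using \<open>x \<in> ?K\<close> that by blast
    then show ?thesis using that(2) by (rule darboux_coord_perp)
  qed
  have "?K = radical V \<beta>"
  proof
    show "radical V \<beta> \<subseteq> ?K"
    proof
      fix x assume "x \<in> radical V \<beta>"
      moreover have "a + 1 < 2 * q" if "a < 2 * q" "even a" for a using that by presburger
      ultimately show "x \<in> ?K" using w by (auto simp: radical_def darboux_coord_def D_def)
    qed
    show "?K \<subseteq> radical V \<beta>"
    proof (rule ccontr)
      assume "\<not> ?K \<subseteq> radical V \<beta>"
      then obtain x y where x: "x \<in> ?K" and y: "y \<in> V" "\<beta> x y \<noteq> 0" by (auto simp: radical_def)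
      \<comment> \<open>The projection of \<open>y\<close> into \<open>?K\<close>. The pairing with
        \<open>x\<close> is unchanged because \<open>x\<close> is orthogonal to all
        \<open>w a\<close>.\<close>
      define y' where "y' = y - (\<Sum>a<2*q. scale (darboux_coord \<beta> w a y) (w a))"
      have y'K: "y' \<in> ?K" unfolding y'_def by (rule dual_system_remainder[OF V(1) ds[OF w] y(1)])
      have lx: "linfun scale V (\<beta> x)" using x \<beta> by (auto simp: altform_def)
      have S: "(\<Sum>a<2*q. scale (darboux_coord \<beta> w a y) (w a)) \<in> V"
        using w by (intro subspace_sum subspace_scale V(1)) (auto simp: D_def)
      have "\<beta> x (\<Sum>a<2*q. scale (darboux_coord \<beta> w a y) (w a)) = (\<Sum>a<2*q. darboux_coord \<beta> w a y * \<beta> x (w a))"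
        using w by (intro linfun_sum[OF V(1) lx]) (auto simp: D_def)
      also have "\<dots> = 0" using perp[OF x] by (intro sum.neutral) auto
      finally have "\<beta> x y' = \<beta> x y" by (simp add: y'_def linfun_minus[OF V(1) lx y(1) S])
      define z where "z = scale (1 / \<beta> x y) y'"
      have zK: "z \<in> ?K" unfolding z_def
        by (rule subspace_scale[OF subspace_kernels[OF V(1)] y'K])
           (rule dual_systemD(2)[OF ds[OF w]])
      have xz: "\<beta> x z = 1"
        using lx y'K \<open>\<beta> x y' = \<beta> x y\<close> y(2) by (simp add: z_def linfun_def)
      define w' where "w' = w(2 * q := x, Suc (2 * q) := z)"
      have xV: "x \<in> V" "z \<in> V" using x zK by auto
      have w'V: "w' a \<in> V" if "a < 2 * Suc q" for a
        using that w xV by (auto simp: w'_def D_def less_Suc_eq)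
      have anti: "\<beta> (w' b) (w' a) = - \<beta> (w' a) (w' b)" if "a < 2 * Suc q" "b < 2 * Suc q" for a b
        using altform_antisym[OF V(1) \<beta> w'V[OF that(1)] w'V[OF that(2)]] .
      \<comment> \<open>Only the pairs with \<open>b \<le> a\<close> are checked; antisymmetry of
        the form and of \<open>omega\<close> gives the rest.\<close>
      have le: "\<beta> (w' a) (w' b) = omega a b" if ab: "a < 2 * Suc q" "b < 2 * Suc q" "b \<le> a" for a b
      proof -
        have "a < 2 * q \<or> (a \<ge> 2 * q \<and> b < 2 * q) \<or> (a = 2 * q \<and> b = 2 * q) \<or>
            (a = Suc (2 * q) \<and> b = Suc (2 * q)) \<or> (a = Suc (2 * q) \<and> b = 2 * q)"
          using ab by presburger
        then consider "a < 2 * q" | "a \<ge> 2 * q" "b < 2 * q" | "a = 2 * q" "b = 2 * q"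
          | "a = Suc (2 * q)" "b = Suc (2 * q)" | "a = Suc (2 * q)" "b = 2 * q"
          by blast
        then show ?thesis
        proof cases
          case 1
          then show ?thesis using ab w by (simp add: D_def w'_def)
        next
          case 2
          then have "\<beta> (w' a) (w' b) = 0" using perp[OF x] perp[OF zK] ab by (auto simp: w'_def)
          moreover have "b \<noteq> Suc a" "\<not> (even b \<and> a = Suc b)" using 2 by presburger+
          then have "omega a b = (0::'a)" by (auto simp: omega_def)
          ultimately show ?thesis by simp
        next
          case 5
          then show ?thesis using anti[of b a] xz by (simp add: w'_def omega_def)
        qed (use \<beta> xV in \<open>auto simp: w'_def omega_def altform_def\<close>)
      qed
      have om: "omega b a = (- omega a b :: 'a)" for a b
        by (auto simp: omega_def)
      have "\<beta> (w' a) (w' b) = omega a b" if "a < 2 * Suc q" "b < 2 * Suc q" for a b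
        using le[of a b] le[of b a] anti[of b a] om[of a b] that by (cases "b \<le> a") auto
      then have "D (Suc q) w'" using w'V by (simp add: D_def)
      then show False using max[of "Suc q"] by auto
    qed
  qed
  then have "dual_system scale V (radical V \<beta>) (2 * q) w (darboux_coord \<beta> w)" using ds[OF w] by simp
  then show ?thesis using that[of q w] w by (simp add: D_def)
qed

text \<open>The functionals \<open>\<beta> u\<close> with \<open>u\<close> in the radical of
  \<open>H\<close> all vanish on \<open>H\<close>. If \<open>l\<close> of them form a maximal dual
  system, then \<open>H\<close> lies in a subspace of codimension \<open>l\<close>, while the
  members of this radical orthogonal to the \<open>l\<close> dual vectors already lie in the radical
  of \<open>V\<close>. Adding the two estimates eliminates \<open>l\<close>.\<close>

lemma dim_isotropic_radical:
  assumes V: "subspace V" "fin_dim scale V" and \<beta>: "altform scale V \<beta>" and H: "subspace H" "H \<subseteq> V"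
  shows "dim H + dim (radical H \<beta>) \<le> dim V + dim (radical V \<beta>)"
proof -
  let ?N = "radical H \<beta>"
  have NV: "?N \<subseteq> V" "?N \<subseteq> H" using H by (auto simp: radical_def)
  have linN: "linfun scale V (\<beta> y)" if "y \<in> V" for y using that \<beta> by (auto simp: altform_def)
  have linN': "linfun scale V (\<lambda>x. \<beta> x y)" if "y \<in> V" for y using that \<beta> by (auto simp: altform_def)
  have N: "subspace ?N"
    unfolding radical_def Ball_def
    by (rule subspace_kernels[OF H(1)]) (use H(2) linN' linfun_mono[OF _ H(2)] in blast)
  have comb: "\<exists>h\<in>\<beta> ` ?N. \<forall>x\<in>V. h x = c * f x + d * g x" if fg: "f \<in> \<beta> ` ?N" "g \<in> \<beta> ` ?N" for f g c d
  proof -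
    obtain u v where uv: "u \<in> ?N" "v \<in> ?N" "f = \<beta> u" "g = \<beta> v" using fg by auto
    have "scale c u + scale d v \<in> ?N" using uv N by (simp add: subspace_add subspace_scale)
    moreover have "\<beta> (scale c u + scale d v) x = c * f x + d * g x" if "x \<in> V" for x
      using linN'[OF that] uv NV V(1) by (auto simp: linfun_def subspace_scale subset_iff)
    ultimately show ?thesis by blast
  qed
  have lamN: "linfun scale V f" if "f \<in> \<beta> ` ?N" for f using that linN NV by auto
  obtain l y \<zeta> where ds: "dual_system scale V {x\<in>V. \<forall>f\<in>\<beta> ` ?N. f x = 0} l y \<zeta>"
    by (rule dual_system_of_functionals[OF V lamN comb])
  let ?K = "{x\<in>V. \<forall>f\<in>\<beta> ` ?N. f x = 0}"
  have HK: "H \<subseteq> ?K" using H by (auto simp: radical_def)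
  have fdH: "fin_dim scale ?N" using fin_dim_subset[OF V(2) NV(1)] .
  note y = dual_systemD(1)[OF ds]
  have "dim ?N \<le> dim {x\<in>?N. \<forall>j. j < l \<longrightarrow> \<beta> x (y j) = 0} + l"
    by (rule dim_kernels_ge[OF N fdH]) (use linN' y linfun_mono[OF _ NV(1)] in blast)
  moreover have "{x\<in>?N. \<forall>j. j < l \<longrightarrow> \<beta> x (y j) = 0} \<subseteq> radical V \<beta>"
  proof
    fix x assume x: "x \<in> {x\<in>?N. \<forall>j. j < l \<longrightarrow> \<beta> x (y j) = 0}"
    then have xV: "x \<in> V" using NV by auto
    have "\<beta> x v = 0" if "v \<in> V" for v
      using dual_system_expand[OF V(1) ds that linN[OF xV]] x by auto
    then show "x \<in> radical V \<beta>" using xV by (simp add: radical_def)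
  qed
  then have "dim {x\<in>?N. \<forall>j. j < l \<longrightarrow> \<beta> x (y j) = 0} \<le> dim (radical V \<beta>)"
    by (rule dim_mono_fin[rotated]) (rule fin_dim_subset[OF V(2)], auto simp: radical_def)
  moreover have "dim V = dim ?K + l" by (rule dim_dual_system[OF V ds])
  moreover have "dim H \<le> dim ?K"
    by (rule dim_mono_fin[OF _ HK]) (rule fin_dim_subset[OF V(2)], auto)
  ultimately show ?thesis by linarith
qed

end

section \<open>Gauss's lemma over a subring\<close>

text \<open>Subrings are sets because the rings k[x_0,...,x_(n-1)] for all n live inside one type of
  polynomials in infinitely many variables. The induction on n therefore needs divisibility, units
  and primes relative to a set.\<close>

definition subring_set :: "'r::comm_ring_1 set \<Rightarrow> bool" where
  "subring_set A \<longleftrightarrow> 0 \<in> A \<and> 1 \<in> A \<and> (\<forall>a\<in>A. \<forall>b\<in>A. a + b \<in> A \<and> a - b \<in> A \<and> a * b \<in> A)"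

definition dvd_in :: "'r::comm_ring_1 set \<Rightarrow> 'r \<Rightarrow> 'r \<Rightarrow> bool" where
  "dvd_in A a b \<longleftrightarrow> (\<exists>c\<in>A. b = a * c)"

definition unit_in :: "'r::comm_ring_1 set \<Rightarrow> 'r \<Rightarrow> bool" where
  "unit_in A a \<longleftrightarrow> a \<in> A \<and> dvd_in A a 1"

definition irreducible_in :: "'r::comm_ring_1 set \<Rightarrow> 'r \<Rightarrow> bool" where
  "irreducible_in A f \<longleftrightarrow> f \<in> A \<and> f \<noteq> 0 \<and> \<not> unit_in A f \<and>
     (\<forall>g\<in>A. \<forall>h\<in>A. f = g * h \<longrightarrow> unit_in A g \<or> unit_in A h)"

definition prime_in :: "'r::comm_ring_1 set \<Rightarrow> 'r \<Rightarrow> bool" where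
  "prime_in A f \<longleftrightarrow> f \<in> A \<and> f \<noteq> 0 \<and> \<not> unit_in A f \<and>
     (\<forall>g\<in>A. \<forall>h\<in>A. dvd_in A f (g * h) \<longrightarrow> dvd_in A f g \<or> dvd_in A f h)"

definition prime_product_in :: "'r::comm_ring_1 set \<Rightarrow> 'r \<Rightarrow> bool" where
  "prime_product_in A a \<longleftrightarrow>
     (\<exists>u ps. unit_in A u \<and> (\<forall>p\<in>set ps. prime_in A p) \<and> a = u * prod_list ps)"

text \<open>Unique factorisation in the form of existence of a factorisation into primes; over a
  domain uniqueness follows from primality.\<close>

definition factorial_set :: "'r::comm_ring_1 set \<Rightarrow> bool" where
  "factorial_set A \<longleftrightarrow> subring_set A \<and> (\<forall>a\<in>A. a \<noteq> 0 \<longrightarrow> prime_product_in A a)"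

definition polys_over :: "'r::comm_ring_1 set \<Rightarrow> 'r poly set" where
  "polys_over A = {p. \<forall>i. coeff p i \<in> A}"

lemma subring_setD:
  assumes "subring_set A"
  shows "0 \<in> A" "1 \<in> A" "a \<in> A \<Longrightarrow> b \<in> A \<Longrightarrow> a + b \<in> A" "a \<in> A \<Longrightarrow> b \<in> A \<Longrightarrow> a - b \<in> A"
    "a \<in> A \<Longrightarrow> b \<in> A \<Longrightarrow> a * b \<in> A"
  using assms by (auto simp: subring_set_def)

lemma subring_set_sum:
  assumes "subring_set A" "\<And>i. i \<in> I \<Longrightarrow> f i \<in> A"
  shows "sum f I \<in> A"
  using assms(2) by (induction I rule: infinite_finite_induct) (auto intro: subring_setD[OF assms(1)])

lemma subring_polys_over:
  assumes A: "subring_set A"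
  shows "subring_set (polys_over A)"
proof -
  have "p * q \<in> polys_over A" if "p \<in> polys_over A" "q \<in> polys_over A" for p q
    using that by (auto simp: polys_over_def coeff_mult intro!: subring_set_sum[OF A] subring_setD(5)[OF A])
  moreover have "1 \<in> polys_over A"
    using subring_setD[OF A] by (auto simp: polys_over_def coeff_1)
  ultimately show ?thesis
    using subring_setD[OF A] unfolding subring_set_def by (auto simp: polys_over_def)
qed

lemma const_polys_over: "subring_set A \<Longrightarrow> a \<in> A \<Longrightarrow> [:a:] \<in> polys_over A"
  by (auto simp: polys_over_def coeff_pCons subring_set_def split: nat.split)

lemma monom_polys_over: "subring_set A \<Longrightarrow> a \<in> A \<Longrightarrow> monom a n \<in> polys_over A"
  by (auto simp: polys_over_def subring_set_def)

lemma dvd_in_const: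
  assumes "subring_set A" "F \<in> polys_over A"
  shows "dvd_in (polys_over A) [:a:] F \<longleftrightarrow> (\<forall>i. dvd_in A a (coeff F i))"
proof
  assume "dvd_in (polys_over A) [:a:] F"
  then show "\<forall>i. dvd_in A a (coeff F i)" by (auto simp: dvd_in_def polys_over_def)
next
  assume "\<forall>i. dvd_in A a (coeff F i)"
  then have "\<forall>i. \<exists>c. c \<in> A \<and> coeff F i = a * c" by (auto simp: dvd_in_def)
  then obtain c where c: "\<And>i. c i \<in> A" "\<And>i. coeff F i = a * c i" by metis
  let ?G = "\<Sum>i\<le>degree F. monom (c i) i"
  have "coeff ?G i = (if i \<le> degree F then c i else 0)" for i
    by (simp add: coeff_sum)
  then have "?G \<in> polys_over A" "F = [:a:] * ?G"
    using c subring_setD(1)[OF assms(1)] by (auto simp: polys_over_def poly_eq_iff coeff_eq_0 simp flip: c(2))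
  then show "dvd_in (polys_over A) [:a:] F" by (auto simp: dvd_in_def)
qed

lemma dvd_in_add:
  "subring_set A \<Longrightarrow> dvd_in A a b \<Longrightarrow> dvd_in A a c \<Longrightarrow> dvd_in A a (b + c)"
  unfolding dvd_in_def by (metis distrib_left subring_setD(3))

lemma dvd_in_diff:
  "subring_set A \<Longrightarrow> dvd_in A a b \<Longrightarrow> dvd_in A a c \<Longrightarrow> dvd_in A a (b - c)"
  unfolding dvd_in_def by (metis right_diff_distrib subring_setD(4))

lemma dvd_in_mult:
  "subring_set A \<Longrightarrow> dvd_in A a b \<Longrightarrow> c \<in> A \<Longrightarrow> dvd_in A a (b * c)"
  unfolding dvd_in_def by (metis mult.assoc subring_setD(5))

lemma dvd_in_sum:
  assumes "subring_set A" "\<And>i. i \<in> I \<Longrightarrow> dvd_in A a (f i)"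
  shows "dvd_in A a (sum f I)"
  using assms(2)
proof (induction I rule: infinite_finite_induct)
  case (insert i I)
  then show ?case using dvd_in_add[OF assms(1)] by simp
qed (use subring_setD(1)[OF assms(1)] in \<open>auto simp: dvd_in_def intro!: bexI[of _ 0]\<close>)

lemma unit_in_const:
  fixes A :: "'r::idom set"
  assumes "subring_set A" "unit_in (polys_over A) F"
  obtains e where "F = [:e:]" "unit_in A e"
proof -
  obtain G where G: "G \<in> polys_over A" "1 = F * G" and F: "F \<in> polys_over A"
    using assms(2) by (auto simp: unit_in_def dvd_in_def)
  then have "F \<noteq> 0" "G \<noteq> 0" by auto
  then have "degree F = 0" using degree_mult_eq[of F G] G(2) by (metis add_is_0 degree_1)
  then obtain e where e: "F = [:e:]" by (auto elim: degree_eq_zeroE)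
  have "1 = e * coeff G 0" using arg_cong[OF G(2), of "\<lambda>p. coeff p 0"] by (simp add: e)
  then have "unit_in A e"
    using F G by (auto simp: unit_in_def dvd_in_def polys_over_def e coeff_pCons split: nat.splits)
  then show ?thesis using that e by blast
qed

lemma unit_in_constI: "subring_set A \<Longrightarrow> unit_in A e \<Longrightarrow> unit_in (polys_over A) [:e:]"
  using const_polys_over[of A] by (force simp: unit_in_def dvd_in_def one_pCons)

text \<open>Gauss's argument: let \<open>i\<close> and \<open>j\<close> be the first indices at
  which \<open>a\<close> fails to divide the coefficients of \<open>G\<close> and of
  \<open>H\<close>. In the coefficient of \<open>G * H\<close> at \<open>i + j\<close> every term
  except the product of these two is divisible by \<open>a\<close>.\<close>

lemma prime_in_const:
  fixes A :: "'r::idom set"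
  assumes A: "subring_set A" and a: "prime_in A a"
  shows "prime_in (polys_over A) [:a:]"
proof -
  have "dvd_in (polys_over A) [:a:] G \<or> dvd_in (polys_over A) [:a:] H"
    if GH: "G \<in> polys_over A" "H \<in> polys_over A" and d: "dvd_in (polys_over A) [:a:] (G * H)" for G H
  proof (rule ccontr)
    assume "\<not> ?thesis"
    then have ex: "\<exists>i. \<not> dvd_in A a (coeff G i)" "\<exists>i. \<not> dvd_in A a (coeff H i)"
      using dvd_in_const[OF A] GH by auto
    define i where "i = (LEAST i. \<not> dvd_in A a (coeff G i))"
    define j where "j = (LEAST i. \<not> dvd_in A a (coeff H i))"
    have i: "\<not> dvd_in A a (coeff G i)" "\<And>k. k < i \<Longrightarrow> dvd_in A a (coeff G k)"
      using LeastI_ex[OF ex(1)] not_less_Least by (auto simp: i_def)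
    have j: "\<not> dvd_in A a (coeff H j)" "\<And>k. k < j \<Longrightarrow> dvd_in A a (coeff H k)"
      using LeastI_ex[OF ex(2)] not_less_Least by (auto simp: j_def)
    have cA: "coeff G k \<in> A" "coeff H k \<in> A" for k using GH by (auto simp: polys_over_def)
    have "coeff (G * H) (i + j) = coeff G i * coeff H j + (\<Sum>k\<in>{..i+j} - {i}. coeff G k * coeff H (i + j - k))"
      unfolding coeff_mult by (subst sum.remove[of _ i]) auto
    then have "coeff G i * coeff H j = coeff (G * H) (i + j) - (\<Sum>k\<in>{..i+j} - {i}. coeff G k * coeff H (i + j - k))"
      by simp
    moreover have "dvd_in A a (coeff (G * H) (i + j))"
      using d dvd_in_const[OF A] subring_setD(5)[OF subring_polys_over[OF A] GH] by blast
    moreover have "dvd_in A a (\<Sum>k\<in>{..i+j} - {i}. coeff G k * coeff H (i + j - k))"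
    proof (intro dvd_in_sum A)
      fix k assume "k \<in> {..i+j} - {i}"
      then consider "k < i" | "i + j - k < j" by fastforce
      then show "dvd_in A a (coeff G k * coeff H (i + j - k))"
      proof cases
        case 1
        then show ?thesis by (intro dvd_in_mult A i(2) cA)
      next
        case 2
        then show ?thesis by (subst mult.commute) (intro dvd_in_mult A j(2) cA)
      qed
    qed
    ultimately have "dvd_in A a (coeff G i * coeff H j)"
      by (simp add: dvd_in_diff[OF A])
    then show False using a i(1) j(1) cA by (auto simp: prime_in_def)
  qed
  moreover have "\<not> unit_in (polys_over A) [:a:]"
    using a unit_in_const[OF A, of "[:a:]"] by (auto simp: prime_in_def)
  ultimately show ?thesis
    using a const_polys_over[OF A] by (auto simp: prime_in_def)
qed

text \<open>In a factorisation of an irreducible element into primes, one prime factor times a unit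
  makes up the whole element, and associates of primes are prime.\<close>

lemma irreducible_imp_prime_in:
  assumes "factorial_set A" "irreducible_in A a"
  shows "prime_in A (a::'r::idom)"
proof -
  have A: "subring_set A" using assms by (simp add: factorial_set_def)
  obtain u ps where u: "unit_in A u" and ps: "\<forall>p\<in>set ps. prime_in A p" and a: "a = u * prod_list ps"
    using assms by (auto simp: factorial_set_def irreducible_in_def prime_product_in_def)
  show ?thesis
  proof (cases ps)
    case Nil
    then show ?thesis using assms u a by (simp add: irreducible_in_def)
  next
    case (Cons p qs)
    have qs: "prod_list qs \<in> A"
      using ps Cons by (induction qs arbitrary: ps) (auto simp: prime_in_def subring_setD[OF A])
    have p: "prime_in A p" using ps Cons by simp
    have pA: "p \<in> A" using p by (simp add: prime_in_def)
    have uq: "u * prod_list qs \<in> A" using u qs by (simp add: unit_in_def subring_setD[OF A])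
    have "a = p * (u * prod_list qs)" using a Cons by simp
    then have v: "unit_in A (u * prod_list qs)"
      using assms(2) pA uq p by (auto simp: irreducible_in_def prime_in_def)
    then obtain w where w: "w \<in> A" "1 = (u * prod_list qs) * w" by (auto simp: unit_in_def dvd_in_def)
    have eq: "p = a * w"
      using w(2) \<open>a = p * (u * prod_list qs)\<close> by (metis mult.assoc mult.right_neutral)
    have "dvd_in A a b \<longleftrightarrow> dvd_in A p b" for b
    proof
      assume "dvd_in A a b"
      then show "dvd_in A p b"
        using \<open>a = p * (u * prod_list qs)\<close> uq A by (auto simp: dvd_in_def mult.assoc intro!: bexI[of _ "u * prod_list qs * _"] subring_setD(5))
    next
      assume "dvd_in A p b"
      then show "dvd_in A a b" using eq w(1) A by (auto simp: dvd_in_def mult.assoc intro!: bexI[of _ "w * _"] subring_setD(5))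
    qed
    then show ?thesis using p assms(2) by (auto simp: prime_in_def irreducible_in_def unit_in_def)
  qed
qed

text \<open>The primes of \<open>c\<close> stay prime as constant polynomials, so each of them
  divides \<open>G\<close> or \<open>H\<close> and can be cancelled there. This clears denominators
  and replaces the passage to polynomials over the fraction field.\<close>

lemma cancel_constant:
  fixes A :: "'r::idom set"
  assumes A: "subring_set A" and c: "prime_product_in A c"
    and FGH: "F \<in> polys_over A" "G \<in> polys_over A" "H \<in> polys_over A" "[:c:] * F = G * H"
  obtains a b G' H' where "a \<in> A" "b \<in> A" "G' \<in> polys_over A" "H' \<in> polys_over A"
    "G = [:a:] * G'" "H = [:b:] * H'" "F = G' * H'"
proof -
  note P = subring_setD[OF subring_polys_over[OF A]]
  obtain u ps where u: "unit_in A u" and ps: "\<forall>p\<in>set ps. prime_in A p" and c: "c = u * prod_list ps"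
    using c by (auto simp: prime_product_in_def)
  have "\<exists>a\<in>A. \<exists>b\<in>A. \<exists>G'\<in>polys_over A. \<exists>H'\<in>polys_over A. G = [:a:] * G' \<and> H = [:b:] * H' \<and> F = G' * H'"
    using ps FGH(2-4) unfolding c
  proof (induction ps arbitrary: G H)
    case Nil
    obtain v where v: "v \<in> A" "1 = u * v" using u by (auto simp: unit_in_def dvd_in_def)
    have uA: "u \<in> A" using u by (simp add: unit_in_def)
    have uv: "[:u:] * [:v:] = 1" using v by (simp add: one_pCons mult.commute)
    have Hu: "H = [:u:] * ([:v:] * H)" using uv by (metis mult.assoc mult_1_left)
    have "[:u:] * F = G * H" using Nil.prems by simp
    then have "[:v:] * ([:u:] * F) = [:v:] * (G * H)" by simp
    moreover have "[:v:] * ([:u:] * F) = ([:u:] * [:v:]) * F" by (simp only: mult_ac)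
    ultimately have FG: "F = G * ([:v:] * H)"
      unfolding uv by (simp only: mult_1_left mult.left_commute)
    have "G = [:1:] * G" by simp
    moreover have "[:v:] * H \<in> polys_over A" by (intro P(5) const_polys_over[OF A] v Nil.prems)
    ultimately show ?case using Nil.prems uA subring_setD(2)[OF A] Hu FG by blast
  next
    case (Cons p ps)
    have p: "prime_in (polys_over A) [:p:]" using Cons.prems A by (intro prime_in_const) auto
    have pA: "p \<in> A" "p \<noteq> 0" using Cons.prems by (auto simp: prime_in_def)
    have GH: "G * H = [:p:] * ([:u * prod_list ps:] * F)"
      using Cons.prems(4) by (simp add: mult_ac)
    have "prod_list ps \<in> A"
      using Cons.prems(1) by (induction ps) (auto simp: prime_in_def subring_setD[OF A])
    then have "u * prod_list ps \<in> A" using u by (auto simp: unit_in_def intro: subring_setD[OF A])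
    then have "[:u * prod_list ps:] * F \<in> polys_over A" by (intro P(5) const_polys_over[OF A] FGH(1))
    then have "dvd_in (polys_over A) [:p:] (G * H)"
      using GH unfolding dvd_in_def by blast
    then consider "dvd_in (polys_over A) [:p:] G" | "dvd_in (polys_over A) [:p:] H"
      using p Cons.prems unfolding prime_in_def by blast
    then show ?case
    proof cases
      case 1
      then obtain G1 where G1: "G1 \<in> polys_over A" "G = [:p:] * G1" by (auto simp: dvd_in_def)
      have "[:p:] * ([:u * prod_list ps:] * F) = [:p:] * (G1 * H)"
        unfolding GH[symmetric] G1(2) by (simp only: mult.assoc)
      then have "[:u * prod_list ps:] * F = G1 * H"
        using pA(2) by (subst (asm) mult_cancel_left) simp
      then obtain a b G' H' where *: "a \<in> A" "b \<in> A" "G' \<in> polys_over A" "H' \<in> polys_over A"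
        "G1 = [:a:] * G'" "H = [:b:] * H'" "F = G' * H'"
        using Cons.IH[of G1 H] Cons.prems G1 by auto
      have "G = [:p * a:] * G'" using G1(2) *(5) by (simp add: mult.commute)
      then show ?thesis using * subring_setD(5)[OF A pA(1) *(1)] by blast
    next
      case 2
      then obtain H1 where H1: "H1 \<in> polys_over A" "H = [:p:] * H1" by (auto simp: dvd_in_def)
      have "[:p:] * ([:u * prod_list ps:] * F) = [:p:] * (G * H1)"
        unfolding GH[symmetric] H1(2) by (simp only: mult.left_commute)
      then have "[:u * prod_list ps:] * F = G * H1"
        using pA(2) by (subst (asm) mult_cancel_left) simp
      then obtain a b G' H' where *: "a \<in> A" "b \<in> A" "G' \<in> polys_over A" "H' \<in> polys_over A"
        "G = [:a:] * G'" "H1 = [:b:] * H'" "F = G' * H'"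
        using Cons.IH[of G H1] Cons.prems H1 by auto
      have "H = [:p * b:] * H'" using H1(2) *(6) by (simp add: mult.commute)
      then show ?thesis using * subring_setD(5)[OF A pA(1) *(2)] by blast
    qed
  qed
  then show ?thesis using that by blast
qed

text \<open>Long division without fractions: multiplying the dividend by the leading coefficient of
  \<open>g\<close> makes its leading term divisible by that of \<open>g\<close>, and the accumulated
  factors form \<open>c\<close>.\<close>

lemma pseudo_division_over:
  fixes A :: "'r::idom set"
  assumes A: "subring_set A" and g: "g \<in> polys_over A" "g \<noteq> 0" and f: "f \<in> polys_over A"
  shows "\<exists>c\<in>A. \<exists>q\<in>polys_over A. \<exists>r\<in>polys_over A. c \<noteq> 0 \<and> [:c:] * f = g * q + r \<and> (r = 0 \<or> degree r < degree g)"
  using f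
proof (induction "degree f" arbitrary: f rule: less_induct)
  case less
  note P = subring_setD[OF subring_polys_over[OF A]]
  show ?case
  proof (cases "f = 0 \<or> degree f < degree g")
    case True
    then show ?thesis
      using less.prems subring_setD(2)[OF A] P
      by (intro bexI[of _ 1] bexI[of _ 0] bexI[of _ f]) auto
  next
    case False
    define d where "d = degree f - degree g"
    define f' where "f' = [:lead_coeff g:] * f - monom (lead_coeff f) d * g"
    have lc: "lead_coeff g \<in> A" "lead_coeff f \<in> A" "lead_coeff g \<noteq> 0"
      using g less.prems by (auto simp: polys_over_def)
    have f'P: "f' \<in> polys_over A"
      unfolding f'_def by (intro P(4,5) const_polys_over[OF A] monom_polys_over[OF A] lc g less.prems)
    have deg: "f' = 0 \<or> degree f' < degree f"
    proof (cases "degree f = 0")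
      case True
      then have "degree g = 0" "d = 0" using False by (auto simp: d_def)
      then have "f' = 0" unfolding f'_def using True
        by (auto elim!: degree_eq_zeroE simp: monom_0)
      then show ?thesis by simp
    next
      case dpos: False
      have "degree f' \<le> degree f"
        unfolding f'_def using False
        by (intro degree_diff_le order.trans[OF degree_mult_le])
           (auto simp: d_def degree_monom_eq)
      moreover have "coeff f' (degree f) = 0"
        using False by (simp add: f'_def d_def coeff_monom_mult)
      ultimately show ?thesis
        using leading_coeff_0_iff[of f'] by (cases "degree f' = degree f") auto
    qed
    have "\<exists>c\<in>A. \<exists>q\<in>polys_over A. \<exists>r\<in>polys_over A. c \<noteq> 0 \<and> [:c:] * f' = g * q + r \<and> (r = 0 \<or> degree r < degree g)"
    proof (cases "f' = 0")
      case True
      then show ?thesis using subring_setD(2)[OF A] P(1)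
        by (intro bexI[of _ 1] bexI[of _ 0]) auto
    next
      case False
      then show ?thesis using deg less.hyps f'P by blast
    qed
    then obtain c q r where c: "c \<in> A" "q \<in> polys_over A" "r \<in> polys_over A" "c \<noteq> 0"
      "[:c:] * f' = g * q + r" "r = 0 \<or> degree r < degree g" by blast
    have "[:c * lead_coeff g:] * f = [:c:] * f' + [:c:] * (monom (lead_coeff f) d * g)"
      unfolding f'_def by (simp add: algebra_simps)
    also have "\<dots> = g * (q + [:c:] * monom (lead_coeff f) d) + r"
      unfolding c(5) by (simp only: algebra_simps)
    finally have "[:c * lead_coeff g:] * f = g * (q + [:c:] * monom (lead_coeff f) d) + r" .
    moreover have "q + [:c:] * monom (lead_coeff f) d \<in> polys_over A"
      by (intro P(3,5) const_polys_over[OF A] monom_polys_over[OF A] lc c)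
    moreover have "c * lead_coeff g \<in> A" "c * lead_coeff g \<noteq> 0"
      using c lc subring_setD[OF A] by auto
    ultimately show ?thesis using c(3,6) by blast
  qed
qed

text \<open>An element \<open>w\<close> of least degree in the ideal of \<open>F\<close> and
  \<open>G\<close> divides every element of the ideal up to a constant, by pseudo-division.
  Stripping constants gives a factor \<open>w'\<close> of the irreducible \<open>F\<close>. If
  \<open>w'\<close> is a unit, then \<open>w\<close> is the constant sought. Otherwise
  \<open>w'\<close> is associated to \<open>F\<close>, and \<open>F\<close> divides a constant
  multiple of \<open>G\<close>, which is possible only for constant \<open>F\<close>.\<close>

lemma elimination_over:
  fixes A :: "'r::idom set"
  assumes fA: "factorial_set A" and F: "irreducible_in (polys_over A) F"
    and G: "G \<in> polys_over A" "\<not> dvd_in (polys_over A) F G"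
  obtains b u v where "b \<in> A" "b \<noteq> 0" "u \<in> polys_over A" "v \<in> polys_over A" "[:b:] = u * F + v * G"
proof -
  have A: "subring_set A" using fA by (simp add: factorial_set_def)
  note P = subring_setD[OF subring_polys_over[OF A]]
  have FP: "F \<in> polys_over A" "F \<noteq> 0" using F by (auto simp: irreducible_in_def)
  define I where "I = {u * F + v * G |u v. u \<in> polys_over A \<and> v \<in> polys_over A}"
  have "1 * F + 0 * G \<in> I" unfolding I_def using P(1,2) by blast
  then have FI: "F \<in> I" by simp
  have "0 * F + 1 * G \<in> I" unfolding I_def using P(1,2) by blast
  then have GI: "G \<in> I" by simp
  have IP: "w \<in> polys_over A" if "w \<in> I" for w using that FP G by (auto simp: I_def intro!: P(3,5))
  have Idiff: "x * f - w * q \<in> I" if fw: "f \<in> I" "w \<in> I" "x \<in> polys_over A" "q \<in> polys_over A" for f w x q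
  proof -
    obtain u v u' v' where uv: "u \<in> polys_over A" "v \<in> polys_over A" "f = u * F + v * G"
      "u' \<in> polys_over A" "v' \<in> polys_over A" "w = u' * F + v' * G" using fw(1,2) unfolding I_def by blast
    have "x * f - w * q = (x * u - u' * q) * F + (x * v - v' * q) * G"
      unfolding uv by (simp add: algebra_simps)
    moreover have "x * u - u' * q \<in> polys_over A" "x * v - v' * q \<in> polys_over A" using uv fw(3,4) by (auto intro!: P(4,5))
    ultimately show ?thesis unfolding I_def by blast
  qed
  obtain w where w: "w \<in> I" "w \<noteq> 0" and min: "\<And>x. x \<in> I \<Longrightarrow> x \<noteq> 0 \<Longrightarrow> degree w \<le> degree x"
    using exists_least_iff[of "\<lambda>d. \<exists>w\<in>I. w \<noteq> 0 \<and> degree w = d"] FI FP(2)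
    by (metis not_le_imp_less)
  have divide: "\<exists>c\<in>A. \<exists>q\<in>polys_over A. c \<noteq> 0 \<and> [:c:] * f = w * q" if f: "f \<in> I" for f
  proof -
    obtain c q r where c: "c \<in> A" "q \<in> polys_over A" "r \<in> polys_over A" "c \<noteq> 0"
      "[:c:] * f = w * q + r" "r = 0 \<or> degree r < degree w"
      using pseudo_division_over[OF A IP[OF w(1)] w(2) IP[OF f]] by blast
    have "r = [:c:] * f - w * q" using c(5) by simp
    then have "r \<in> I" using Idiff[OF f w(1) const_polys_over[OF A c(1)] c(2)] by simp
    then have "r = 0" using c(6) min[of r] by (meson not_le)
    then show ?thesis using c by auto
  qed
  have pp: "prime_product_in A c" if "c \<in> A" "c \<noteq> 0" for c using fA that by (simp add: factorial_set_def)
  obtain c q where c: "c \<in> A" "q \<in> polys_over A" "c \<noteq> 0" "[:c:] * F = w * q" using divide[OF FI] by blast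
  obtain a b w' q' where 1: "a \<in> A" "b \<in> A" "w' \<in> polys_over A" "q' \<in> polys_over A"
    "w = [:a:] * w'" "q = [:b:] * q'" "F = w' * q'"
    using cancel_constant[OF A pp[OF c(1,3)] FP(1) IP[OF w(1)] c(2,4)] by blast
  have "unit_in (polys_over A) w' \<or> unit_in (polys_over A) q'"
    using F 1 unfolding irreducible_in_def by blast
  then show ?thesis
  proof
    assume "unit_in (polys_over A) w'"
    then obtain e where e: "w' = [:e:]" "unit_in A e" using unit_in_const[OF A] by blast
    have "w = [:a * e:]" using 1(5) e(1) by simp
    moreover have "a * e \<in> A" using 1(1) e(2) by (auto simp: unit_in_def intro: subring_setD[OF A])
    moreover have "a * e \<noteq> 0" using w(2) calculation(1) by auto
    ultimately show ?thesis using w(1) that[of "a * e"] by (auto simp: I_def)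
  next
    assume "unit_in (polys_over A) q'"
    then obtain r where r: "r \<in> polys_over A" "1 = q' * r" by (auto simp: unit_in_def dvd_in_def)
    have w': "w' = F * r" using r(2) 1(7) by (simp add: mult.assoc flip: r(2))
    obtain c2 q2 where c2: "c2 \<in> A" "q2 \<in> polys_over A" "c2 \<noteq> 0" "[:c2:] * G = w * q2" using divide[OF GI] by blast
    have x: "[:a:] * r * q2 \<in> polys_over A" by (intro P(5) const_polys_over[OF A] 1 r c2)
    have "[:c2:] * G = F * ([:a:] * r * q2)" unfolding c2(4) 1(5) w' by (simp only: mult_ac)
    then obtain a1 b1 F' K' where 2: "a1 \<in> A" "b1 \<in> A" "F' \<in> polys_over A" "K' \<in> polys_over A"
      "F = [:a1:] * F'" "[:a:] * r * q2 = [:b1:] * K'" "G = F' * K'"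
      using cancel_constant[OF A pp[OF c2(1,3)] G(1) FP(1) x] by blast
    have "unit_in (polys_over A) [:a1:] \<or> unit_in (polys_over A) F'"
      using F 2 const_polys_over[OF A 2(1)] unfolding irreducible_in_def by blast
    then show ?thesis
    proof
      assume "unit_in (polys_over A) [:a1:]"
      then obtain s where s: "s \<in> polys_over A" "1 = [:a1:] * s" by (auto simp: unit_in_def dvd_in_def)
      have "G = ([:a1:] * s) * (F' * K')" using 2(7) s(2) by simp
      also have "\<dots> = F * (s * K')" unfolding 2(5) by (simp only: mult_ac)
      finally have "G = F * (s * K')" .
      then have "dvd_in (polys_over A) F G" using P(5)[OF s(1) 2(4)] unfolding dvd_in_def by blast
      then show ?thesis using G(2) by simp
    next
      \<comment> \<open>Here \<open>F\<close> itself is a nonzero constant and serves as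
        \<open>b\<close>.\<close>
      assume "unit_in (polys_over A) F'"
      then obtain e where e: "F' = [:e:]" "unit_in A e" using unit_in_const[OF A] by blast
      have "[:a1 * e:] = 1 * F + 0 * G" using 2(5) e(1) by simp
      moreover have "a1 * e \<in> A" using 2(1) e(2) by (auto simp: unit_in_def intro: subring_setD[OF A])
      moreover have "a1 * e \<noteq> 0" using FP(2) 2(5) e(1) by auto
      ultimately show ?thesis using that P(1,2) by blast
    qed
  qed
qed

lemma irreducible_in_const:
  fixes A :: "'r::idom set"
  assumes A: "subring_set A" and F: "irreducible_in (polys_over A) [:a:]"
  shows "irreducible_in A a"
  unfolding irreducible_in_def
proof (intro conjI ballI impI)
  have "coeff [:a:] 0 \<in> A" using F unfolding irreducible_in_def polys_over_def by blast
  then show "a \<in> A" by simp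
  show "a \<noteq> 0" using F by (simp add: irreducible_in_def)
  show "\<not> unit_in A a" using F unit_in_constI[OF A] by (auto simp: irreducible_in_def)
  fix g h assume gh: "g \<in> A" "h \<in> A" "a = g * h"
  then have "[:a:] = [:g:] * [:h:]" by simp
  then have "unit_in (polys_over A) [:g:] \<or> unit_in (polys_over A) [:h:]"
    using F const_polys_over[OF A gh(1)] const_polys_over[OF A gh(2)] unfolding irreducible_in_def by blast
  then show "unit_in A g \<or> unit_in A h" by (metis A pCons_eq_iff unit_in_const)
qed

text \<open>For constant \<open>F\<close> this is Gauss's lemma. Otherwise, if \<open>F\<close> does
  not divide \<open>G\<close>, multiplying the relation between \<open>b\<close>, \<open>F\<close>
  and \<open>G\<close> by \<open>H\<close> shows that \<open>F\<close> divides \<open>b * H\<close>;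
  the constant \<open>b\<close> can be cancelled since \<open>F\<close> has positive degree.\<close>

lemma irreducible_imp_prime_over:
  fixes A :: "'r::idom set"
  assumes fA: "factorial_set A" and F: "irreducible_in (polys_over A) F"
  shows "prime_in (polys_over A) F"
proof -
  have A: "subring_set A" using fA by (simp add: factorial_set_def)
  note P = subring_setD[OF subring_polys_over[OF A]]
  have FP: "F \<in> polys_over A" "F \<noteq> 0" using F by (auto simp: irreducible_in_def)
  show ?thesis
  proof (cases "degree F = 0")
    case True
    then obtain a where a: "F = [:a:]" by (auto elim: degree_eq_zeroE)
    then have "irreducible_in A a" using F irreducible_in_const[OF A] by simp
    then show ?thesis unfolding a by (intro prime_in_const A irreducible_imp_prime_in[OF fA])
  next
    case False
    have "dvd_in (polys_over A) F H"
      if GH: "G \<in> polys_over A" "H \<in> polys_over A" "dvd_in (polys_over A) F (G * H)" "\<not> dvd_in (polys_over A) F G" for G H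
    proof -
      obtain b u v where b: "b \<in> A" "b \<noteq> 0" "u \<in> polys_over A" "v \<in> polys_over A" "[:b:] = u * F + v * G"
        using elimination_over[OF fA F GH(1,4)] .
      obtain K where K: "K \<in> polys_over A" "G * H = F * K" using GH(3) by (auto simp: dvd_in_def)
      have "[:b:] * H = u * F * H + v * (G * H)" unfolding b(5) by (simp add: algebra_simps)
      also have "\<dots> = F * (u * H + v * K)" unfolding K(2) by (simp add: algebra_simps)
      finally have eq: "[:b:] * H = F * (u * H + v * K)" .
      have x: "u * H + v * K \<in> polys_over A" by (intro P(3,5) b GH K)
      have "prime_product_in A b" using fA b by (simp add: factorial_set_def)
      from cancel_constant[OF A this GH(2) FP(1) x eq]
      obtain a1 b1 F' K' where 2: "a1 \<in> A" "b1 \<in> A" "F' \<in> polys_over A" "K' \<in> polys_over A"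
        "F = [:a1:] * F'" "u * H + v * K = [:b1:] * K'" "H = F' * K'" by blast
      have "unit_in (polys_over A) [:a1:] \<or> unit_in (polys_over A) F'"
        using F 2 const_polys_over[OF A 2(1)] unfolding irreducible_in_def by blast
      moreover have "\<not> unit_in (polys_over A) F'"
      proof
        assume "unit_in (polys_over A) F'"
        then obtain e where "F' = [:e:]" using unit_in_const[OF A] by blast
        then show False using False 2(5) by simp
      qed
      ultimately obtain s where s: "s \<in> polys_over A" "1 = [:a1:] * s" by (auto simp: unit_in_def dvd_in_def)
      have "H = ([:a1:] * s) * (F' * K')" using 2(7) s(2) by simp
      also have "\<dots> = F * (s * K')" unfolding 2(5) by (simp only: mult_ac)
      finally have "H = F * (s * K')" .
      then show ?thesis using P(5)[OF s(1) 2(4)] unfolding dvd_in_def by blast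
    qed
    then show ?thesis using F unfolding prime_in_def irreducible_in_def by blast
  qed
qed

section \<open>Polynomial rings in finitely many variables\<close>

lemma sum_single_lookup:
  "(\<Sum>m\<in>Poly_Mapping.keys f. Poly_Mapping.single m (Poly_Mapping.lookup f m)) = f"
  by (rule poly_mapping_eqI)
     (simp add: lookup_sum lookup_single when_def not_in_keys_iff_lookup_eq_zero)

definition ring_hom_fun :: "('a::comm_ring_1 \<Rightarrow> 'r::comm_ring_1) \<Rightarrow> bool" where
  "ring_hom_fun \<iota> \<longleftrightarrow> \<iota> 0 = 0 \<and> \<iota> 1 = 1 \<and> (\<forall>x y. \<iota> (x + y) = \<iota> x + \<iota> y \<and> \<iota> (x * y) = \<iota> x * \<iota> y)"

lemma ring_hom_funD:
  assumes "ring_hom_fun \<iota>"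
  shows "\<iota> 0 = 0" "\<iota> 1 = 1" "\<iota> (x + y) = \<iota> x + \<iota> y" "\<iota> (x * y) = \<iota> x * \<iota> y"
  using assms by (auto simp: ring_hom_fun_def)

lemma ring_hom_fun_sum: "ring_hom_fun \<iota> \<Longrightarrow> \<iota> (sum f I) = (\<Sum>i\<in>I. \<iota> (f i))"
  by (induction I rule: infinite_finite_induct) (simp_all add: ring_hom_funD)

lemma ring_hom_fun_prod: "ring_hom_fun \<iota> \<Longrightarrow> \<iota> (prod f I) = (\<Prod>i\<in>I. \<iota> (f i))"
  by (induction I rule: infinite_finite_induct) (simp_all add: ring_hom_funD)

lemma ring_hom_fun_diff: "ring_hom_fun \<iota> \<Longrightarrow> \<iota> (x - y) = \<iota> x - \<iota> y"
  by (metis add_diff_cancel_right' diff_add_cancel ring_hom_funD(3))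

lemma ring_hom_fun_power: "ring_hom_fun \<iota> \<Longrightarrow> \<iota> (x ^ n) = \<iota> x ^ n"
  by (induction n) (simp_all add: ring_hom_funD)

lemma ring_hom_fun_of_int: "ring_hom_fun \<iota> \<Longrightarrow> \<iota> (of_int n) = of_int n"
proof (induction n rule: int_induct[where k=0])
  case (step1 i)
  then show ?case by (simp add: ring_hom_funD)
next
  case (step2 i)
  then show ?case by (simp add: ring_hom_fun_diff ring_hom_funD)
qed (simp_all add: ring_hom_funD)

lemma ring_hom_fun_id: "ring_hom_fun id"
  by (simp add: ring_hom_fun_def)

lemma ring_hom_fun_mconst: "ring_hom_fun mconst"
  by (simp add: ring_hom_fun_def mconst_def single_add mult_single)

lemma ring_hom_fun_mconst_poly: "ring_hom_fun (\<lambda>c. [:mconst c:])"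
  by (simp add: ring_hom_fun_def ring_hom_funD[OF ring_hom_fun_mconst] mult_ac one_pCons)

definition monomial_value :: "(nat \<Rightarrow> 'r::comm_ring_1) \<Rightarrow> (nat \<Rightarrow>\<^sub>0 nat) \<Rightarrow> 'r" where
  "monomial_value v m = (\<Prod>i\<in>Poly_Mapping.keys m. v i ^ Poly_Mapping.lookup m i)"

lemma monomial_value_superset:
  assumes "finite S" "Poly_Mapping.keys m \<subseteq> S"
  shows "monomial_value v m = (\<Prod>i\<in>S. v i ^ Poly_Mapping.lookup m i)"
  unfolding monomial_value_def using assms
  by (intro prod.mono_neutral_left) (auto simp: in_keys_iff)

lemma monomial_value_add: "monomial_value v (m + m') = monomial_value v m * monomial_value v m'"
proof -
  let ?S = "Poly_Mapping.keys m \<union> Poly_Mapping.keys m'"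
  have "Poly_Mapping.keys (m + m') \<subseteq> ?S" by (rule keys_add)
  then show ?thesis
    by (simp add: monomial_value_superset[of ?S] lookup_add power_add prod.distrib)
qed

lemma mpol_eval_superset:
  assumes "finite S" "Poly_Mapping.keys f \<subseteq> S" "\<iota> 0 = 0"
  shows "mpol_eval \<iota> v f = (\<Sum>m\<in>S. \<iota> (Poly_Mapping.lookup f m) * monomial_value v m)"
  unfolding mpol_eval_def monomial_value_def using assms
  by (intro sum.mono_neutral_left) (auto simp: in_keys_iff)

lemma mpol_eval_single:
  assumes "\<iota> 0 = 0"
  shows "mpol_eval \<iota> v (Poly_Mapping.single m c) = \<iota> c * monomial_value v m"
  by (subst mpol_eval_superset[of "{m}"]) (use assms in auto)

lemma mpol_eval_add:
  assumes "ring_hom_fun \<iota>"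
  shows "mpol_eval \<iota> v (f + g) = mpol_eval \<iota> v f + mpol_eval \<iota> v g"
proof -
  let ?S = "Poly_Mapping.keys f \<union> Poly_Mapping.keys g"
  have "Poly_Mapping.keys (f + g) \<subseteq> ?S" by (rule keys_add)
  then show ?thesis
    by (simp add: mpol_eval_superset[of ?S] lookup_add ring_hom_funD[OF assms] distrib_right sum.distrib)
qed

lemma mpol_eval_zero: "mpol_eval \<iota> v 0 = 0"
  by (simp add: mpol_eval_def)

lemma mpol_eval_sum:
  "ring_hom_fun \<iota> \<Longrightarrow> mpol_eval \<iota> v (sum f I) = (\<Sum>i\<in>I. mpol_eval \<iota> v (f i))"
  by (induction I rule: infinite_finite_induct) (simp_all add: mpol_eval_zero mpol_eval_add)

lemma mpol_eval_mult:
  assumes "ring_hom_fun \<iota>"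
  shows "mpol_eval \<iota> v (f * g) = mpol_eval \<iota> v f * mpol_eval \<iota> v g"
proof -
  let ?s = "\<lambda>f m. Poly_Mapping.single m (Poly_Mapping.lookup f m)"
  have 0: "\<iota> 0 = 0" using assms by (simp add: ring_hom_funD)
  have "mpol_eval \<iota> v (f * g) =
      mpol_eval \<iota> v ((\<Sum>m\<in>Poly_Mapping.keys f. ?s f m) * (\<Sum>m\<in>Poly_Mapping.keys g. ?s g m))"
    by (simp only: sum_single_lookup)
  also have "\<dots> = (\<Sum>m\<in>Poly_Mapping.keys f. mpol_eval \<iota> v (?s f m)) * (\<Sum>m\<in>Poly_Mapping.keys g. mpol_eval \<iota> v (?s g m))"
    by (simp add: sum_product mpol_eval_sum[OF assms] mult_single mpol_eval_single[of \<iota>, OF 0]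
        monomial_value_add ring_hom_funD[OF assms] mult_ac)
  finally show ?thesis
    by (simp only: mpol_eval_sum[OF assms, symmetric] sum_single_lookup)
qed

lemma mpol_eval_mconst: "ring_hom_fun \<iota> \<Longrightarrow> mpol_eval \<iota> v (mconst c) = \<iota> c"
  by (simp add: mconst_def mpol_eval_single ring_hom_funD monomial_value_def)

lemma mpol_eval_mvar: "ring_hom_fun \<iota> \<Longrightarrow> mpol_eval \<iota> v (mvar i) = v i"
  by (simp add: mvar_def mpol_eval_single ring_hom_funD monomial_value_def)

lemma mpol_eval_hom:
  assumes "ring_hom_fun \<iota>" shows "ring_hom_fun (mpol_eval \<iota> v)"
  using mpol_eval_mconst[OF assms, of v 1]
  by (simp add: ring_hom_funD(2)[OF ring_hom_fun_mconst] ring_hom_funD(2)[OF assms] ring_hom_fun_def mpol_eval_zero mpol_eval_add[OF assms] mpol_eval_mult[OF assms])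

lemma mpol_eval_cong:
  assumes "f \<in> mpols_below n" "\<And>i. i < n \<Longrightarrow> v i = v' i"
  shows "mpol_eval \<iota> v f = mpol_eval \<iota> v' f"
  unfolding mpol_eval_def using assms
  by (intro sum.cong arg_cong2[where f="(*)"] prod.cong refl) (auto simp: mpols_below_def subset_iff)

lemmas eval_hom = mpol_eval_hom[OF ring_hom_fun_id]

section \<open>Gradings and the total degree\<close>

text \<open>
  The variable \<open>x\<^sub>i\<close> is multiplied by the power \<open>w i\<close> of a new variable, so that additivity of weighted degrees
  under multiplication is inherited from the degree of univariate polynomials.
\<close>

definition wgrade :: "(nat \<Rightarrow> nat) \<Rightarrow> 'k::comm_ring_1 mpol \<Rightarrow> 'k mpol poly" where
  "wgrade w f = mpol_eval (\<lambda>c. [:mconst c:]) (\<lambda>i. monom (mvar i) (w i)) f"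

definition wdeg :: "(nat \<Rightarrow> nat) \<Rightarrow> (nat \<Rightarrow>\<^sub>0 nat) \<Rightarrow> nat" where
  "wdeg w m = (\<Sum>i\<in>Poly_Mapping.keys m. Poly_Mapping.lookup m i * w i)"

lemma wgrade_hom: "ring_hom_fun (wgrade w)"
  unfolding wgrade_def[abs_def] by (rule mpol_eval_hom[OF ring_hom_fun_mconst_poly])

lemma prod_monom: "(\<Prod>i\<in>I. monom (a i) (n i)) = monom (\<Prod>i\<in>I. a i) (\<Sum>i\<in>I. n i)"
  by (induction I rule: infinite_finite_induct) (simp_all add: mult_monom monom_0 one_pCons)

lemma wgrade_eq:
  "wgrade w f = (\<Sum>m\<in>Poly_Mapping.keys f. monom (Poly_Mapping.single m (Poly_Mapping.lookup f m)) (wdeg w m))"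
  unfolding wgrade_def mpol_eval_def
proof (intro sum.cong refl)
  fix m
  have "(\<Prod>i\<in>Poly_Mapping.keys m. monom (mvar i :: 'a mpol) (w i) ^ Poly_Mapping.lookup m i) =
      monom (\<Prod>i\<in>Poly_Mapping.keys m. mvar i ^ Poly_Mapping.lookup m i) (wdeg w m)"
    by (simp add: monom_power prod_monom wdeg_def mult.commute)
  then show "[:mconst (Poly_Mapping.lookup f m):] *
      (\<Prod>i\<in>Poly_Mapping.keys m. monom (mvar i) (w i) ^ Poly_Mapping.lookup m i) =
      monom (Poly_Mapping.single m (Poly_Mapping.lookup f m)) (wdeg w m)"
    by (simp add: single_eq_prod_mvar[of m "Poly_Mapping.lookup f m"] smult_monom)
qed

lemma poly_wgrade_1: "poly (wgrade w f) 1 = f"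
  by (simp add: wgrade_eq poly_sum poly_monom sum_single_lookup)

lemma wgrade_eq_0_iff: "wgrade w f = 0 \<longleftrightarrow> f = 0"
  using poly_wgrade_1[of w f] ring_hom_funD(1)[OF wgrade_hom] by auto

lemma lookup_coeff_wgrade:
  "Poly_Mapping.lookup (coeff (wgrade w f) d) m = (if wdeg w m = d then Poly_Mapping.lookup f m else 0)"
proof -
  have "Poly_Mapping.lookup (coeff (wgrade w f) d) m =
      (\<Sum>x\<in>Poly_Mapping.keys f. if x = m then (if wdeg w m = d then Poly_Mapping.lookup f m else 0) else 0)"
    unfolding wgrade_eq coeff_sum lookup_sum
    by (intro sum.cong) (auto simp: lookup_single when_def)
  then show ?thesis by (simp add: not_in_keys_iff_lookup_eq_zero)
qed

lemma degree_wgrade_le_iff: "degree (wgrade w f) \<le> d \<longleftrightarrow> (\<forall>m\<in>Poly_Mapping.keys f. wdeg w m \<le> d)"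
proof
  assume d: "degree (wgrade w f) \<le> d"
  show "\<forall>m\<in>Poly_Mapping.keys f. wdeg w m \<le> d"
  proof
    fix m assume "m \<in> Poly_Mapping.keys f"
    then have "coeff (wgrade w f) (wdeg w m) \<noteq> 0"
      using lookup_coeff_wgrade[of w f "wdeg w m" m] by (auto simp: in_keys_iff)
    then show "wdeg w m \<le> d" using d le_degree by (metis order.trans)
  qed
next
  assume "\<forall>m\<in>Poly_Mapping.keys f. wdeg w m \<le> d"
  then show "degree (wgrade w f) \<le> d"
    unfolding wgrade_eq by (intro degree_sum_le) (auto intro: order.trans[OF degree_monom_le])
qed

lemma degree_wgrade_mult:
  assumes "f \<noteq> 0" "g \<noteq> (0 :: 'k::idom mpol)"
  shows "degree (wgrade w (f * g)) = degree (wgrade w f) + degree (wgrade w g)"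
  using assms by (simp add: ring_hom_funD[OF wgrade_hom] degree_mult_eq wgrade_eq_0_iff)

lemma total_degree_eq: "total_degree f = degree (wgrade (\<lambda>_. 1) f)"
proof -
  have "total_degree f \<le> d \<longleftrightarrow> degree (wgrade (\<lambda>_. 1) f) \<le> d" for d
    by (auto simp: degree_wgrade_le_iff total_degree_def wdeg_def)
  then show ?thesis by (metis order.antisym order_refl)
qed

lemma total_degree_mult:
  "f \<noteq> 0 \<Longrightarrow> g \<noteq> (0 :: 'k::idom mpol) \<Longrightarrow> total_degree (f * g) = total_degree f + total_degree g"
  by (simp add: total_degree_eq degree_wgrade_mult)

text \<open>Stated through \<open>wgrade\<close>, a ring homomorphism, so that sums and products are
  immediate. The zero polynomial is homogeneous of every degree.\<close>

definition homogeneous :: "nat \<Rightarrow> 'k::comm_ring_1 mpol \<Rightarrow> bool" where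
  "homogeneous d f \<longleftrightarrow> wgrade (\<lambda>_. 1) f = monom f d"

lemma homogeneous_mult: "homogeneous d f \<Longrightarrow> homogeneous e g \<Longrightarrow> homogeneous (d + e) (f * g)"
  by (simp add: homogeneous_def ring_hom_funD[OF wgrade_hom] mult_monom)

lemma homogeneous_sum: "(\<And>i. i \<in> I \<Longrightarrow> homogeneous d (f i)) \<Longrightarrow> homogeneous d (sum f I)"
  by (simp add: homogeneous_def ring_hom_fun_sum[OF wgrade_hom] monom_sum)

lemma homogeneous_mconst: "homogeneous 0 (mconst c)"
  by (simp add: homogeneous_def wgrade_def mpol_eval_mconst[OF ring_hom_fun_mconst_poly] monom_0)

lemma homogeneous_mvar: "homogeneous 1 (mvar i)"
  by (simp add: homogeneous_def wgrade_def mpol_eval_mvar[OF ring_hom_fun_mconst_poly])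

lemma homogeneous_prod:
  assumes "\<And>i. i \<in> I \<Longrightarrow> homogeneous (d i) (f i)"
  shows "homogeneous (sum d I) (prod f I)"
  using assms
proof (induction I rule: infinite_finite_induct)
  case (insert i I)
  then show ?case by (simp add: homogeneous_mult)
qed (use homogeneous_mconst[of 1] in \<open>simp_all add: ring_hom_funD(2)[OF ring_hom_fun_mconst]\<close>)

lemma of_int_mpol: "of_int c = (mconst (of_int c) :: 'k::comm_ring_1 mpol)"
  by (simp add: ring_hom_fun_of_int[OF ring_hom_fun_mconst])

lemma total_degree_homogeneous: "homogeneous d f \<Longrightarrow> f \<noteq> 0 \<Longrightarrow> total_degree f = d"
  by (simp add: homogeneous_def total_degree_eq degree_monom_eq)

lemma total_degree_0_imp_const:
  assumes "total_degree f = 0" shows "f = mconst (Poly_Mapping.lookup f 0)"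
proof -
  have *: "wdeg (\<lambda>_. 1) m = 0" if "m \<in> Poly_Mapping.keys f" for m
    using that assms degree_wgrade_le_iff[of "\<lambda>_. 1" f 0] by (auto simp: total_degree_eq)
  have "m = 0" if "m \<in> Poly_Mapping.keys f" for m
  proof (rule poly_mapping_eqI)
    fix i show "Poly_Mapping.lookup m i = Poly_Mapping.lookup 0 i"
      using *[OF that] by (auto simp: wdeg_def in_keys_iff)
  qed
  then have "Poly_Mapping.lookup f m = 0" if "m \<noteq> 0" for m using that by (auto simp: in_keys_iff)
  then show ?thesis
    by (intro poly_mapping_eqI) (auto simp: mconst_def lookup_single when_def)
qed

lemma total_degree_mconst: "total_degree (mconst c) = 0"
  by (simp add: total_degree_def mconst_def)

lemma subring_mpols_below: "subring_set (mpols_below n :: 'k::comm_ring_1 mpol set)"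
proof -
  note A = mpol_subalgebra_mpols_below[of n, where 'k='k, unfolded mpol_subalgebra_def]
  have c: "mconst c \<in> mpols_below n" for c :: 'k using A by blast
  have "a - b \<in> mpols_below n" if "a \<in> mpols_below n" "b \<in> mpols_below n" for a b :: "'k mpol"
  proof -
    have "a + mconst (of_int (-1)) * b \<in> mpols_below n" using A c that by blast
    then show ?thesis unfolding of_int_mpol[symmetric] by simp
  qed
  then show ?thesis
    using A c[of 0] c[of 1] ring_hom_funD(1,2)[OF ring_hom_fun_mconst] unfolding subring_set_def by metis
qed

lemma mconst_mpols_below: "mconst c \<in> mpols_below n"
  using mpol_subalgebra_mpols_below[of n] by (auto simp: mpol_subalgebra_def)

lemma mvar_mpols_below: "i < n \<Longrightarrow> mvar i \<in> mpols_below n"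
  by (auto simp: mpols_below_def mvar_def)

text \<open>With weight 0 for the variables below \<open>n\<close> and weight 1 for the others,
  membership means weighted degree 0. Additivity of this degree shows that the subring contains all
  factors of its nonzero elements, hence that relative and absolute divisibility agree.\<close>

lemma mpols_below_iff_degree: "f \<in> mpols_below n \<longleftrightarrow> degree (wgrade (\<lambda>i. if i < n then 0 else 1) f) = 0"
proof -
  have "wdeg (\<lambda>i. if i < n then 0 else 1) m \<le> 0 \<longleftrightarrow> Poly_Mapping.keys m \<subseteq> {..<n}" for m
    by (auto simp: wdeg_def subset_iff in_keys_iff split: if_splits)
  then show ?thesis
    using degree_wgrade_le_iff[of "\<lambda>i. if i < n then 0 else 1" f 0]
    by (simp add: mpols_below_def)
qed

lemma mpols_below_factor:
  assumes "f * g \<in> mpols_below n" "f * g \<noteq> (0 :: 'k::idom mpol)"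
  shows "f \<in> mpols_below n"
  using assms degree_wgrade_mult[of f g "\<lambda>i. if i < n then 0 else 1"]
  by (auto simp: mpols_below_iff_degree)

lemma dvd_in_mpols_below:
  fixes f :: "'k::idom mpol"
  assumes "g \<in> mpols_below n"
  shows "dvd_in (mpols_below n) f g \<longleftrightarrow> f dvd g"
proof
  assume "f dvd g"
  then obtain c where c: "g = f * c" by (elim dvdE)
  show "dvd_in (mpols_below n) f g"
  proof (cases "g = 0")
    case True
    then show ?thesis using subring_setD(1)[OF subring_mpols_below[of n]] by (auto simp: dvd_in_def intro!: bexI[of _ 0])
  next
    case False
    then have "c \<in> mpols_below n" using assms c mpols_below_factor[of c f n] by (simp add: mult.commute)
    then show ?thesis using c by (auto simp: dvd_in_def)
  qed
qed (auto simp: dvd_in_def)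

lemma unit_in_mpols_below:
  fixes f :: "'k::field mpol"
  shows "unit_in (mpols_below n) f \<longleftrightarrow> f \<noteq> 0 \<and> total_degree f = 0"
proof
  assume "unit_in (mpols_below n) f"
  then obtain g where "1 = f * g" by (auto simp: unit_in_def dvd_in_def)
  then show "f \<noteq> 0 \<and> total_degree f = 0"
    using total_degree_mult[of f g] total_degree_mconst[of "1::'k"] ring_hom_funD(2)[OF ring_hom_fun_mconst]
    by (metis add_is_0 mult_zero_left mult_zero_right zero_neq_one)
next
  assume f: "f \<noteq> 0 \<and> total_degree f = 0"
  then obtain c where c: "f = mconst c" using total_degree_0_imp_const by blast
  then have "c \<noteq> 0" using f ring_hom_funD(1)[OF ring_hom_fun_mconst] by auto
  then have "f * mconst (1 / c) = 1"
    using c ring_hom_funD(2,4)[OF ring_hom_fun_mconst] by (metis nonzero_mult_div_cancel_left times_divide_eq_right mult.right_neutral)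
  then show "unit_in (mpols_below n) f"
    using c mconst_mpols_below unfolding unit_in_def dvd_in_def by metis
qed

lemma unit_in_mpols_below_0:
  fixes f :: "'k::field mpol"
  assumes "f \<in> mpols_below 0" "f \<noteq> 0"
  shows "unit_in (mpols_below 0) f"
proof -
  have "degree (wgrade (\<lambda>_. 1) f) \<le> 0"
    using assms(1) by (subst degree_wgrade_le_iff) (auto simp: mpols_below_def wdeg_def)
  then show ?thesis using assms(2) by (simp add: unit_in_mpols_below total_degree_eq)
qed

section \<open>Unique factorisation\<close>

lemma poly_mvar_mpols_below:
  assumes "Q \<in> polys_over (mpols_below n)"
  shows "poly Q (mvar n) \<in> mpols_below (Suc n)"
proof -
  have "mpols_below n \<subseteq> (mpols_below (Suc n) :: 'a mpol set)" by (force simp: mpols_below_def)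
  then have "coeff Q i \<in> mpols_below (Suc n)" for i using assms by (auto simp: polys_over_def)
  moreover have "mvar n ^ i \<in> (mpols_below (Suc n) :: 'a mpol set)" for i
    by (induction i) (auto intro: subring_setD[OF subring_mpols_below] mvar_mpols_below)
  ultimately show ?thesis unfolding poly_altdef
    by (intro subring_set_sum subring_mpols_below subring_setD(5)[OF subring_mpols_below])
qed

text \<open>Together with \<open>poly_mvar_inj\<close> this identifies k[x_0,...,x_n] with the
  polynomials in x_n over k[x_0,...,x_(n-1)], via substitution of \<open>mvar n\<close>. The values
  of the substitution form a subalgebra containing all the variables.\<close>

lemma mpols_below_Suc_poly:
  assumes f: "f \<in> mpols_below (Suc n)"
  obtains Q where "Q \<in> polys_over (mpols_below n)" "f = poly Q (mvar n :: 'k::comm_ring_1 mpol)"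
proof -
  let ?A = "(\<lambda>Q. poly Q (mvar n :: 'k mpol)) ` polys_over (mpols_below n)"
  note P = subring_setD[OF subring_polys_over[OF subring_mpols_below[of n, where 'k='k]]]
  have cA: "mconst c \<in> ?A" for c
    using const_polys_over[OF subring_mpols_below mconst_mpols_below[of c n]]
    by (intro image_eqI[of _ _ "[:mconst c:]"]) auto
  have A: "mpol_subalgebra ?A"
    unfolding mpol_subalgebra_def
  proof (intro conjI ballI)
    show "range mconst \<subseteq> ?A" using cA by auto
    fix f g assume "f \<in> ?A" "g \<in> ?A"
    then obtain p q where "p \<in> polys_over (mpols_below n)" "q \<in> polys_over (mpols_below n)"
      "f = poly p (mvar n)" "g = poly q (mvar n)" by blast
    then show "f + g \<in> ?A" "f * g \<in> ?A"
      using P(3,5)[of p q] by (auto simp flip: poly_add poly_mult)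
  qed
  have var: "mvar i \<in> ?A" if "i < Suc n" for i
  proof (cases "i = n")
    case True
    have "[:0, 1:] \<in> polys_over (mpols_below n :: 'k mpol set)"
      using subring_setD(1,2)[OF subring_mpols_below[of n]] by (auto simp: polys_over_def coeff_pCons split: nat.split)
    then show ?thesis using True by (intro image_eqI[of _ _ "[:0, 1:]"]) auto
  next
    case False
    then show ?thesis using that const_polys_over[OF subring_mpols_below mvar_mpols_below[of i n]]
      by (intro image_eqI[of _ _ "[:mvar i:]"]) auto
  qed
  have "Poly_Mapping.single m c \<in> ?A" if "Poly_Mapping.keys m \<subseteq> {..<Suc n}" for m c
  proof -
    have "(\<Prod>i\<in>Poly_Mapping.keys m. \<Prod>_<Poly_Mapping.lookup m i. mvar i) \<in> ?A"
      using var that by (intro mpol_subalgebra_prod A) auto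
    then show ?thesis
      using A cA[of c] unfolding single_eq_prod_mvar[of m c] mpol_subalgebra_def by blast
  qed
  then have "(\<Sum>m\<in>Poly_Mapping.keys f. Poly_Mapping.single m (Poly_Mapping.lookup f m)) \<in> ?A"
    using f by (intro mpol_subalgebra_sum[OF A]) (auto simp: mpols_below_def)
  then show ?thesis using that by (auto simp: sum_single_lookup)
qed

lemma eval_poly_mvar:
  assumes "Q \<in> polys_over (mpols_below n)"
  shows "mpol_eval id (v(n := x)) (poly Q (mvar n)) = poly (map_poly (mpol_eval id v) Q) x"
proof -
  have "mpol_eval id (v(n := x)) (coeff Q i) = mpol_eval id v (coeff Q i)" for i
    using assms by (intro mpol_eval_cong[of _ n]) (auto simp: polys_over_def)
  then have "mpol_eval id (v(n := x)) (poly Q (mvar n)) = (\<Sum>i\<le>degree Q. mpol_eval id v (coeff Q i) * x ^ i)"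
    by (simp add: poly_altdef ring_hom_fun_sum[OF eval_hom] ring_hom_funD[OF eval_hom]
        ring_hom_fun_power[OF eval_hom] mpol_eval_mvar[OF ring_hom_fun_id])
  also have "\<dots> = poly (map_poly (mpol_eval id v) Q) x"
  proof -
    have "degree (map_poly (mpol_eval id v) Q) \<le> degree Q" by (rule map_poly_degree_leq)
    then have "poly (map_poly (mpol_eval id v) Q) x = (\<Sum>i\<le>degree Q. coeff (map_poly (mpol_eval id v) Q) i * x ^ i)"
      unfolding poly_altdef by (intro sum.mono_neutral_left) (auto simp: coeff_eq_0)
    then show ?thesis by (simp add: coeff_map_poly mpol_eval_zero)
  qed
  finally show ?thesis .
qed

text \<open>Induction on the number of variables: with the others fixed, a polynomial in the last
  variable that vanishes on an infinite field has zero coefficients.\<close>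

lemma mpols_below_eq_0:
  fixes f :: "'k::field_char_0 mpol"
  assumes "f \<in> mpols_below n" "\<And>v. mpol_eval id v f = 0"
  shows "f = 0"
  using assms
proof (induction n arbitrary: f)
  case 0
  have "f = mconst (Poly_Mapping.lookup f 0)"
    by (intro total_degree_0_imp_const)
       (use 0(1) in \<open>auto simp: total_degree_eq degree_wgrade_le_iff[of _ _ 0, simplified] mpols_below_def wdeg_def\<close>)
  then show ?case using 0(2)[of "\<lambda>_. 0"] mpol_eval_mconst[OF ring_hom_fun_id]
    by (metis id_apply ring_hom_funD(1) ring_hom_fun_mconst)
next
  case (Suc n)
  obtain Q where Q: "Q \<in> polys_over (mpols_below n)" "f = poly Q (mvar n)"
    using mpols_below_Suc_poly[OF Suc.prems(1)] .
  have "coeff Q i = 0" for i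
  proof (rule Suc.IH)
    show "coeff Q i \<in> mpols_below n" using Q(1) by (simp add: polys_over_def)
    fix v
    have "poly (map_poly (mpol_eval id v) Q) x = 0" for x
      unfolding eval_poly_mvar[OF Q(1), symmetric] Q(2)[symmetric] by (rule Suc.prems(2))
    then have "map_poly (mpol_eval id v) Q = 0" by (simp add: poly_all_0_iff_0[symmetric])
    then have "coeff (map_poly (mpol_eval id v) Q) i = 0" by simp
    then show "mpol_eval id v (coeff Q i) = 0" by (simp add: coeff_map_poly mpol_eval_zero)
  qed
  then show ?case using Q(2) by (simp add: poly_eq_iff[of Q 0] poly_altdef)
qed

lemma poly_mvar_eq_0:
  fixes Q :: "'k::field_char_0 mpol poly"
  assumes Q: "Q \<in> polys_over (mpols_below n)" and 0: "poly Q (mvar n) = 0"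
  shows "Q = 0"
proof (rule poly_eqI)
  fix i
  have "coeff Q i = 0"
  proof (rule mpols_below_eq_0)
    show "coeff Q i \<in> mpols_below n" using Q by (simp add: polys_over_def)
    fix v
    have "poly (map_poly (mpol_eval id v) Q) x = 0" for x
      unfolding eval_poly_mvar[OF Q, symmetric] 0 by (rule mpol_eval_zero)
    then have "map_poly (mpol_eval id v) Q = 0" by (simp add: poly_all_0_iff_0[symmetric])
    then have "coeff (map_poly (mpol_eval id v) Q) i = 0" by simp
    then show "mpol_eval id v (coeff Q i) = 0" by (simp add: coeff_map_poly mpol_eval_zero)
  qed
  then show "coeff Q i = coeff 0 i" by simp
qed

lemma poly_mvar_inj:
  fixes Q :: "'k::field_char_0 mpol poly"
  assumes "Q \<in> polys_over (mpols_below n)" "Q' \<in> polys_over (mpols_below n)" "poly Q (mvar n) = poly Q' (mvar n)"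
  shows "Q = Q'"
proof -
  have "Q - Q' \<in> polys_over (mpols_below n)"
    by (rule subring_setD(4)[OF subring_polys_over[OF subring_mpols_below] assms(1,2)])
  then show ?thesis using poly_mvar_eq_0[of "Q - Q'" n] assms(3) by simp
qed

lemma unit_in_poly_mvar:
  fixes Q :: "'k::field_char_0 mpol poly"
  assumes Q: "Q \<in> polys_over (mpols_below n)"
  shows "unit_in (mpols_below (Suc n)) (poly Q (mvar n)) \<longleftrightarrow> unit_in (polys_over (mpols_below n)) Q"
proof
  note P = subring_setD[OF subring_polys_over[OF subring_mpols_below[of n, where 'k='k]]]
  assume "unit_in (mpols_below (Suc n)) (poly Q (mvar n))"
  then obtain g where "g \<in> mpols_below (Suc n)" "1 = poly Q (mvar n) * g" by (auto simp: unit_in_def dvd_in_def)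
  then obtain G where G: "G \<in> polys_over (mpols_below n)" "1 = poly Q (mvar n) * poly G (mvar n)"
    using mpols_below_Suc_poly by metis
  then have "poly 1 (mvar n) = poly (Q * G) (mvar n)" by simp
  then have "1 = Q * G" using P G Q by (intro poly_mvar_inj) auto
  then show "unit_in (polys_over (mpols_below n)) Q" using Q G by (auto simp: unit_in_def dvd_in_def)
next
  assume "unit_in (polys_over (mpols_below n)) Q"
  then obtain G where G: "G \<in> polys_over (mpols_below n)" "1 = Q * G" by (auto simp: unit_in_def dvd_in_def)
  then have "1 = poly Q (mvar n) * poly G (mvar n)" by (metis poly_1 poly_mult)
  then show "unit_in (mpols_below (Suc n)) (poly Q (mvar n))"
    using poly_mvar_mpols_below[OF Q] poly_mvar_mpols_below[OF G(1)] by (auto simp: unit_in_def dvd_in_def)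
qed

lemma dvd_in_poly_mvar:
  fixes Q :: "'k::field_char_0 mpol poly"
  assumes Q: "Q \<in> polys_over (mpols_below n)" "G \<in> polys_over (mpols_below n)"
  shows "dvd_in (mpols_below (Suc n)) (poly Q (mvar n)) (poly G (mvar n)) \<longleftrightarrow> dvd_in (polys_over (mpols_below n)) Q G"
proof
  note P = subring_setD[OF subring_polys_over[OF subring_mpols_below[of n, where 'k='k]]]
  assume "dvd_in (mpols_below (Suc n)) (poly Q (mvar n)) (poly G (mvar n))"
  then obtain h where "h \<in> mpols_below (Suc n)" "poly G (mvar n) = poly Q (mvar n) * h" by (auto simp: dvd_in_def)
  then obtain H where H: "H \<in> polys_over (mpols_below n)" "poly G (mvar n) = poly (Q * H) (mvar n)"
    using mpols_below_Suc_poly by (metis poly_mult)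
  then have "G = Q * H" using P Q by (intro poly_mvar_inj) auto
  then show "dvd_in (polys_over (mpols_below n)) Q G" using H by (auto simp: dvd_in_def)
next
  assume "dvd_in (polys_over (mpols_below n)) Q G"
  then obtain H where H: "H \<in> polys_over (mpols_below n)" "G = Q * H" by (auto simp: dvd_in_def)
  then show "dvd_in (mpols_below (Suc n)) (poly Q (mvar n)) (poly G (mvar n))"
    unfolding dvd_in_def by (intro bexI[of _ "poly H (mvar n)"] poly_mvar_mpols_below) simp_all
qed

lemma irreducible_in_poly_mvar:
  fixes Q :: "'k::field_char_0 mpol poly"
  assumes Q: "Q \<in> polys_over (mpols_below n)" and irr: "irreducible_in (mpols_below (Suc n)) (poly Q (mvar n))"
  shows "irreducible_in (polys_over (mpols_below n)) Q"
  unfolding irreducible_in_def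
proof (intro conjI ballI impI Q)
  show "Q \<noteq> 0" using irr by (auto simp: irreducible_in_def)
  show "\<not> unit_in (polys_over (mpols_below n)) Q"
    using irr unit_in_poly_mvar[OF Q] by (simp add: irreducible_in_def)
  fix G H :: "'k mpol poly"
  assume GH: "G \<in> polys_over (mpols_below n)" "H \<in> polys_over (mpols_below n)" "Q = G * H"
  then have "unit_in (mpols_below (Suc n)) (poly G (mvar n)) \<or> unit_in (mpols_below (Suc n)) (poly H (mvar n))"
    using irr poly_mvar_mpols_below[OF GH(1)] poly_mvar_mpols_below[OF GH(2)]
    unfolding irreducible_in_def GH(3) poly_mult by blast
  then show "unit_in (polys_over (mpols_below n)) G \<or> unit_in (polys_over (mpols_below n)) H"
    using GH unit_in_poly_mvar by blast
qed

lemma prime_product_in_mult: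
  assumes A: "subring_set A" and "prime_product_in A a" "prime_product_in A b"
  shows "prime_product_in A (a * b)"
proof -
  obtain u ps v qs where 1: "unit_in A u" "\<forall>p\<in>set ps. prime_in A p" "a = u * prod_list ps"
    and 2: "unit_in A v" "\<forall>p\<in>set qs. prime_in A p" "b = v * prod_list qs"
    using assms by (auto simp: prime_product_in_def)
  obtain u' v' where "u' \<in> A" "1 = u * u'" "v' \<in> A" "1 = v * v'" using 1(1) 2(1) by (auto simp: unit_in_def dvd_in_def)
  then have "1 = (u * v) * (u' * v')" "u' * v' \<in> A" using A
    by (auto simp: mult_ac intro: subring_setD)
  then have "unit_in A (u * v)" using A 1(1) 2(1) by (auto simp: unit_in_def dvd_in_def intro: subring_setD)
  then show ?thesis
    unfolding prime_product_in_def using 1 2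
    by (intro exI[of _ "u * v"] exI[of _ "ps @ qs"]) (auto simp: mult_ac)
qed

text \<open>The inductive step turns irreducibles into primes by the results over a factorial
  coefficient set. Factorisations exist by induction on the total degree, because nonunits have
  positive degree.\<close>

lemma factorial_mpols_below: "factorial_set (mpols_below n :: 'k::field_char_0 mpol set)"
proof (induction n)
  case 0
  have "prime_product_in (mpols_below 0) f" if "f \<in> mpols_below 0" "f \<noteq> 0" for f :: "'k mpol"
  proof -
    have "unit_in (mpols_below 0) f" using that by (rule unit_in_mpols_below_0)
    then show ?thesis unfolding prime_product_in_def by (intro exI[of _ f] exI[of _ "[]"]) simp
  qed
  then show ?case by (simp add: factorial_set_def subring_mpols_below)
next
  case (Suc n)
  let ?R = "mpols_below (Suc n) :: 'k mpol set"
  have prm: "prime_in ?R f" if f: "irreducible_in ?R f" for f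
  proof -
    obtain Q where Q: "Q \<in> polys_over (mpols_below n)" "f = poly Q (mvar n)"
      using mpols_below_Suc_poly[of f n] f by (auto simp: irreducible_in_def)
    have p: "prime_in (polys_over (mpols_below n)) Q"
      using irreducible_imp_prime_over[OF Suc] irreducible_in_poly_mvar[OF Q(1)] f Q(2) by blast
    have "dvd_in ?R f g \<or> dvd_in ?R f h" if gh: "g \<in> ?R" "h \<in> ?R" "dvd_in ?R f (g * h)" for g h
    proof -
      obtain G where G: "G \<in> polys_over (mpols_below n)" "g = poly G (mvar n)" using mpols_below_Suc_poly[OF gh(1)] .
      obtain H where H: "H \<in> polys_over (mpols_below n)" "h = poly H (mvar n)" using mpols_below_Suc_poly[OF gh(2)] .
      have GH: "G * H \<in> polys_over (mpols_below n)" using G H subring_setD(5)[OF subring_polys_over[OF subring_mpols_below]] by blast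
      have "dvd_in (polys_over (mpols_below n)) Q (G * H)"
        using gh(3) dvd_in_poly_mvar[OF Q(1) GH] by (simp add: Q G H)
      then show ?thesis using p G H Q dvd_in_poly_mvar[OF Q(1)] unfolding prime_in_def by blast
    qed
    then show ?thesis using f unfolding prime_in_def irreducible_in_def by blast
  qed
  have "prime_product_in ?R f" if "f \<in> ?R" "f \<noteq> 0" for f
    using that
  proof (induction "total_degree f" arbitrary: f rule: less_induct)
    case less
    show ?case
    proof (cases "unit_in ?R f")
      case True
      then show ?thesis unfolding prime_product_in_def by (intro exI[of _ f] exI[of _ "[]"]) simp
    next
      case nu: False
      show ?thesis
      proof (cases "irreducible_in ?R f")
        case True
        then show ?thesis unfolding prime_product_in_def
          using prm by (intro exI[of _ 1] exI[of _ "[f]"]) (auto simp: unit_in_def dvd_in_def subring_setD[OF subring_mpols_below] intro!: bexI[of _ 1])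
      next
        case False
        then obtain g h where gh: "g \<in> ?R" "h \<in> ?R" "f = g * h" "\<not> unit_in ?R g" "\<not> unit_in ?R h"
          using nu less.prems unfolding irreducible_in_def by blast
        then have nz: "g \<noteq> 0" "h \<noteq> 0" using less.prems by auto
        then have "total_degree g > 0" "total_degree h > 0" using gh by (auto simp: unit_in_mpols_below)
        then have "total_degree g < total_degree f" "total_degree h < total_degree f"
          using total_degree_mult[OF nz] gh(3) by auto
        then show ?thesis using less.hyps gh nz prime_product_in_mult[OF subring_mpols_below] by blast
      qed
    qed
  qed
  then show ?case by (simp add: factorial_set_def subring_mpols_below)
qed

lemma prime_divisor_mpols_below:
  fixes f :: "'k::field_char_0 mpol"
  assumes f: "f \<in> mpols_below n" "f \<noteq> 0" "total_degree f > 0"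
  obtains q where "prime_in (mpols_below n) q" "q dvd f"
proof -
  obtain u ps where u: "unit_in (mpols_below n) u" and ps: "\<forall>p\<in>set ps. prime_in (mpols_below n) p" and a: "f = u * prod_list ps"
    using factorial_mpols_below[of n] f by (auto simp: factorial_set_def prime_product_in_def)
  have "ps \<noteq> []" using u f a by (auto simp: unit_in_mpols_below)
  then obtain p qs where "ps = p # qs" by (cases ps) auto
  then show ?thesis using that[of p] ps a by (auto intro: dvd_mult)
qed

lemma prime_in_mpols_below_degree:
  "prime_in (mpols_below n) q \<Longrightarrow> total_degree (q :: 'k::field mpol) > 0"
  by (auto simp: prime_in_def unit_in_mpols_below)

lemma prime_imp_irreducible_mpols_below:
  fixes q :: "'k::field mpol"
  assumes q: "prime_in (mpols_below n) q"
  shows "irreducible_in (mpols_below n) q"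
  unfolding irreducible_in_def
proof (intro conjI ballI impI)
  show "q \<in> mpols_below n" "q \<noteq> 0" "\<not> unit_in (mpols_below n) q" using q by (auto simp: prime_in_def)
  fix g h :: "'k mpol" assume gh: "g \<in> mpols_below n" "h \<in> mpols_below n" "q = g * h"
  have nz: "g \<noteq> 0" "h \<noteq> 0" using gh q by (auto simp: prime_in_def)
  have "dvd_in (mpols_below n) q (g * h)"
    using gh dvd_in_mpols_below[of "g * h" n q] q by (simp add: prime_in_def)
  then have "dvd_in (mpols_below n) q g \<or> dvd_in (mpols_below n) q h"
    using q gh(1,2) unfolding prime_in_def by blast
  then have "q dvd g \<or> q dvd h" by (auto simp: dvd_in_def)
  moreover have "total_degree q = total_degree g + total_degree h" using total_degree_mult[OF nz] gh by simp
  moreover have "total_degree q \<le> total_degree f" if "q dvd f" "f \<noteq> 0" for f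
    using that total_degree_mult[of q] by (auto elim!: dvdE)
  ultimately show "unit_in (mpols_below n) g \<or> unit_in (mpols_below n) h"
    using nz by (fastforce simp: unit_in_mpols_below)
qed

text \<open>A prime of \<open>\<alpha>\<close> divides \<open>\<beta>\<close> or all the \<open>a K\<close>; the primes of the second kind make up \<open>q\<close>.\<close>

lemma common_divisor_degree:
  fixes \<alpha> \<beta> :: "'k::field_char_0 mpol"
  assumes "\<alpha> \<in> mpols_below n" "\<alpha> \<noteq> 0" "\<beta> \<noteq> 0" "\<beta> \<in> mpols_below n"
    and "\<And>K. K \<in> S \<Longrightarrow> a K \<in> mpols_below n \<and> \<alpha> dvd a K * \<beta>"
  shows "\<exists>q\<in>mpols_below n. q dvd \<alpha> \<and> (\<forall>K\<in>S. q dvd a K) \<and> total_degree \<alpha> \<le> total_degree q + total_degree \<beta>"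
  using assms
proof (induction "total_degree \<alpha>" arbitrary: \<alpha> \<beta> a rule: less_induct)
  case less
  let ?R = "mpols_below n :: 'k mpol set"
  show ?case
  proof (cases "total_degree \<alpha> = 0")
    case True
    then show ?thesis using subring_setD(2)[OF subring_mpols_below[of n]] by (intro bexI[of _ 1]) auto
  next
    case False
    then obtain p where p: "prime_in ?R p" "p dvd \<alpha>"
      using prime_divisor_mpols_below[OF less.prems(1,2)] by auto
    have pnz: "p \<noteq> 0" and pR: "p \<in> ?R" using p by (auto simp: prime_in_def)
    obtain \<alpha>' where \<alpha>': "\<alpha> = p * \<alpha>'" using p(2) by (elim dvdE)
    have \<alpha>'nz: "\<alpha>' \<noteq> 0" using less.prems(2) \<alpha>' by auto
    have \<alpha>'R: "\<alpha>' \<in> ?R" using mpols_below_factor[of \<alpha>' p n] less.prems \<alpha>' by (simp add: mult.commute)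
    have deg: "total_degree \<alpha> = total_degree p + total_degree \<alpha>'" using total_degree_mult[OF pnz \<alpha>'nz] \<alpha>' by simp
    then have lt: "total_degree \<alpha>' < total_degree \<alpha>" using prime_in_mpols_below_degree[OF p(1)] by simp
    show ?thesis
    proof (cases "\<forall>K\<in>S. p dvd a K")
      case True
      then have "\<forall>K. \<exists>b. K \<in> S \<longrightarrow> a K = p * b" by (metis dvdE)
      then obtain b where b: "\<And>K. K \<in> S \<Longrightarrow> a K = p * b K" by metis
      have "b K \<in> ?R \<and> \<alpha>' dvd b K * \<beta>" if K: "K \<in> S" for K
      proof
        show "b K \<in> ?R"
          using mpols_below_factor[of "b K" p n] less.prems(5)[OF K] b[OF K] subring_setD(1)[OF subring_mpols_below[of n]]
          by (cases "b K = 0") (auto simp: mult.commute pnz)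
        show "\<alpha>' dvd b K * \<beta>"
          using less.prems(5)[OF K] b[OF K] \<alpha>' pnz by (simp add: mult.assoc)
      qed
      from less.hyps[OF lt \<alpha>'R \<alpha>'nz less.prems(3,4), of b, OF this]
      obtain q where q: "q \<in> ?R" "q dvd \<alpha>'" "\<forall>K\<in>S. q dvd b K" "total_degree \<alpha>' \<le> total_degree q + total_degree \<beta>" by blast
      have qnz: "q \<noteq> 0" using q(2) \<alpha>'nz by auto
      show ?thesis
      proof (intro bexI[of _ "p * q"] conjI ballI)
        show "p * q \<in> ?R" using subring_setD(5)[OF subring_mpols_below] pR q(1) by blast
        show "p * q dvd \<alpha>" using q(2) \<alpha>' by simp
        show "p * q dvd a K" if "K \<in> S" for K using q(3) b[OF that] that by simp
        show "total_degree \<alpha> \<le> total_degree (p * q) + total_degree \<beta>"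
          using total_degree_mult[OF pnz qnz] deg q(4) by simp
      qed
    next
      case False
      then obtain K where K: "K \<in> S" "\<not> p dvd a K" by blast
      have aK: "a K \<in> ?R" "\<alpha> dvd a K * \<beta>" using less.prems(5)[OF K(1)] by auto
      have "p dvd a K * \<beta>" using aK(2) p(2) dvd_trans by blast
      moreover have "a K * \<beta> \<in> ?R" using aK(1) less.prems(4) subring_setD(5)[OF subring_mpols_below] by blast
      ultimately have "p dvd \<beta>"
        using p(1) aK(1) less.prems(4) K(2) by (auto simp: prime_in_def dvd_in_mpols_below)
      then obtain \<beta>' where \<beta>': "\<beta> = p * \<beta>'" by (elim dvdE)
      have \<beta>'nz: "\<beta>' \<noteq> 0" using less.prems(3) \<beta>' by auto
      have \<beta>'R: "\<beta>' \<in> ?R" using mpols_below_factor[of \<beta>' p n] less.prems \<beta>' by (simp add: mult.commute)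
      have "a K \<in> ?R \<and> \<alpha>' dvd a K * \<beta>'" if "K \<in> S" for K
        using less.prems(5)[OF that] \<alpha>' \<beta>' pnz by (simp add: mult.left_commute)
      from less.hyps[OF lt \<alpha>'R \<alpha>'nz \<beta>'nz \<beta>'R, of a, OF this]
      obtain q where q: "q \<in> ?R" "q dvd \<alpha>'" "\<forall>K\<in>S. q dvd a K" "total_degree \<alpha>' \<le> total_degree q + total_degree \<beta>'" by blast
      have "total_degree \<beta> = total_degree p + total_degree \<beta>'" using total_degree_mult[OF pnz \<beta>'nz] \<beta>' by simp
      then show ?thesis using q deg \<alpha>' by (intro bexI[of _ q]) auto
    qed
  qed
qed

section \<open>The Nullstellensatz for hypersurfaces\<close>

text \<open>Induction on the number of variables, with \<open>q\<close> regarded as a polynomial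
  \<open>Q\<close> in the last one. If \<open>Q\<close> is constant, the coefficients of
  \<open>g\<close> are treated one by one. Otherwise, if \<open>Q\<close> did not divide
  \<open>G\<close>, elimination would give a nonzero \<open>b\<close> in the ideal of both. At a
  point where neither \<open>b\<close> nor the leading coefficient of \<open>Q\<close> vanishes, the
  specialized \<open>Q\<close> keeps its positive degree and has a root; there \<open>G\<close>
  vanishes too, contradicting the value of \<open>b\<close>.\<close>

lemma hypersurface_nullstellensatz:
  fixes q :: "'k::{alg_closed_field, field_char_0} mpol"
  assumes "irreducible_in (mpols_below n) q" "g \<in> mpols_below n"
    and "\<And>v. mpol_eval id v q = 0 \<Longrightarrow> mpol_eval id v g = 0"
  shows "q dvd g"
  using assms
proof (induction n arbitrary: q g)
  case 0
  then have "unit_in (mpols_below 0) q"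
    by (intro unit_in_mpols_below_0) (auto simp: irreducible_in_def)
  then show ?case using 0 by (simp add: irreducible_in_def)
next
  case (Suc n)
  let ?R = "mpols_below n :: 'k mpol set"
  obtain Q where Q: "Q \<in> polys_over ?R" "q = poly Q (mvar n)"
    using mpols_below_Suc_poly[of q n] Suc.prems by (auto simp: irreducible_in_def)
  obtain G where G: "G \<in> polys_over ?R" "g = poly G (mvar n)"
    using mpols_below_Suc_poly[OF Suc.prems(2)] .
  have irr: "irreducible_in (polys_over ?R) Q" using irreducible_in_poly_mvar[OF Q(1)] Suc.prems(1) Q(2) by simp
  have zero: "poly (map_poly (mpol_eval id v) G) x = 0" if "poly (map_poly (mpol_eval id v) Q) x = 0" for v x
    using that Suc.prems(3)[of "v(n := x)"]
    unfolding Q(2) G(2) eval_poly_mvar[OF Q(1)] eval_poly_mvar[OF G(1)] by blast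
  have "dvd_in (polys_over ?R) Q G"
  proof (cases "degree Q = 0")
    case True
    then obtain a where a: "Q = [:a:]" by (auto elim: degree_eq_zeroE)
    have irra: "irreducible_in ?R a" using irr irreducible_in_const[OF subring_mpols_below] a by simp
    have "dvd_in ?R a (coeff G i)" for i
    proof -
      have "a dvd coeff G i"
      proof (rule Suc.IH[OF irra])
        show "coeff G i \<in> ?R" using G by (simp add: polys_over_def)
        fix v assume "mpol_eval id v a = 0"
        then have "poly (map_poly (mpol_eval id v) G) x = 0" for x
          by (intro zero) (simp add: a mpol_eval_zero map_poly_pCons)
        then have "map_poly (mpol_eval id v) G = 0" by (simp add: poly_all_0_iff_0[symmetric])
        then have "coeff (map_poly (mpol_eval id v) G) i = 0" by simp
        then show "mpol_eval id v (coeff G i) = 0" by (simp add: coeff_map_poly mpol_eval_zero)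
      qed
      then show ?thesis using G by (simp add: dvd_in_mpols_below polys_over_def)
    qed
    then show ?thesis using dvd_in_const[OF subring_mpols_below G(1)] a by simp
  next
    case False
    show ?thesis
    proof (rule ccontr)
      assume "\<not> ?thesis"
      then obtain b u w where b: "b \<in> ?R" "b \<noteq> 0" "u \<in> polys_over ?R" "w \<in> polys_over ?R" "[:b:] = u * Q + w * G"
        using elimination_over[OF factorial_mpols_below irr G(1)] by blast
      have lR: "lead_coeff Q \<in> ?R" using Q(1) by (simp add: polys_over_def)
      have "b * lead_coeff Q \<noteq> 0" using b(2) False by auto
      moreover have "b * lead_coeff Q \<in> ?R" using b(1) lR subring_setD(5)[OF subring_mpols_below] by blast
      ultimately obtain v where v: "mpol_eval id v (b * lead_coeff Q) \<noteq> 0"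
        using mpols_below_eq_0 by blast
      let ?e = "mpol_eval id v"
      have l: "?e (lead_coeff Q) \<noteq> 0" and eb: "?e b \<noteq> 0" using v by (auto simp: ring_hom_funD[OF eval_hom])
      have "coeff (map_poly ?e Q) (degree Q) \<noteq> 0" using l by (simp add: coeff_map_poly mpol_eval_zero)
      then have "degree (map_poly ?e Q) \<ge> degree Q" by (rule le_degree)
      then obtain x where x: "poly (map_poly ?e Q) x = 0"
        using alg_closed_imp_poly_has_root[of "map_poly ?e Q"] False by auto
      have y: "poly (map_poly ?e G) x = 0" using zero[OF x] .
      let ?E = "mpol_eval id (v(n := x))"
      have "?E b = ?e b" using b(1) by (intro mpol_eval_cong[of _ n]) auto
      moreover have "?E b = ?E (poly (u * Q + w * G) (mvar n))" by (simp flip: b(5))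
      moreover have "\<dots> = 0"
        by (simp add: ring_hom_funD[OF eval_hom] eval_poly_mvar[OF Q(1)] eval_poly_mvar[OF G(1)] x y)
      ultimately show False using eb by simp
    qed
  qed
  then show ?case using dvd_in_poly_mvar[OF Q(1) G(1)] Q(2) G(2) dvd_in_mpols_below[OF Suc.prems(2)] by simp
qed

section \<open>Mixed Pfaffians of an alternating form\<close>

lemma mixpf_hom:
  assumes "ring_hom_fun h"
  shows "h (mixpf q r B L) = mixpf q r (\<lambda>a b. h (B a b)) (\<lambda>i a. h (L i a))"
  by (simp add: mixpf_def ring_hom_fun_sum[OF assms] ring_hom_fun_prod[OF assms] ring_hom_funD[OF assms]
      ring_hom_fun_of_int[OF assms])

text \<open>An argument in the radical cannot occur in a factor of \<open>B\<close>, so only the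
  permutations that send it to the covector \<open>L 0\<close> contribute.\<close>

lemma mixpf_last:
  fixes B :: "nat \<Rightarrow> nat \<Rightarrow> 'r::comm_ring_1"
  assumes B: "\<And>j k. j = 2 * q \<or> k = 2 * q \<Longrightarrow> B j k = 0"
  shows "mixpf q 1 B L = L 0 (2 * q) * mixpf q 0 B L'"
proof -
  let ?t = "\<lambda>\<sigma>. of_int (sign \<sigma>) *
     ((\<Prod>i<q. B (\<sigma> (2 * i)) (\<sigma> (2 * i + 1))) * (\<Prod>j<1. L j (\<sigma> (2 * q + j))))"
  have sub: "{\<sigma>. \<sigma> permutes {..<2 * q}} \<subseteq> {\<sigma>. \<sigma> permutes {..<2 * q + 1}}"
    by (auto intro: permutes_subset)
  have "mixpf q 1 B L = (\<Sum>\<sigma> | \<sigma> permutes {..<2 * q}. ?t \<sigma>)"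
    unfolding mixpf_def
  proof (intro sum.mono_neutral_right sub ballI)
    show "finite {\<sigma>. \<sigma> permutes {..<2 * q + 1}}" by (simp add: finite_permutations)
    fix \<sigma> assume "\<sigma> \<in> {\<sigma>. \<sigma> permutes {..<2 * q + 1}} - {\<sigma>. \<sigma> permutes {..<2 * q}}"
    then have \<sigma>: "\<sigma> permutes {..<2 * q + 1}" "\<not> \<sigma> permutes {..<2 * q}" by auto
    have "\<sigma> (2 * q) \<noteq> 2 * q"
    proof
      assume "\<sigma> (2 * q) = 2 * q"
      then have "\<sigma> x = x" if "x \<notin> {..<2 * q}" for x
        using \<sigma>(1) that unfolding permutes_def by (cases "x = 2 * q") auto
      then show False using \<sigma> unfolding permutes_def by blast
    qed
    moreover obtain x where x: "\<sigma> x = 2 * q" using permutes_inverses(1)[OF \<sigma>(1)] by blast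
    moreover have "x < 2 * q + 1" using permutes_lessThan[OF \<sigma>(1), of x] x by simp
    ultimately have "x < 2 * q" by (cases "x = 2 * q") auto
    then have "x div 2 < q" "x = 2 * (x div 2) \<or> x = 2 * (x div 2) + 1" by auto
    then have "\<exists>i<q. \<sigma> (2 * i) = 2 * q \<or> \<sigma> (2 * i + 1) = 2 * q" using x by metis
    then have "(\<Prod>i<q. B (\<sigma> (2 * i)) (\<sigma> (2 * i + 1))) = 0"
      using B by (intro prod_zero) auto
    then show "?t \<sigma> = 0" by simp
  qed
  also have "\<dots> = L 0 (2 * q) * mixpf q 0 B L'"
    unfolding mixpf_def sum_distrib_left
  proof (intro sum.cong)
    fix \<sigma> assume "\<sigma> \<in> {\<sigma>. \<sigma> permutes {..<2 * q + 0}}"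
    then have "\<sigma> (2 * q) = 2 * q" by (auto simp: permutes_def)
    then show "?t \<sigma> = L 0 (2 * q) * (of_int (sign \<sigma>) *
     ((\<Prod>i<q. B (\<sigma> (2 * i)) (\<sigma> (2 * i + 1))) * (\<Prod>j<0. L' j (\<sigma> (2 * q + j)))))"
      by (simp add: mult_ac)
  qed simp
  finally show ?thesis .
qed

text \<open>Everything factors through the quotient of \<open>V\<close> by the radical, whose
  dimension is smaller than the number of arguments. The covectors must vanish on the radical for
  this.\<close>

lemma mixpf_form_zero:
  fixes s :: "'k::field_char_0 \<Rightarrow> 'a::ab_group_add \<Rightarrow> 'a"
  assumes vs: "vector_space s" and V: "module.subspace s V" "fin_dim s V" and \<beta>: "altform s V \<beta>"
    and y: "\<And>j. j < 2 * q + r \<Longrightarrow> y j \<in> V"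
    and L: "\<And>i. i < r \<Longrightarrow> linfun s V (L i)" "\<And>i u. i < r \<Longrightarrow> u \<in> radical V \<beta> \<Longrightarrow> L i u = 0"
    and d: "vector_space.dim s V < vector_space.dim s (radical V \<beta>) + (2 * q + r)"
  shows "mixpf q r (\<lambda>j k. \<beta> (y j) (y k)) (\<lambda>i j. L i (y j)) = 0"
proof -
  interpret vector_space s by fact
  obtain T w where ds: "dual_system s V (radical V \<beta>) (2 * T) w (darboux_coord \<beta> w)"
    using darboux_basis[OF V \<beta>] by metis
  have bl: "\<And>v. v \<in> V \<Longrightarrow> linfun s V (\<beta> v)" "\<And>v. v \<in> V \<Longrightarrow> linfun s V (\<lambda>u. \<beta> u v)"
    using \<beta> by (auto simp: altform_def)
  have rad: "\<beta> u v = 0" "\<beta> v u = 0" if "u \<in> radical V \<beta>" "v \<in> V" for u v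
    using that altform_antisym[OF V(1) \<beta>, of u v] by (auto simp: radical_def)
  have "2 * T < 2 * q + r" using dim_dual_system[OF V ds] d by simp
  then show ?thesis
    using dual_system_expand2[OF V(1) ds y y bl rad] dual_system_expand[OF V(1) ds y L]
    by (intro mixpf_rank_less[where T="2 * T" and c="\<lambda>j a. darboux_coord \<beta> w a (y j)" and
        ?B0.0="\<lambda>a b. \<beta> (w a) (w b)" and ?L0.0="\<lambda>i a. L i (w a)"]) auto
qed

text \<open>Both expressions are top degree forms on the quotient of \<open>V\<close> by the
  radical, of dimension \<open>N\<close>. Relative to a Darboux basis they acquire the same
  determinant for the tuple \<open>y\<close>, and likewise for \<open>y'\<close>.\<close>

lemma mixpf_form_proportional:
  fixes s :: "'k::field_char_0 \<Rightarrow> 'a::ab_group_add \<Rightarrow> 'a"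
  assumes vs: "vector_space s" and V: "module.subspace s V" "fin_dim s V" and \<beta>: "altform s V \<beta>"
    and d: "vector_space.dim s V = vector_space.dim s (radical V \<beta>) + N"
    and N: "N = 2 * q + r" "N = 2 * q' + r'"
    and y: "\<And>j. j < N \<Longrightarrow> y j \<in> V" "\<And>j. j < N \<Longrightarrow> y' j \<in> V"
    and L: "\<And>i. i < r \<Longrightarrow> linfun s V (L i)" "\<And>i u. i < r \<Longrightarrow> u \<in> radical V \<beta> \<Longrightarrow> L i u = 0"
    and L': "\<And>i. i < r' \<Longrightarrow> linfun s V (L' i)" "\<And>i u. i < r' \<Longrightarrow> u \<in> radical V \<beta> \<Longrightarrow> L' i u = 0"
  shows "mixpf q r (\<lambda>j k. \<beta> (y j) (y k)) (\<lambda>i j. L i (y j)) * mixpf q' r' (\<lambda>j k. \<beta> (y' j) (y' k)) (\<lambda>i j. L' i (y' j)) =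
    mixpf q r (\<lambda>j k. \<beta> (y' j) (y' k)) (\<lambda>i j. L i (y' j)) * mixpf q' r' (\<lambda>j k. \<beta> (y j) (y k)) (\<lambda>i j. L' i (y j))"
proof -
  interpret vector_space s by fact
  obtain T w where ds: "dual_system s V (radical V \<beta>) (2 * T) w (darboux_coord \<beta> w)"
    using darboux_basis[OF V \<beta>] by metis
  have bl: "\<And>v. v \<in> V \<Longrightarrow> linfun s V (\<beta> v)" "\<And>v. v \<in> V \<Longrightarrow> linfun s V (\<lambda>u. \<beta> u v)"
    using \<beta> by (auto simp: altform_def)
  have rad: "\<beta> u v = 0" "\<beta> v u = 0" if "u \<in> radical V \<beta>" "v \<in> V" for u v
    using that altform_antisym[OF V(1) \<beta>, of u v] by (auto simp: radical_def)
  have T: "2 * T = N" using dim_dual_system[OF V ds] d by simp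
  note E2 = dual_system_expand2[OF V(1) ds, unfolded T, of _ _ \<beta>, OF _ _ bl rad]
  note E1 = dual_system_expand[OF V(1) ds, unfolded T]
  have 1: "mixpf q r (\<lambda>j k. \<beta> (y j) (y k)) (\<lambda>i j. L i (y j)) =
     detc N (\<lambda>j a. darboux_coord \<beta> w a (y j)) * mixpf q r (\<lambda>a b. \<beta> (w a) (w b)) (\<lambda>i a. L i (w a))"
    if "\<And>j. j < N \<Longrightarrow> y j \<in> V" for y
    using E2[OF that that] E1[OF that L] by (intro mixpf_rank_eq N(1)) auto
  have 2: "mixpf q' r' (\<lambda>j k. \<beta> (y j) (y k)) (\<lambda>i j. L' i (y j)) =
     detc N (\<lambda>j a. darboux_coord \<beta> w a (y j)) * mixpf q' r' (\<lambda>a b. \<beta> (w a) (w b)) (\<lambda>i a. L' i (w a))"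
    if "\<And>j. j < N \<Longrightarrow> y j \<in> V" for y
    using E2[OF that that] E1[OF that L'] by (intro mixpf_rank_eq N(2)) auto
  show ?thesis
    by (subst 1[of y, OF y(1)], assumption, subst 1[of y', OF y(2)], assumption,
        subst 2[of y, OF y(1)], assumption, subst 2[of y', OF y(2)], assumption) (simp only: mult_ac)
qed

section \<open>Coadjoint forms\<close>

context lie_algebra begin

abbreviation coform :: "('a \<Rightarrow> 'k) \<Rightarrow> 'a \<Rightarrow> 'a \<Rightarrow> 'k" where
  "coform \<xi> \<equiv> \<lambda>x y. \<xi> (br x y)"

lemma fin_dim_G: "fin_dim s G"
  using finite_dim_G by (auto simp: fin_dim_def)

lemma lie_subalgebra_G: "lie_subalgebra s br G G"
  using subspace_G br_closed by (simp add: lie_subalgebra_def)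

lemma lie_subalgebraD:
  assumes "lie_subalgebra s br G H"
  shows "subspace H" "H \<subseteq> G" "x \<in> H \<Longrightarrow> y \<in> H \<Longrightarrow> br x y \<in> H" "fin_dim s H"
  using assms fin_dim_subset[OF fin_dim_G] by (auto simp: lie_subalgebra_def)

lemma stabilizer_eq_radical: "stabilizer br H \<xi> = radical H (coform \<xi>)"
  by (simp add: stabilizer_def radical_def)

lemma altform_coform:
  assumes H: "lie_subalgebra s br G H" and \<xi>: "linfun s H \<xi>"
  shows "altform s H (coform \<xi>)"
proof -
  have G: "x \<in> G" if "x \<in> H" for x using that lie_subalgebraD(2)[OF H] by blast
  have "linfun s H (coform \<xi> x)" if "x \<in> H" for x
    using that \<xi> lie_subalgebraD(3)[OF H] unfolding linfun_def
    by (simp add: br_add_right br_scale_right G)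
  moreover have "linfun s H (\<lambda>x. coform \<xi> x y)" if "y \<in> H" for y
    using that \<xi> lie_subalgebraD(3)[OF H] unfolding linfun_def
    by (simp add: br_add_left br_scale_left G)
  moreover have "coform \<xi> x x = 0" if "x \<in> H" for x
    using that G br_self linfun_zero[OF lie_subalgebraD(1)[OF H] \<xi>] by simp
  ultimately show ?thesis by (simp add: altform_def)
qed

lemma dual_space_eq: "dual_space s H = {\<xi> \<in> extensional H. linfun s H \<xi>}"
  by (simp add: dual_space_def linfun_def)

lemma restrict_dual_space:
  assumes "lie_subalgebra s br G H" "linfun s H \<xi>"
  shows "restrict \<xi> H \<in> dual_space s H" "stabilizer br H (restrict \<xi> H) = stabilizer br H \<xi>"
  using assms lie_subalgebraD[OF assms(1)]
  by (auto simp: dual_space_eq linfun_def stabilizer_def subspace_add subspace_scale)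

lemma lie_index_le:
  assumes "lie_subalgebra s br G H" "linfun s H \<xi>"
  shows "lie_index s br H \<le> dim (stabilizer br H \<xi>)"
  unfolding lie_index_def using restrict_dual_space[OF assms]
  by (metis (no_types, lifting) bdd_below_bot cINF_lower)

lemma lie_index_attained:
  assumes H: "lie_subalgebra s br G H"
  obtains \<xi> where "linfun s H \<xi>" "dim (stabilizer br H \<xi>) = lie_index s br H"
proof -
  have "linfun s H (\<lambda>_. 0)" by (simp add: linfun_def)
  then have "dual_space s H \<noteq> {}" using restrict_dual_space[OF H] by blast
  then have "lie_index s br H \<in> (\<lambda>\<xi>. dim (stabilizer br H \<xi>)) ` dual_space s H"
    unfolding lie_index_def by (intro Inf_nat_def1) auto
  then show ?thesis using that by (auto simp: dual_space_eq)
qed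

text \<open>\<open>R\<close> is the projection onto \<open>U\<close> along the span of the dual
  vectors, and \<open>f\<close> is composed with it.\<close>

lemma linfun_extend:
  assumes V: "subspace V" "fin_dim s V" and U: "subspace U" "U \<subseteq> V" and f: "linfun s U f"
  obtains g where "linfun s V g" "\<And>x. x \<in> U \<Longrightarrow> g x = f x"
proof -
  obtain l y \<zeta> where ds: "dual_system s V U l y \<zeta>" using dual_system_exists[OF V U] .
  define R where "R x = x - (\<Sum>a<l. s (\<zeta> a x) (y a))" for x
  have \<zeta>: "\<zeta> a (x + x') = \<zeta> a x + \<zeta> a x'" "\<zeta> a (s c x) = c * \<zeta> a x" if "a < l" "x \<in> V" "x' \<in> V" for a x x' c
    using dual_systemD(2)[OF ds that(1)] that by (auto simp: linfun_def)
  have RU: "R x \<in> U" if "x \<in> V" for x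
    unfolding R_def by (rule dual_system_remainder[OF V(1) ds that])
  have "R (x + x') = R x + R x'" if "x \<in> V" "x' \<in> V" for x x'
    using that by (simp add: R_def \<zeta> scale_left_distrib sum.distrib)
  moreover have "R (s c x) = s c (R x)" if "x \<in> V" for c x
    using that by (simp add: R_def \<zeta>[where x'=x] scale_right_diff_distrib scale_sum_right)
  ultimately have "linfun s V (\<lambda>x. f (R x))"
    using f RU by (simp add: linfun_def)
  moreover have "R x = x" if "x \<in> U" for x
  proof -
    have "\<zeta> a x = 0" if "a < l" for a
      using dual_systemD(4)[OF ds] \<open>x \<in> U\<close> that by blast
    then show ?thesis by (simp add: R_def)
  qed
  ultimately show ?thesis using that by auto
qed

text \<open>Index and stabilizer of \<open>H\<close> involve functionals on \<open>H\<close>, while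
  the polynomials below are evaluated at functionals on \<open>G\<close>; extension of functionals
  bridges the two.\<close>

lemma lie_index_attained_G:
  assumes H: "lie_subalgebra s br G H"
  obtains \<xi> where "linfun s G \<xi>" "dim (stabilizer br H \<xi>) = lie_index s br H"
proof -
  obtain \<xi> where \<xi>: "linfun s H \<xi>" "dim (stabilizer br H \<xi>) = lie_index s br H"
    using lie_index_attained[OF H] .
  obtain \<eta> where \<eta>: "linfun s G \<eta>" "\<And>x. x \<in> H \<Longrightarrow> \<eta> x = \<xi> x"
    using linfun_extend[OF subspace_G fin_dim_G lie_subalgebraD(1,2)[OF H] \<xi>(1)] by blast
  have "stabilizer br H \<eta> = stabilizer br H \<xi>"
    using \<eta>(2) lie_subalgebraD(3)[OF H] by (auto simp: stabilizer_def)
  then show ?thesis using that \<eta>(1) \<xi>(2) by simp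
qed

text \<open>For a regular functional of \<open>G\<close> the index of \<open>H\<close> is at most
  the dimension of the radical of its form on \<open>H\<close>, and
  \<open>dim_isotropic_radical\<close> bounds that radical.\<close>

lemma lie_c_subalgebra_le:
  assumes H: "lie_subalgebra s br G H"
  shows "lie_c s br H \<le> lie_c s br G"
proof -
  obtain \<xi> where \<xi>: "linfun s G \<xi>" "dim (stabilizer br G \<xi>) = lie_index s br G"
    using lie_index_attained[OF lie_subalgebra_G] .
  have "lie_index s br H \<le> dim (stabilizer br H \<xi>)"
    by (rule lie_index_le[OF H linfun_mono[OF \<xi>(1) lie_subalgebraD(2)[OF H]]])
  moreover have "dim H + dim (stabilizer br H \<xi>) \<le> dim G + dim (stabilizer br G \<xi>)"
    unfolding stabilizer_eq_radical
    by (rule dim_isotropic_radical[OF subspace_G fin_dim_G altform_coform[OF lie_subalgebra_G \<xi>(1)] lie_subalgebraD(1,2)[OF H]])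
  ultimately have "dim H + lie_index s br H \<le> dim G + lie_index s br G" using \<xi>(2) by simp
  then have "real (dim H + lie_index s br H) \<le> real (dim G + lie_index s br G)" by (rule of_nat_mono)
  then show ?thesis by (simp add: lie_c_def)
qed

lemma stabilizer_subspace:
  assumes H: "lie_subalgebra s br G H" and \<xi>: "linfun s H \<xi>"
  shows "subspace (stabilizer br H \<xi>)"
proof -
  have "linfun s H (\<lambda>x. coform \<xi> x y)" if "y \<in> H" for y
    using altform_coform[OF H \<xi>] that by (simp add: altform_def)
  then show ?thesis
    unfolding stabilizer_def Ball_def by (intro subspace_kernels lie_subalgebraD(1)[OF H])
qed

abbreviation "FG \<equiv> frobenius_semiradical s br G"

lemma stabilizer_subset_semiradical:
  assumes "linfun s G \<xi>" "dim (stabilizer br G \<xi>) = lie_index s br G"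
  shows "stabilizer br G \<xi> \<subseteq> FG"
proof -
  have "restrict \<xi> G \<in> dual_reg s br G"
    using assms restrict_dual_space[OF lie_subalgebra_G assms(1)] by (simp add: dual_reg_def)
  then show ?thesis
    unfolding frobenius_semiradical_def using restrict_dual_space(2)[OF lie_subalgebra_G assms(1)]
    by (blast intro: span_base)
qed

lemma subspace_semiradical: "subspace FG"
  by (simp add: frobenius_semiradical_def)

lemma semiradical_subset: "FG \<subseteq> G"
  unfolding frobenius_semiradical_def by (intro span_minimal subspace_G) (auto simp: stabilizer_def)

end

section \<open>The semi-radical is an ideal\<close>

locale lie_algebra_char_0 = lie_algebra s br G
  for s :: "'k::field_char_0 \<Rightarrow> 'a::ab_group_add \<Rightarrow> 'a" and br G
begin

text \<open>
  Let \<open>y\<close> consist of a Darboux basis \<open>w\<close> of \<open>\<xi>\<close> followed by \<open>x \<in> G(\<xi>)\<close>. The vector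
  \<open>v(\<epsilon>) = \<Sum>\<^sub>\<sigma> sgn(\<sigma>) (\<Prod>\<^sub>i \<xi>\<^sub>\<epsilon>([y(\<sigma>(2i)), y(\<sigma>(2i + 1))])) y(\<sigma>(2m))\<close> stabilizes \<open>\<xi>\<^sub>\<epsilon> = \<xi> + \<epsilon> \<xi> \<circ> ad X\<close>, and \<open>v(0)\<close> is a nonzero
  multiple of \<open>x\<close>. Comparing the coefficients of \<open>\<epsilon>\<close> gives \<open>[X, v(0)] + v'(0) \<in> G(\<xi>)\<close>.
\<close>

lemma bracket_stabilizer_semiradical:
  assumes \<xi>: "linfun s G \<xi>" "dim (stabilizer br G \<xi>) = lie_index s br G"
    and x: "x \<in> stabilizer br G \<xi>" and X: "X \<in> G"
  shows "br X x \<in> FG"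
proof -
  note alt = altform_coform[OF lie_subalgebra_G]
  have vs: "vector_space s" ..
  obtain m w where w: "\<And>a. a < 2 * m \<Longrightarrow> w a \<in> G"
    and om: "\<And>a b. a < 2 * m \<Longrightarrow> b < 2 * m \<Longrightarrow> coform \<xi> (w a) (w b) = omega a b"
    and ds: "dual_system s G (radical G (coform \<xi>)) (2 * m) w (darboux_coord (coform \<xi>) w)"
    using darboux_basis[OF subspace_G fin_dim_G alt[OF \<xi>(1)]] by metis
  have dG: "dim G = lie_index s br G + 2 * m"
    using dim_dual_system[OF subspace_G fin_dim_G ds] \<xi>(2) by (simp add: stabilizer_eq_radical)
  have xG: "x \<in> G" and x0: "\<And>z. z \<in> G \<Longrightarrow> \<xi> (br x z) = 0"
    using x by (auto simp: stabilizer_def)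
  have x0': "\<xi> (br z x) = 0" if "z \<in> G" for z
    using altform_antisym[OF subspace_G alt[OF \<xi>(1)] xG that] x0[OF that] by simp
  define y where "y j = (if j < 2 * m then w j else x)" for j
  have yG: "y j \<in> G" for j using w xG by (simp add: y_def)
  define \<eta> where "\<eta> z = \<xi> (br X z)" for z
  have \<eta>: "linfun s G \<eta>"
    using alt[OF \<xi>(1)] X by (simp add: altform_def \<eta>_def[abs_def])
  define \<xi>' where "\<xi>' e z = \<xi> z + e * \<eta> z" for e z
  have \<xi>': "linfun s G (\<xi>' e)" for e
    using \<xi>(1) \<eta> by (simp add: linfun_def \<xi>'_def algebra_simps)
  define B where "B a b = [:\<xi> (br (y a) (y b)), \<eta> (br (y a) (y b)):]" for a b
  have hom: "ring_hom_fun (\<lambda>p. poly p e)" for e :: 'k by (simp add: ring_hom_fun_def)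
  have ev: "poly (mixpf m r B L) e = mixpf m r (\<lambda>a b. coform (\<xi>' e) (y a) (y b)) (\<lambda>i a. poly (L i a) e)" for r L e
    unfolding mixpf_hom[OF hom] by (simp add: B_def \<xi>'_def)
  have idx: "lie_index s br G \<le> dim (radical G (coform (\<xi>' e)))" for e
    using lie_index_le[OF lie_subalgebra_G \<xi>'] by (simp add: stabilizer_eq_radical)
  \<comment> \<open>The rank of the form of \<open>\<xi>' e\<close> never exceeds
    \<open>2 * m\<close>, because the index is a minimum. There are \<open>2 * m + 1\<close>
    arguments, so these expressions vanish for every \<open>e\<close>, whether
    \<open>\<xi>' e\<close> is regular or not.\<close>
  have zero: "mixpf m 1 (\<lambda>a b. coform (\<xi>' e) (y a) (y b)) (\<lambda>i a. L (y a)) = 0"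
    if "linfun s G L" "\<And>u. u \<in> radical G (coform (\<xi>' e)) \<Longrightarrow> L u = 0" for e L
    using idx[of e] dG that by (intro mixpf_form_zero[OF vs subspace_G fin_dim_G alt[OF \<xi>']] yG) auto
  \<comment> \<open>A polynomial in the deformation parameter, nonzero at 0. Where it does not
    vanish, the form has rank at least \<open>2 * m\<close> and the deformed functional is
    regular.\<close>
  define h where "h = mixpf m 0 B (\<lambda>_ _. 0)"
  have gram: "mixpf m 0 (\<lambda>a b. coform \<xi> (y a) (y b)) L = mixpf m 0 omega (\<lambda>_ _. 0)" for L
    using om by (intro mixpf_cong) (auto simp: y_def)
  have "poly h 0 \<noteq> 0"
    unfolding h_def ev using gram mixpf_omega_nonzero[of m "\<lambda>_ _. 0 :: 'k"] by (simp add: \<xi>'_def)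
  then have hnz: "h \<noteq> 0" by auto
  have reg: "stabilizer br G (\<xi>' e) \<subseteq> FG" if "poly h e \<noteq> 0" for e
  proof -
    have "\<not> dim G < dim (radical G (coform (\<xi>' e))) + (2 * m + 0)"
    proof
      assume "dim G < dim (radical G (coform (\<xi>' e))) + (2 * m + 0)"
      then have "mixpf m 0 (\<lambda>a b. coform (\<xi>' e) (y a) (y b)) (\<lambda>i a. 0) = 0"
        by (intro mixpf_form_zero[OF vs subspace_G fin_dim_G alt[OF \<xi>']] yG) auto
      then show False using that by (simp add: h_def ev)
    qed
    then show ?thesis
      using idx[of e] dG by (intro stabilizer_subset_semiradical \<xi>') (simp add: stabilizer_eq_radical)
  qed
  \<comment> \<open>\<open>v k\<close> is the coefficient of the k-th power of the parameter in the
    deformed stabilizing vector.\<close>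
  define c where "c k \<sigma> = of_int (sign \<sigma>) * coeff (\<Prod>i<m. B (\<sigma> (2 * i)) (\<sigma> (2 * i + 1))) k" for k and \<sigma> :: "nat \<Rightarrow> nat"
  define v where "v k = (\<Sum>\<sigma> | \<sigma> permutes {..<2 * m + 1}. s (c k \<sigma>) (y (\<sigma> (2 * m))))" for k
  have vG: "v k \<in> G" for k unfolding v_def by (intro subspace_sum subspace_scale subspace_G yG)
  have Lv: "L (v k) = (\<Sum>\<sigma> | \<sigma> permutes {..<2 * m + 1}. c k \<sigma> * L (y (\<sigma> (2 * m))))" if "linfun s G L" for L k
    unfolding v_def by (intro linfun_sum[OF subspace_G that] yG)
  have c1: "coeff (mixpf m 1 B (\<lambda>_ a. [:L (y a), M (y a):])) 1 = L (v 1) + M (v 0)"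
    if "linfun s G L" "linfun s G M" for L M
    unfolding Lv[OF that(1)] Lv[OF that(2)] mixpf_def
    by (simp add: coeff_sum c_def of_int_poly sum.distrib[symmetric] algebra_simps)
  have c0: "coeff (mixpf m 1 B (\<lambda>_ a. [:L (y a):])) 0 = L (v 0)" if "linfun s G L" for L
    unfolding Lv[OF that(1)] mixpf_def
    by (simp add: coeff_sum c_def of_int_poly algebra_simps)
  define \<kappa> where "\<kappa> = (mixpf m 0 omega (\<lambda>_ _. 0) :: 'k)"
  have \<kappa>: "\<kappa> \<noteq> 0" unfolding \<kappa>_def by (rule mixpf_omega_nonzero)
  have v0: "L (v 0) = \<kappa> * L x" if L: "linfun s G L" for L
  proof -
    have "L (v 0) = poly (mixpf m 1 B (\<lambda>_ a. [:L (y a):])) 0"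
      using c0[OF L] by (simp add: poly_0_coeff_0)
    also have "\<dots> = mixpf m 1 (\<lambda>a b. coform \<xi> (y a) (y b)) (\<lambda>_ a. L (y a))"
      by (simp add: ev \<xi>'_def)
    also have "\<dots> = L (y (2 * m)) * mixpf m 0 (\<lambda>a b. coform \<xi> (y a) (y b)) (\<lambda>_ _. 0)"
      by (rule mixpf_last) (use x0 x0' w xG in \<open>auto simp: y_def\<close>)
    also have "y (2 * m) = x" by (simp add: y_def)
    finally show ?thesis unfolding gram \<kappa>_def by (simp only: mult.commute)
  qed
  \<comment> \<open>Vectors are compared by their values under linear functionals, since the mixed
    Pfaffians only see the latter.\<close>
  have "v 0 = s \<kappa> x"
  proof (rule ccontr)
    assume "v 0 \<noteq> s \<kappa> x"
    then have "v 0 - s \<kappa> x \<notin> {0}" by simp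
    then obtain f where f: "linfun s UNIV f" "f (v 0 - s \<kappa> x) = 1"
      using separating_functional[of "{0}"] subspace_single_0 by blast
    have fG: "linfun s G f" using f(1) by (rule linfun_mono) simp
    have "f (v 0 - s \<kappa> x) = f (v 0) - f (s \<kappa> x)"
      by (rule linfun_minus[OF subspace_G fG vG subspace_scale[OF subspace_G xG]])
    also have "f (s \<kappa> x) = \<kappa> * f x" using f(1) by (simp add: linfun_def)
    finally show False using v0[OF fG] f(2) by simp
  qed
  \<comment> \<open>A functional that vanishes on the semi-radical vanishes on the stabilizers of
    all regular deformed functionals. The resulting polynomial in the parameter is zero wherever
    \<open>h\<close> is not, hence identically, and its linear coefficient is the value at
    \<open>v 1\<close>.\<close>
  have v1F: "v 1 \<in> FG"
  proof (rule ccontr)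
    assume "v 1 \<notin> FG"
    then obtain f where f: "linfun s UNIV f" "\<And>u. u \<in> FG \<Longrightarrow> f u = 0" "f (v 1) = 1"
      using separating_functional[OF subspace_semiradical] by blast
    have fG: "linfun s G f" using f(1) by (rule linfun_mono) simp
    let ?P = "mixpf m 1 B (\<lambda>_ a. [:f (y a), 0:])"
    have "poly (?P * h) e = 0" for e
    proof (cases "poly h e = 0")
      case False
      then have "poly ?P e = 0"
        using zero[OF fG] reg[OF False] f(2) by (simp add: ev stabilizer_eq_radical subset_iff)
      then show ?thesis by simp
    qed simp
    then have "?P * h = 0" by (simp add: poly_all_0_iff_0[symmetric])
    then have "?P = 0" using hnz by simp
    then have "f (v 1) + 0 = 0" using c1[OF fG, of "\<lambda>_. 0"] by (simp add: linfun_def)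
    then show False using f(3) by simp
  qed
  \<comment> \<open>The covector pairing with \<open>z\<close> depends on the parameter itself, so
    its linear coefficient involves both \<open>v 1\<close> and \<open>v 0\<close>.\<close>
  have "\<xi> (br (v 1) z) + \<eta> (br (v 0) z) = 0" if z: "z \<in> G" for z
  proof -
    have L: "linfun s G (\<lambda>u. \<xi> (br u z))" "linfun s G (\<lambda>u. \<eta> (br u z))"
      using alt[OF \<xi>(1)] alt[OF \<eta>] z by (simp_all add: altform_def)
    have L': "linfun s G (\<lambda>u. \<xi>' e (br u z))" for e
      using alt[OF \<xi>'] z by (simp add: altform_def)
    let ?P = "mixpf m 1 B (\<lambda>_ a. [:\<xi> (br (y a) z), \<eta> (br (y a) z):])"
    have "poly ?P e = 0" for e
      using zero[OF L', of e e] z by (simp add: ev radical_def \<xi>'_def)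
    then have "?P = 0" by (simp add: poly_all_0_iff_0[symmetric])
    then show ?thesis using c1[OF L] by simp
  qed
  \<comment> \<open>By the Jacobi identity the two sides differ by
    \<open>\<xi> (br (v 0) (br z X))\<close>, which is zero because \<open>v 0\<close> is a multiple
    of the stabilizing vector \<open>x\<close>.\<close>
  moreover have "\<eta> (br (v 0) z) = \<xi> (br (br X (v 0)) z)" if z: "z \<in> G" for z
  proof -
    have XG: "br X (v 0) \<in> G" "br X z \<in> G" "br (v 0) z \<in> G" "br z X \<in> G" using X vG z br_closed by auto
    have sk: "br a b = - br b a" if "a \<in> G" "b \<in> G" for a b
    proof -
      have "br (a + b) (a + b) = br a a + br a b + (br b a + br b b)"
        using that subspace_G by (simp add: br_add_left br_add_right subspace_add)
      then show ?thesis using that br_self subspace_add[OF subspace_G] by (simp add: eq_neg_iff_add_eq_0 add.commute)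
    qed
    have "br X (br (v 0) z) = - br (v 0) (br z X) - br z (br X (v 0))"
      using jacobi[OF X vG[of 0] z] by (simp add: eq_diff_eq eq_neg_iff_add_eq_0 add_ac)
    also have "\<dots> = br (br X (v 0)) z - br (v 0) (br z X)"
      using sk[OF z XG(1)] by simp
    finally have "\<eta> (br (v 0) z) = \<xi> (br (br X (v 0)) z) - \<xi> (br (v 0) (br z X))"
      using XG vG z br_closed by (simp add: \<eta>_def linfun_minus[OF subspace_G \<xi>(1)])
    moreover have "\<xi> (br (v 0) (br z X)) = 0"
      using \<open>v 0 = s \<kappa> x\<close> x0[OF XG(4)] xG XG(4) \<xi>(1) br_closed by (simp add: br_scale_left linfun_def)
    ultimately show ?thesis by simp
  qed
  ultimately have "v 1 + br X (v 0) \<in> stabilizer br G \<xi>"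
    using vG X br_closed \<xi>(1) subspace_G
    by (auto simp: stabilizer_def subspace_add br_add_left linfun_def)
  then have "v 1 + br X (v 0) \<in> FG" using stabilizer_subset_semiradical[OF \<xi>] by blast
  then have "(v 1 + br X (v 0)) - v 1 \<in> FG" using v1F subspace_diff[OF subspace_semiradical] by blast
  then have "s \<kappa> (br X x) \<in> FG" using \<open>v 0 = s \<kappa> x\<close> X xG by (simp add: br_scale_right)
  then have "s (1 / \<kappa>) (s \<kappa> (br X x)) \<in> FG" by (rule subspace_scale[OF subspace_semiradical])
  then show ?thesis using \<kappa> by simp
qed

lemma semiradical_ideal:
  assumes X: "X \<in> G" and x: "x \<in> FG"
  shows "br X x \<in> FG"
proof -
  let ?S = "{x \<in> G. br X x \<in> FG}"
  have "br X 0 = 0" using br_scale_right[of X 0 0] X subspace_0[OF subspace_G] by simp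
  then have "subspace ?S"
    using X subspace_G subspace_semiradical
    by (intro subspaceI) (auto simp: br_add_right br_scale_right subspace_add subspace_scale subspace_0)
  moreover have "(\<Union>\<xi>\<in>dual_reg s br G. stabilizer br G \<xi>) \<subseteq> ?S"
    using bracket_stabilizer_semiradical[OF _ _ _ X] by (auto simp: dual_reg_def dual_space_eq stabilizer_def)
  ultimately have "FG \<subseteq> ?S" unfolding frobenius_semiradical_def by (rule span_minimal[rotated])
  then show ?thesis using x by blast
qed

lemma lie_subalgebra_semiradical: "lie_subalgebra s br G FG"
  using subspace_semiradical semiradical_subset semiradical_ideal
  by (auto simp: lie_subalgebra_def)

end

section \<open>The fundamental semi-invariant\<close>

lemma mixpf_in_subring:
  assumes A: "subring_set A" and B: "\<And>a b. B a b \<in> A" and L: "\<And>i a. i < r \<Longrightarrow> L i a \<in> A"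
  shows "mixpf q r B L \<in> A"
proof -
  have prod: "prod f I \<in> A" if "\<And>i. i \<in> I \<Longrightarrow> f i \<in> A" for I :: "nat set" and f
    using that by (induction I rule: infinite_finite_induct) (auto intro: subring_setD[OF A])
  have nat: "of_nat k \<in> A" for k by (induction k) (auto intro: subring_setD[OF A])
  have int: "of_int k \<in> A" for k
  proof (cases k rule: int_cases2)
    case (nonpos n)
    then show ?thesis using subring_setD(4)[OF A subring_setD(1)[OF A] nat[of n]] by simp
  qed (simp add: nat)
  show ?thesis unfolding mixpf_def
    by (intro subring_set_sum A subring_setD(5)[OF A] prod int B L) auto
qed

lemma homogeneous_mixpf:
  assumes B: "\<And>a b. homogeneous 1 (B a b)" and L: "\<And>i a. i < r \<Longrightarrow> homogeneous (d i) (L i a)"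
  shows "homogeneous (q + (\<Sum>i<r. d i)) (mixpf q r B L)"
  unfolding mixpf_def
proof (intro homogeneous_sum)
  fix \<sigma>
  have "homogeneous (\<Sum>i<q. 1) (\<Prod>i<q. B (\<sigma> (2 * i)) (\<sigma> (2 * i + 1)))"
    by (intro homogeneous_prod B)
  moreover have "homogeneous (\<Sum>i<r. d i) (\<Prod>i<r. L i (\<sigma> (2 * q + i)))"
    by (intro homogeneous_prod L) simp
  ultimately have "homogeneous (0 + (q + (\<Sum>i<r. d i))) (of_int (sign \<sigma>) *
      ((\<Prod>i<q. B (\<sigma> (2 * i)) (\<sigma> (2 * i + 1))) * (\<Prod>i<r. L i (\<sigma> (2 * q + i)))))"
    unfolding of_int_mpol by (intro homogeneous_mult homogeneous_mconst) simp_all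
  then show "homogeneous (q + (\<Sum>i<r. d i)) (of_int (sign \<sigma>) *
      ((\<Prod>i<q. B (\<sigma> (2 * i)) (\<sigma> (2 * i + 1))) * (\<Prod>i<r. L i (\<sigma> (2 * q + i)))))" by simp
qed

locale lie_algebra_basis = lie_algebra_char_0 s br G
  for s :: "'k::field_char_0 \<Rightarrow> 'a::ab_group_add \<Rightarrow> 'a" and br G +
  fixes xs :: "'a list"
  assumes xs: "ordered_basis s G xs"
begin

lemma xs_basis: "distinct xs" "independent (set xs)" "span (set xs) = G"
  using xs by (auto simp: ordered_basis_def)

lemma xs_G: "i < length xs \<Longrightarrow> xs ! i \<in> G"
  using xs_basis(3) span_base by auto

lemma vs: "vector_space s" ..

definition coord :: "nat \<Rightarrow> 'a \<Rightarrow> 'k" where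
  "coord i x = representation (set xs) x (xs ! i)"

lemma linfun_coord: "linfun s G (coord i)"
  using xs_basis by (simp add: linfun_def coord_def representation_add representation_scale)

lemma coord_basis: "i < length xs \<Longrightarrow> j < length xs \<Longrightarrow> coord i (xs ! j) = (if i = j then 1 else 0)"
  using xs_basis by (simp add: coord_def representation_basis nth_eq_iff_index_eq)

lemma sum_coord:
  assumes "x \<in> G" shows "(\<Sum>i<length xs. s (coord i x) (xs ! i)) = x"
proof -
  have "x = (\<Sum>b\<in>set xs. s (representation (set xs) x b) b)"
    using sum_representation_eq[OF xs_basis(2), of x "set xs"] assms xs_basis(3) by simp
  also have "\<dots> = (\<Sum>i<length xs. s (coord i x) (xs ! i))"
    using bij_betw_nth[OF xs_basis(1) refl refl] unfolding coord_def
    by (intro sum.reindex_bij_betw[symmetric])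
  finally show ?thesis by simp
qed

lemma dual_system_coord: "dual_system s G {0} (length xs) ((!) xs) coord"
proof -
  have "x = 0" if "x \<in> G" "\<forall>i<length xs. coord i x = 0" for x
    using sum_coord[OF that(1)] that(2) by simp
  then have "{0} = {x\<in>G. \<forall>i<length xs. coord i x = 0}"
    using subspace_0[OF subspace_G] linfun_zero[OF subspace_G linfun_coord] by auto
  then show ?thesis unfolding dual_system_def
    by (intro conjI allI impI xs_G linfun_coord coord_basis)
qed

lemma lin_form_eq: "lin_form s xs x = (\<Sum>i<length xs. mconst (coord i x) * mvar i)"
  by (simp add: lin_form_def coord_def)

lemma lin_form_mpols_below: "lin_form s xs x \<in> mpols_below (length xs)"
  unfolding lin_form_eq
  by (intro subring_set_sum subring_mpols_below subring_setD(5)[OF subring_mpols_below] mconst_mpols_below mvar_mpols_below) simp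

lemma homogeneous_lin_form: "homogeneous 1 (lin_form s xs x)"
proof -
  have "homogeneous (0 + 1) (lin_form s xs x)"
    unfolding lin_form_eq by (intro homogeneous_sum homogeneous_mult homogeneous_mconst homogeneous_mvar)
  then show ?thesis by simp
qed

text \<open>The functional with values \<open>c i\<close> on the basis: evaluating a linear form at
  \<open>c\<close> is evaluating \<open>point c\<close> at the corresponding vector.\<close>

definition point :: "(nat \<Rightarrow> 'k) \<Rightarrow> 'a \<Rightarrow> 'k" where
  "point c x = (\<Sum>i<length xs. coord i x * c i)"

lemma eval_lin_form: "mpol_eval id c (lin_form s xs x) = point c x"
  by (simp add: lin_form_eq point_def ring_hom_fun_sum[OF eval_hom] ring_hom_funD[OF eval_hom]
      mpol_eval_mconst[OF ring_hom_fun_id] mpol_eval_mvar[OF ring_hom_fun_id])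

lemma linfun_point: "linfun s G (point c)"
  using linfun_coord by (simp add: linfun_def point_def distrib_right sum.distrib sum_distrib_left mult.assoc)

lemma point_coord:
  assumes \<xi>: "linfun s G \<xi>" and x: "x \<in> G"
  shows "point (\<lambda>i. \<xi> (xs ! i)) x = \<xi> x"
  using linfun_sum[OF subspace_G \<xi>, of "{..<length xs}" "(!) xs" "\<lambda>i. coord i x"] xs_G sum_coord[OF x]
  by (simp add: point_def)

lemma stabilizer_cong: "(\<And>x. x \<in> G \<Longrightarrow> \<xi> x = \<eta> x) \<Longrightarrow> lie_subalgebra s br G H \<Longrightarrow> stabilizer br H \<xi> = stabilizer br H \<eta>"
  using lie_subalgebraD(2,3)[of H] by (auto simp: stabilizer_def subset_iff)

lemma dim_index_even:
  assumes H: "lie_subalgebra s br G H"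
  obtains m where "dim H = lie_index s br H + 2 * m"
proof -
  obtain \<xi> where \<xi>: "linfun s H \<xi>" "dim (stabilizer br H \<xi>) = lie_index s br H"
    using lie_index_attained[OF H] .
  obtain m w where "dual_system s H (radical H (coform \<xi>)) (2 * m) w (darboux_coord (coform \<xi>) w)"
    using darboux_basis[OF lie_subalgebraD(1,4)[OF H] altform_coform[OF H \<xi>(1)]] by metis
  then show ?thesis
    using dim_dual_system[OF lie_subalgebraD(1,4)[OF H]] \<xi>(2) that[of m] by (simp add: stabilizer_eq_radical)
qed

text \<open>\<open>h\<close> is a multiple of the Pfaffian of the Gram matrix on a Darboux basis
  chosen for one functional of minimal stabilizer. It is nonzero at that functional, and wherever it
  is nonzero the rank on \<open>H\<close> is maximal.\<close>

lemma generic_regular: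
  assumes H: "lie_subalgebra s br G H"
  obtains h where "h \<in> mpols_below (length xs)" "h \<noteq> 0"
    "\<And>c. mpol_eval id c h \<noteq> 0 \<Longrightarrow> dim (stabilizer br H (point c)) = lie_index s br H"
proof -
  obtain \<xi> where \<xi>: "linfun s G \<xi>" "dim (stabilizer br H \<xi>) = lie_index s br H"
    using lie_index_attained_G[OF H] .
  have \<xi>H: "linfun s H \<xi>" using \<xi>(1) lie_subalgebraD(2)[OF H] by (rule linfun_mono)
  obtain m w where w: "\<And>a. a < 2 * m \<Longrightarrow> w a \<in> H"
    and om: "\<And>a b. a < 2 * m \<Longrightarrow> b < 2 * m \<Longrightarrow> coform \<xi> (w a) (w b) = omega a b"
    and ds: "dual_system s H (radical H (coform \<xi>)) (2 * m) w (darboux_coord (coform \<xi>) w)"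
    using darboux_basis[OF lie_subalgebraD(1,4)[OF H] altform_coform[OF H \<xi>H]] by metis
  have dH: "dim H = lie_index s br H + 2 * m"
    using dim_dual_system[OF lie_subalgebraD(1,4)[OF H] ds] \<xi>(2) by (simp add: stabilizer_eq_radical)
  define h where "h = mixpf m 0 (\<lambda>a b. lin_form s xs (br (w a) (w b))) (\<lambda>_ _. 0)"
  have ev: "mpol_eval id c h = mixpf m 0 (\<lambda>a b. coform (point c) (w a) (w b)) (\<lambda>_ _. 0)" for c
    unfolding h_def mixpf_hom[OF eval_hom] eval_lin_form mpol_eval_zero ..
  have "mpol_eval id (\<lambda>i. \<xi> (xs ! i)) h = mixpf m 0 omega (\<lambda>_ _. 0)"
    unfolding ev
  proof (rule mixpf_cong)
    fix a b assume ab: "a < 2 * m + 0" "b < 2 * m + 0"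
    then have "br (w a) (w b) \<in> G" using w lie_subalgebraD(2,3)[OF H] by auto
    then show "point (\<lambda>i. \<xi> (xs ! i)) (br (w a) (w b)) = omega a b"
      using om ab by (simp add: point_coord[OF \<xi>(1)])
  qed simp
  then have "h \<noteq> 0" using mixpf_omega_nonzero[of m "\<lambda>_ _. 0 :: 'k"] mpol_eval_zero[of id] by metis
  moreover have "h \<in> mpols_below (length xs)"
    unfolding h_def by (intro mixpf_in_subring subring_mpols_below lin_form_mpols_below) simp
  moreover have "dim (stabilizer br H (point c)) = lie_index s br H" if nz: "mpol_eval id c h \<noteq> 0" for c
  proof -
    have pH: "linfun s H (point c)" using linfun_point lie_subalgebraD(2)[OF H] by (rule linfun_mono)
    have "\<not> dim H < dim (radical H (coform (point c))) + (2 * m + 0)"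
    proof
      assume "dim H < dim (radical H (coform (point c))) + (2 * m + 0)"
      then have "mixpf m 0 (\<lambda>a b. coform (point c) (w a) (w b)) (\<lambda>i a. 0) = 0"
        by (intro mixpf_form_zero[OF vs lie_subalgebraD(1,4)[OF H] altform_coform[OF H pH]]) (use w in auto)
      then show False using nz by (simp add: ev)
    qed
    then show ?thesis using lie_index_le[OF H pH] dH unfolding stabilizer_eq_radical by linarith
  qed
  ultimately show ?thesis using that by blast
qed

definition minor_vec :: "nat set \<Rightarrow> nat \<Rightarrow> 'a" where
  "minor_vec J a = xs ! (sorted_list_of_set J ! a)"

text \<open>The Pfaffian of the principal minor without its normalization
  \<open>1 / (2 ^ m * fact m)\<close>, a unit that does not affect divisibility.\<close>

definition pf_poly :: "nat \<Rightarrow> nat set \<Rightarrow> 'k mpol" where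
  "pf_poly m J = mixpf m 0 (\<lambda>a b. lin_form s xs (br (minor_vec J a) (minor_vec J b))) (\<lambda>_ _. 0)"

lemma minor_vec_G:
  assumes "J \<subseteq> {..<length xs}" "a < card J" shows "minor_vec J a \<in> G"
proof -
  have "sorted_list_of_set J ! a \<in> J"
    using assms finite_subset[OF assms(1)] nth_mem[of a "sorted_list_of_set J"] by simp
  then show ?thesis using assms(1) xs_G by (auto simp: minor_vec_def)
qed

lemma pf_poly_mpols_below: "pf_poly m J \<in> mpols_below (length xs)"
  unfolding pf_poly_def by (intro mixpf_in_subring subring_mpols_below lin_form_mpols_below) simp

lemma eval_pf_poly: "mpol_eval id c (pf_poly m J) =
    mixpf m 0 (\<lambda>a b. coform (point c) (minor_vec J a) (minor_vec J b)) (\<lambda>_ _. 0)"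
  unfolding pf_poly_def mixpf_hom[OF eval_hom] eval_lin_form mpol_eval_zero ..

lemma homogeneous_pf_poly: "homogeneous m (pf_poly m J)"
proof -
  have "homogeneous (m + (\<Sum>i<(0::nat). 0)) (pf_poly m J)"
    unfolding pf_poly_def by (intro homogeneous_mixpf homogeneous_lin_form) simp
  then show ?thesis by simp
qed

lemma principal_pfaffians_eq:
  assumes m: "dim G = lie_index s br G + 2 * m"
  shows "principal_pfaffians s br G xs =
    (\<lambda>J. mconst (1 / (2 ^ m * fact m)) * pf_poly m J) ` {J. J \<subseteq> {..<length xs} \<and> card J = 2 * m}"
proof -
  have "pfaffian m (\<lambda>a b. structure_matrix s br xs (sorted_list_of_set J ! a) (sorted_list_of_set J ! b)) =
      mconst (1 / (2 ^ m * fact m)) * pf_poly m J" for J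
    by (simp add: pfaffian_def pf_poly_def mixpf_def structure_matrix_def minor_vec_def)
  then show ?thesis
    using m by (simp add: principal_pfaffians_def Let_def)
qed

lemma pf_poly_dvd_iff:
  assumes m: "dim G = lie_index s br G + 2 * m"
  shows "(\<forall>f\<in>principal_pfaffians s br G xs. q dvd f) \<longleftrightarrow>
    (\<forall>J. J \<subseteq> {..<length xs} \<and> card J = 2 * m \<longrightarrow> q dvd pf_poly m J)"
proof -
  have u: "mconst (2 ^ m * fact m) * mconst (1 / (2 ^ m * fact m)) = (1 :: 'k mpol)"
    by (simp add: ring_hom_funD[OF ring_hom_fun_mconst, symmetric])
  have "q dvd mconst (1 / (2 ^ m * fact m)) * f \<longleftrightarrow> q dvd f" for f :: "'k mpol"
  proof
    assume "q dvd mconst (1 / (2 ^ m * fact m)) * f"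
    then have "q dvd mconst (2 ^ m * fact m) * (mconst (1 / (2 ^ m * fact m)) * f)" by (rule dvd_mult)
    then show "q dvd f" using u by (simp add: mult.assoc[symmetric])
  qed (rule dvd_mult)
  then show ?thesis unfolding principal_pfaffians_eq[OF m] by auto
qed

text \<open>At a regular point the Pfaffian on a Darboux basis is nonzero, and its expansion in the
  given basis exhibits a nonzero principal Pfaffian. Conversely a nonzero one bounds the rank from
  below by \<open>2 * m\<close>.\<close>

lemma regular_iff_pf_poly:
  assumes m: "dim G = lie_index s br G + 2 * m"
  shows "dim (stabilizer br G (point c)) = lie_index s br G \<longleftrightarrow>
    (\<exists>J. J \<subseteq> {..<length xs} \<and> card J = 2 * m \<and> mpol_eval id c (pf_poly m J) \<noteq> 0)"
proof
  note alt = altform_coform[OF lie_subalgebra_G linfun_point]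
  assume reg: "dim (stabilizer br G (point c)) = lie_index s br G"
  obtain m' w where w: "\<And>a. a < 2 * m' \<Longrightarrow> w a \<in> G"
    and om: "\<And>a b. a < 2 * m' \<Longrightarrow> b < 2 * m' \<Longrightarrow> coform (point c) (w a) (w b) = omega a b"
    and ds: "dual_system s G (radical G (coform (point c))) (2 * m') w (darboux_coord (coform (point c)) w)"
    using darboux_basis[OF subspace_G fin_dim_G alt[of c]] by metis
  have [simp]: "m' = m"
    using dim_dual_system[OF subspace_G fin_dim_G ds] reg m by (simp add: stabilizer_eq_radical)
  have bl: "\<And>v. v \<in> G \<Longrightarrow> linfun s G (coform (point c) v)" "\<And>v. v \<in> G \<Longrightarrow> linfun s G (\<lambda>u. coform (point c) u v)"
    using alt[of c] by (auto simp: altform_def)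
  have rad: "coform (point c) u v = 0" "coform (point c) v u = 0" if "u \<in> {0}" "v \<in> G" for u v
    using that linfun_zero[OF subspace_G bl(1)] linfun_zero[OF subspace_G bl(2)] by auto
  have "mixpf m 0 (\<lambda>a b. coform (point c) (w a) (w b)) (\<lambda>_ _. 0) = mixpf m 0 omega (\<lambda>_ _. 0)"
    using om by (intro mixpf_cong) auto
  then have nz: "mixpf m 0 (\<lambda>a b. coform (point c) (w a) (w b)) (\<lambda>_ _. 0) \<noteq> 0"
    by (simp add: mixpf_omega_nonzero)
  have ex: "coform (point c) (w j) (w k) = (\<Sum>a<length xs. \<Sum>b<length xs. coord a (w j) * coord b (w k) * coform (point c) (xs ! a) (xs ! b))"
    if "j < 2 * m" "k < 2 * m" for j k
    by (rule dual_system_expand2[OF subspace_G dual_system_coord]) (use that w bl rad in auto)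
  obtain J where "J \<subseteq> {..<length xs}" "card J = 2 * m"
    "mixpf m 0 (\<lambda>j k. coform (point c) (xs ! (sorted_list_of_set J ! j)) (xs ! (sorted_list_of_set J ! k))) (\<lambda>i j. 0) \<noteq> 0"
    by (rule mixpf_minor_nonzero[where q=m and r=0 and N="2 * m" and n="length xs" and L="\<lambda>_ _. 0" and ?L0.0="\<lambda>_ _. 0"
          and c="\<lambda>j a. coord a (w j)" and ?B0.0="\<lambda>a b. coform (point c) (xs ! a) (xs ! b)", OF _ ex _ nz]) auto
  then show "\<exists>J. J \<subseteq> {..<length xs} \<and> card J = 2 * m \<and> mpol_eval id c (pf_poly m J) \<noteq> 0"
    by (auto simp: eval_pf_poly minor_vec_def)
next
  assume "\<exists>J. J \<subseteq> {..<length xs} \<and> card J = 2 * m \<and> mpol_eval id c (pf_poly m J) \<noteq> 0"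
  then obtain J where J: "J \<subseteq> {..<length xs}" "card J = 2 * m" "mpol_eval id c (pf_poly m J) \<noteq> 0" by blast
  have "\<not> dim G < dim (radical G (coform (point c))) + (2 * m + 0)"
  proof
    assume "dim G < dim (radical G (coform (point c))) + (2 * m + 0)"
    then have "mixpf m 0 (\<lambda>a b. coform (point c) (minor_vec J a) (minor_vec J b)) (\<lambda>i a. 0) = 0"
      by (intro mixpf_form_zero[OF vs subspace_G fin_dim_G altform_coform[OF lie_subalgebra_G linfun_point]])
         (use minor_vec_G[OF J(1)] J(2) in auto)
    then show False using J(3) by (simp add: eval_pf_poly)
  qed
  then show "dim (stabilizer br G (point c)) = lie_index s br G"
    using lie_index_le[OF lie_subalgebra_G linfun_point[of c]] m unfolding stabilizer_eq_radical by linarith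
qed

lemma pf_poly_nonzero:
  assumes m: "dim G = lie_index s br G + 2 * m"
  obtains J where "J \<subseteq> {..<length xs}" "card J = 2 * m" "pf_poly m J \<noteq> 0"
proof -
  obtain h where h: "h \<in> mpols_below (length xs)" "h \<noteq> 0"
    "\<And>c. mpol_eval id c h \<noteq> 0 \<Longrightarrow> dim (stabilizer br G (point c)) = lie_index s br G"
    using generic_regular[OF lie_subalgebra_G] by blast
  obtain c where "mpol_eval id c h \<noteq> 0" using mpols_below_eq_0 h(1,2) by blast
  then obtain J where "J \<subseteq> {..<length xs}" "card J = 2 * m" "mpol_eval id c (pf_poly m J) \<noteq> 0"
    using h(3) regular_iff_pf_poly[OF m] by blast
  then show ?thesis using that mpol_eval_zero by metis
qed

end

context lie_algebra_basis begin

text \<open>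
  The Pfaffians of the \<open>2m\<close>-minors are the coordinates of \<open>\<omega>\<^sup>m\<close>, where \<open>\<omega> = \<xi>([\<cdot>,\<cdot>])\<close>. They are compared with
  the coordinates of \<open>\<omega>\<^sup>m\<^sup>F \<and> \<xi>([X\<^sub>1,\<cdot>]) \<and> \<dots> \<and> \<xi>([X\<^sub>l,\<cdot>]) \<and> \<zeta>\<^sub>1 \<and> \<dots> \<and> \<zeta>\<^sub>l\<^sub>'\<close>, which have degree \<open>mF + l\<close>. Here
  \<open>\<zeta>\<^sub>1, \<dots>, \<zeta>\<^sub>l\<^sub>'\<close> are linear forms with common kernel \<open>F(G)\<close>, and the \<open>X\<^sub>j\<close> cut out \<open>G(\<xi>)\<close> in
  the stabilizer of the restriction of \<open>\<xi>\<close> to \<open>F(G)\<close>. Both multivectors have kernel \<open>G(\<xi>)\<close> for a regular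
  \<open>\<xi>\<close>, hence they are proportional.
\<close>

lemma common_divisor_of_pfaffians:
  assumes m: "dim G = lie_index s br G + 2 * m"
  obtains q where "q \<in> mpols_below (length xs)"
    "\<And>J. J \<subseteq> {..<length xs} \<Longrightarrow> card J = 2 * m \<Longrightarrow> q dvd pf_poly m J"
    "lie_c s br G - lie_c s br FG \<le> real (total_degree q)"
proof -
  let ?n = "length xs"
  note F = lie_subalgebra_semiradical
  note FD = lie_subalgebraD[OF F]
  obtain mF where mF: "dim FG = lie_index s br FG + 2 * mF" using dim_index_even[OF F] .
  obtain hG where hG: "hG \<in> mpols_below ?n" "hG \<noteq> 0"
    "\<And>c. mpol_eval id c hG \<noteq> 0 \<Longrightarrow> dim (stabilizer br G (point c)) = lie_index s br G"
    using generic_regular[OF lie_subalgebra_G] by blast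
  obtain hF where hF: "hF \<in> mpols_below ?n" "hF \<noteq> 0"
    "\<And>c. mpol_eval id c hF \<noteq> 0 \<Longrightarrow> dim (stabilizer br FG (point c)) = lie_index s br FG"
    using generic_regular[OF F] by blast
  have "hG * hF \<noteq> 0" "hG * hF \<in> mpols_below ?n"
    using hG hF subring_setD(5)[OF subring_mpols_below] by auto
  \<comment> \<open>A point in general position for \<open>G\<close> and for its semi-radical
    simultaneously. All auxiliary vectors are chosen there.\<close>
  then obtain c0 where "mpol_eval id c0 (hG * hF) \<noteq> 0" using mpols_below_eq_0 by blast
  then have c0: "mpol_eval id c0 hG \<noteq> 0" "mpol_eval id c0 hF \<noteq> 0"
    by (auto simp: ring_hom_funD[OF eval_hom])
  define \<xi> where "\<xi> = point c0"
  have \<xi>: "linfun s G \<xi>" unfolding \<xi>_def by (rule linfun_point)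
  have \<xi>F: "linfun s FG \<xi>" using \<xi> FD(2) by (rule linfun_mono)
  note altG = altform_coform[OF lie_subalgebra_G \<xi>] and altF = altform_coform[OF F \<xi>F]
  have blG: "\<And>v. v \<in> G \<Longrightarrow> linfun s G (coform \<xi> v)" "\<And>v. v \<in> G \<Longrightarrow> linfun s G (\<lambda>u. coform \<xi> u v)"
    using altG by (auto simp: altform_def)
  have dU: "dim (stabilizer br G \<xi>) = lie_index s br G" and dV: "dim (stabilizer br FG \<xi>) = lie_index s br FG"
    using hG(3)[OF c0(1)] hF(3)[OF c0(2)] by (simp_all add: \<xi>_def)
  define U where "U = stabilizer br G \<xi>"
  define V where "V = stabilizer br FG \<xi>"
  have UF: "U \<subseteq> FG" unfolding U_def by (rule stabilizer_subset_semiradical[OF \<xi> dU])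
  have VF: "V \<subseteq> FG" "V \<subseteq> G" using FD(2) by (auto simp: V_def stabilizer_def)
  have V: "subspace V" "fin_dim s V"
    using stabilizer_subspace[OF F \<xi>F] fin_dim_subset[OF fin_dim_G VF(2)] by (auto simp: V_def)
  have anti: "coform \<xi> y x = - coform \<xi> x y" if "x \<in> G" "y \<in> G" for x y
    using altform_antisym[OF subspace_G altG that] .

  obtain q' f where f: "\<And>a. a < 2 * q' \<Longrightarrow> f a \<in> FG"
    and om: "\<And>a b. a < 2 * q' \<Longrightarrow> b < 2 * q' \<Longrightarrow> coform \<xi> (f a) (f b) = omega a b"
    and dsf: "dual_system s FG (radical FG (coform \<xi>)) (2 * q') f (darboux_coord (coform \<xi>) f)"
    using darboux_basis[OF FD(1,4) altF] by metis
  have q': "q' = mF"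
    using dim_dual_system[OF FD(1,4) dsf] mF dV by (simp add: stabilizer_eq_radical)
  have fG: "f a \<in> G" if "a < 2 * mF" for a using f[of a] that FD(2) q' by auto
  have om: "coform \<xi> (f a) (f b) = omega a b" if "a < 2 * mF" "b < 2 * mF" for a b using om that q' by simp

  \<comment> \<open>The orthogonal complement of the Darboux system of the semi-radical. With the
    \<open>X j\<close> taken from it, their covectors vanish on all \<open>f a\<close>, as the block
    form below requires.\<close>
  define G' where "G' = {X \<in> G. \<forall>a<2*mF. coform \<xi> X (f a) = 0}"
  define \<Lambda> where "\<Lambda> = coform \<xi> ` G'"
  have \<Lambda>1: "linfun s V g" if "g \<in> \<Lambda>" for g
    using that blG(1) linfun_mono[OF _ VF(2)] by (auto simp: \<Lambda>_def G'_def)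
  have \<Lambda>2: "\<exists>h\<in>\<Lambda>. \<forall>x\<in>V. h x = c * g x + d * g' x" if gg: "g \<in> \<Lambda>" "g' \<in> \<Lambda>" for g g' c d
  proof -
    obtain X Y where XY: "X \<in> G'" "Y \<in> G'" "g = coform \<xi> X" "g' = coform \<xi> Y" using gg by (auto simp: \<Lambda>_def)
    have XYG: "X \<in> G" "Y \<in> G" using XY(1,2) by (simp_all add: G'_def)
    have lin: "coform \<xi> (s c X + s d Y) x = c * coform \<xi> X x + d * coform \<xi> Y x" if "x \<in> G" for x
      using blG(2)[OF that] XYG subspace_scale[OF subspace_G] by (simp add: linfun_def)
    have "s c X + s d Y \<in> G'"
      using XY(1,2) XYG lin[OF fG] subspace_G by (simp add: G'_def subspace_add subspace_scale)
    moreover have "\<forall>x\<in>V. coform \<xi> (s c X + s d Y) x = c * g x + d * g' x"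
      using lin VF(2) unfolding XY(3,4) by blast
    ultimately show ?thesis
      unfolding \<Lambda>_def by (intro bexI[of _ "coform \<xi> (s c X + s d Y)"] imageI)
  qed
  \<comment> \<open>Every element of \<open>G\<close> differs from an element of \<open>G'\<close>
    by a combination of the \<open>f a\<close>, and these pair to zero with \<open>V\<close>. So
    \<open>G'\<close> suffices to cut out \<open>U\<close> inside \<open>V\<close>.\<close>
  have kerU: "{x\<in>V. \<forall>g\<in>\<Lambda>. g x = 0} = U"
  proof
    show "U \<subseteq> {x\<in>V. \<forall>g\<in>\<Lambda>. g x = 0}"
    proof
      fix x assume x: "x \<in> U"
      then have xG: "x \<in> G" and x0: "\<And>z. z \<in> G \<Longrightarrow> coform \<xi> x z = 0" by (auto simp: U_def stabilizer_def)
      have "coform \<xi> X x = 0" if "X \<in> G" for X using anti[OF xG that] x0[OF that] by simp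
      then show "x \<in> {x\<in>V. \<forall>g\<in>\<Lambda>. g x = 0}"
        using x UF x0 FD(2) by (auto simp: V_def stabilizer_def \<Lambda>_def G'_def subset_iff)
    qed
    show "{x\<in>V. \<forall>g\<in>\<Lambda>. g x = 0} \<subseteq> U"
    proof
      fix x assume "x \<in> {x\<in>V. \<forall>g\<in>\<Lambda>. g x = 0}"
      then have xV: "x \<in> V" and x\<Lambda>: "\<forall>g\<in>\<Lambda>. g x = 0" by simp_all
      have x0: "coform \<xi> X x = 0" if "X \<in> G'" for X
        by (rule bspec[OF x\<Lambda>]) (use that in \<open>simp add: \<Lambda>_def\<close>)
      have xG: "x \<in> G" using xV VF by auto
      have "coform \<xi> x X = 0" if X: "X \<in> G" for X
      proof -
        let ?c = "darboux_coord (coform \<xi>) f"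
        let ?S = "\<Sum>a<2*mF. s (?c a X) (f a)"
        have ds: "dual_system s G {x\<in>G. \<forall>a<2*mF. ?c a x = 0} (2 * mF) f ?c"
          by (rule darboux_dual_system[OF altG fG om])
        have "X - ?S \<in> {x\<in>G. \<forall>a<2*mF. ?c a x = 0}"
          by (rule dual_system_remainder[OF subspace_G ds X])
        then have R: "X - ?S \<in> G" "\<And>a. a < 2 * mF \<Longrightarrow> ?c a (X - ?S) = 0" by auto
        have "X - ?S \<in> G'"
          unfolding G'_def using R(1) darboux_coord_perp[OF R(2)] by blast
        then have e0: "coform \<xi> (X - ?S) x = 0" by (rule x0)
        have SG: "?S \<in> G" using fG by (intro subspace_sum subspace_scale subspace_G) simp
        have "coform \<xi> ?S x = (\<Sum>a<2*mF. ?c a X * coform \<xi> (f a) x)"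
          using fG by (intro linfun_sum[OF subspace_G blG(2)[OF xG]]) simp
        also have "\<dots> = 0"
        proof (intro sum.neutral ballI)
          fix a assume "a \<in> {..<2*mF}"
          then have a: "a < 2 * mF" by simp
          have "coform \<xi> x (f a) = 0" using xV f[of a] a q' by (simp add: V_def stabilizer_def)
          then show "?c a X * coform \<xi> (f a) x = 0" using anti[OF xG fG[OF a]] by simp
        qed
        finally have "coform \<xi> X x = 0"
          using e0 linfun_minus[OF subspace_G blG(2)[OF xG] X SG] by simp
        then show ?thesis using anti[OF X xG] by simp
      qed
      then show "x \<in> U" using xG by (simp add: U_def stabilizer_def)
    qed
  qed
  obtain l z \<theta> where dsz0: "dual_system s V {x\<in>V. \<forall>g\<in>\<Lambda>. g x = 0} l z \<theta>" and \<theta>: "\<And>j. j < l \<Longrightarrow> \<theta> j \<in> \<Lambda>"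
  proof (rule dual_system_of_functionals[OF V \<Lambda>1 \<Lambda>2])
    fix l y \<zeta>
    assume "dual_system s V {x\<in>V. \<forall>g\<in>\<Lambda>. g x = 0} l y \<zeta>" "\<And>j. j < l \<Longrightarrow> \<zeta> j \<in> \<Lambda>"
    then show ?thesis by (rule that)
  qed
  note dsz = dsz0[unfolded kerU]
  have "\<forall>j. \<exists>X. j < l \<longrightarrow> X \<in> G' \<and> \<theta> j = coform \<xi> X"
    using \<theta> unfolding \<Lambda>_def image_iff by blast
  then obtain X where X: "\<And>j. j < l \<Longrightarrow> X j \<in> G'" "\<And>j. j < l \<Longrightarrow> \<theta> j = coform \<xi> (X j)" by metis
  have XG: "X j \<in> G" if "j < l" for j using X(1)[OF that] by (simp add: G'_def)
  have zV: "z j \<in> V" if "j < l" for j using dual_systemD(1)[OF dsz that] .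
  have Xz: "coform \<xi> (X j) (z k) = (if j = k then 1 else 0)" if "j < l" "k < l" for j k
    using dual_systemD(3)[OF dsz that] X(2)[OF that(1)] by simp
  have Xf: "coform \<xi> (X j) (f a) = 0" if "j < l" "a < 2 * mF" for j a
    using X(1)[OF that(1)] that(2) by (simp add: G'_def)
  have dl: "lie_index s br FG = lie_index s br G + l"
    using dim_dual_system[OF V dsz] dU dV by (simp add: U_def V_def)
  obtain l' y \<zeta> where dsy: "dual_system s G FG l' y \<zeta>"
    using dual_system_exists[OF subspace_G fin_dim_G FD(1,2)] .
  note yG = dual_systemD(1)[OF dsy] and l\<zeta> = dual_systemD(2)[OF dsy] and \<zeta>y = dual_systemD(3)[OF dsy]
  have \<zeta>F: "\<zeta> j x = 0" if "j < l'" "x \<in> FG" for j x using dual_systemD(4)[OF dsy] that by blast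
  have dl': "dim G = dim FG + l'" by (rule dim_dual_system[OF subspace_G fin_dim_G dsy])
  have N: "2 * m = 2 * mF + (l + l')" using m mF dl dl' by simp
  \<comment> \<open>A correction that makes the covectors of the \<open>X j\<close> vanish. The
    \<open>z j\<close> lie in the semi-radical, so the values of the \<zeta>'s are not
    changed.\<close>
  define y' where "y' k = y k - (\<Sum>j<l. s (coform \<xi> (X j) (y k)) (z j))" for k
  have SV: "(\<Sum>j<l. s (coform \<xi> (X j) (y k)) (z j)) \<in> V" for k
    using zV by (intro subspace_sum subspace_scale V(1)) simp
  have y'G: "y' k \<in> G" if "k < l'" for k
    using yG[OF that] SV VF(2) subspace_diff[OF subspace_G] by (auto simp: y'_def)
  have Xy': "coform \<xi> (X i) (y' k) = 0" if ik: "i < l" "k < l'" for i k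
  proof -
    have "coform \<xi> (X i) (\<Sum>j<l. s (coform \<xi> (X j) (y k)) (z j)) = (\<Sum>j<l. coform \<xi> (X j) (y k) * coform \<xi> (X i) (z j))"
      using zV VF(2) by (intro linfun_sum[OF subspace_G blG(1)[OF XG[OF ik(1)]]]) auto
    also have "\<dots> = (\<Sum>j<l. if j = i then coform \<xi> (X j) (y k) else 0)"
      using ik by (intro sum.cong) (simp_all add: Xz)
    also have "\<dots> = coform \<xi> (X i) (y k)" using ik by simp
    finally show ?thesis
      using linfun_minus[OF subspace_G blG(1)[OF XG[OF ik(1)]] yG[OF ik(2)] subsetD[OF VF(2) SV]]
      by (simp add: y'_def)
  qed
  have \<zeta>y': "\<zeta> i (y' k) = (if i = k then 1 else 0)" if ik: "i < l'" "k < l'" for i k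
    using linfun_minus[OF subspace_G l\<zeta>[OF ik(1)] yG[OF ik(2)] subsetD[OF VF(2) SV]]
      \<zeta>F[OF ik(1) subsetD[OF VF(1) SV]] \<zeta>y[OF ik] by (simp add: y'_def)

  \<comment> \<open>A tuple on which the comparison form is in block form: a Darboux basis, then
    vectors dual to the covectors of the \<open>X j\<close>, then vectors dual to the
    \<zeta>'s.\<close>
  define wv where "wv j = (if j < 2 * mF then f j else if j < 2 * mF + l then z (j - 2 * mF) else y' (j - 2 * mF - l))" for j
  have wvG: "wv j \<in> G" if "j < 2 * m" for j
    using that fG zV VF(2) y'G N by (auto simp: wv_def)
  \<comment> \<open>The first \<open>l\<close> covectors depend linearly on the functional and
    contribute degree 1 each; the remaining \<open>l'\<close> are constant.\<close>
  define Lp where "Lp i x = (if i < l then lin_form s xs (br (X i) x) else mconst (\<zeta> (i - l) x))" for i x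
  define Le where "Le c i x = (if i < l then coform (point c) (X i) x else \<zeta> (i - l) x)" for c i x
  have evL: "mpol_eval id c (Lp i x) = Le c i x" for c i x
    by (simp add: Lp_def Le_def eval_lin_form mpol_eval_mconst[OF ring_hom_fun_id])
  define bp where "bp J = mixpf mF (l + l') (\<lambda>a b. lin_form s xs (br (minor_vec J a) (minor_vec J b)))
      (\<lambda>i a. Lp i (minor_vec J a))" for J
  have evb: "mpol_eval id c (bp J) = mixpf mF (l + l') (\<lambda>a b. coform (point c) (minor_vec J a) (minor_vec J b))
      (\<lambda>i a. Le c i (minor_vec J a))" for c J
    unfolding bp_def mixpf_hom[OF eval_hom] eval_lin_form evL ..
  have linLe: "linfun s G (Le c i)" if "i < l + l'" for c i
    using altform_coform[OF lie_subalgebra_G linfun_point[of c]] XG l\<zeta>[of "i - l"] that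
    by (cases "i < l") (simp_all add: Le_def[abs_def] altform_def)
  have bpR: "bp J \<in> mpols_below ?n" for J
    unfolding bp_def Lp_def
    by (intro mixpf_in_subring subring_mpols_below lin_form_mpols_below) (simp add: lin_form_mpols_below mconst_mpols_below)
  have "homogeneous (mF + (\<Sum>i<l+l'. if i < l then 1 else 0)) (bp J)" for J
    unfolding bp_def Lp_def
    by (intro homogeneous_mixpf homogeneous_lin_form) (simp add: homogeneous_lin_form[unfolded One_nat_def] homogeneous_mconst)
  moreover have "(\<Sum>i<l+l'. if i < l then 1 else 0) = l"
  proof -
    have "{..<l+l'} \<inter> {i. i < l} = {..<l}" by auto
    then show ?thesis by (simp add: sum.If_cases)
  qed
  ultimately have hb: "homogeneous (mF + l) (bp J)" for J by metis

  \<comment> \<open>Checked point by point. At a regular point the covectors vanish on the radical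
    and the two forms are proportional; at a singular point both Pfaffians are zero.\<close>
  have rank: "pf_poly m J * bp K = pf_poly m K * bp J"
    if JK: "J \<subseteq> {..<?n}" "card J = 2 * m" "K \<subseteq> {..<?n}" "card K = 2 * m" for J K
  proof -
    have "pf_poly m J * bp K - pf_poly m K * bp J = 0"
    proof (rule mpols_below_eq_0)
      show "pf_poly m J * bp K - pf_poly m K * bp J \<in> mpols_below ?n"
        by (intro subring_setD(4,5)[OF subring_mpols_below] pf_poly_mpols_below bpR)
      fix c
      have "mpol_eval id c (pf_poly m J) * mpol_eval id c (bp K) = mpol_eval id c (pf_poly m K) * mpol_eval id c (bp J)"
      proof (cases "dim (stabilizer br G (point c)) = lie_index s br G")
        case True
        note alt = altform_coform[OF lie_subalgebra_G linfun_point[of c]]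
        have 0: "Le c i u = 0" if i: "i < l + l'" and u: "u \<in> radical G (coform (point c))" for i u
        proof (cases "i < l")
          case True
          have uG: "u \<in> G" using u by (simp add: radical_def)
          have "coform (point c) u (X i) = 0" using u XG[OF True] by (simp add: radical_def)
          then show ?thesis
            using True altform_antisym[OF subspace_G alt uG XG[OF True]] by (simp add: Le_def)
        next
          case False
          have "u \<in> FG"
            using stabilizer_subset_semiradical[OF linfun_point \<open>dim (stabilizer br G (point c)) = lie_index s br G\<close>] u
            by (auto simp: stabilizer_eq_radical)
          then show ?thesis using False i \<zeta>F[of "i - l" u] by (simp add: Le_def)
        qed
        have "dim G = dim (radical G (coform (point c))) + 2 * m"
          using True m by (simp add: stabilizer_eq_radical)
        then show ?thesis
          unfolding eval_pf_poly evb
          by (intro mixpf_form_proportional[OF vs subspace_G fin_dim_G alt, where N="2 * m" and L="\<lambda>_ _. 0"])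
             (use N JK minor_vec_G linLe 0 in \<open>auto simp: linfun_def[of s G "\<lambda>_. 0"]\<close>)
      next
        case False
        then have "mpol_eval id c (pf_poly m J) = 0" "mpol_eval id c (pf_poly m K) = 0"
          using regular_iff_pf_poly[OF m] JK by blast+
        then show ?thesis by simp
      qed
      then show "mpol_eval id c (pf_poly m J * bp K - pf_poly m K * bp J) = 0"
        by (simp add: ring_hom_fun_diff[OF eval_hom] ring_hom_funD[OF eval_hom])
    qed
    then show ?thesis by simp
  qed

  have nzw: "mixpf mF (l + l') (\<lambda>a b. coform \<xi> (wv a) (wv b)) (\<lambda>i a. Le c0 i (wv a)) \<noteq> 0"
  proof -
    have "mixpf mF (l + l') (\<lambda>a b. coform \<xi> (wv a) (wv b)) (\<lambda>i a. Le c0 i (wv a)) =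
        mixpf mF 0 (\<lambda>a b. coform \<xi> (wv a) (wv b)) (\<lambda>_ _. 0)"
    proof (rule mixpf_block)
      fix i j assume i: "i < l + l'" and j: "j < 2 * mF + (l + l')"
      have "j < 2 * mF \<or> (\<exists>k<l. j = 2 * mF + k) \<or> (\<exists>k<l'. j = 2 * mF + (l + k))"
        using j by (metis add_diff_inverse_nat nat_add_left_cancel_less)
      then consider "j < 2 * mF" | k where "k < l" "j = 2 * mF + k" | k where "k < l'" "j = 2 * mF + (l + k)"
        by blast
      then show "Le c0 i (wv j) = (if j = 2 * mF + i then 1 else 0)"
      proof cases
        case 1
        then show ?thesis
          using i Xf \<zeta>F[of "i - l" "f j"] f[of j] q' by (auto simp: wv_def Le_def \<xi>_def[symmetric])
      next
        case 2
        then show ?thesis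
          using i Xz[of i k] \<zeta>F[of "i - l" "z k"] zV[of k] VF(1) by (auto simp: wv_def Le_def \<xi>_def[symmetric])
      next
        case 3
        then show ?thesis
          using i Xy'[of i k] \<zeta>y'[of "i - l" k] by (auto simp: wv_def Le_def \<xi>_def[symmetric])
      qed
    qed
    also have "\<dots> = mixpf mF 0 omega (\<lambda>_ _. 0)"
      by (intro mixpf_cong) (auto simp: wv_def om)
    finally show ?thesis by (simp add: mixpf_omega_nonzero)
  qed
  have rad0: "coform \<xi> u v = 0" "coform \<xi> v u = 0" if "u \<in> {0}" "v \<in> G" for u v
    using that linfun_zero[OF subspace_G blG(1)] linfun_zero[OF subspace_G blG(2)] by auto
  have exB: "coform \<xi> (wv j) (wv k) = (\<Sum>a<?n. \<Sum>b<?n. coord a (wv j) * coord b (wv k) * coform \<xi> (xs ! a) (xs ! b))"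
    if "j < 2 * m" "k < 2 * m" for j k
    by (rule dual_system_expand2[OF subspace_G dual_system_coord wvG[OF that(1)] wvG[OF that(2)] blG rad0])
  have exL: "Le c0 i (wv j) = (\<Sum>a<?n. coord a (wv j) * Le c0 i (xs ! a))" if "i < l + l'" "j < 2 * m" for i j
    by (rule dual_system_expand[OF subspace_G dual_system_coord wvG[OF that(2)] linLe[OF that(1)]])
       (use linfun_zero[OF subspace_G linLe[OF that(1)]] in auto)
  \<comment> \<open>The nonvanishing found on the tuple \<open>wv\<close> is transferred to a tuple
    of basis vectors.\<close>
  obtain J1 where J1: "J1 \<subseteq> {..<?n}" "card J1 = 2 * m"
    "mixpf mF (l + l') (\<lambda>j k. coform \<xi> (xs ! (sorted_list_of_set J1 ! j)) (xs ! (sorted_list_of_set J1 ! k)))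
       (\<lambda>i j. Le c0 i (xs ! (sorted_list_of_set J1 ! j))) \<noteq> 0"
    by (rule mixpf_minor_nonzero[where c="\<lambda>j a. coord a (wv j)" and n="length xs" and B="\<lambda>j k. coform \<xi> (wv j) (wv k)"
        and ?B0.0="\<lambda>a b. coform \<xi> (xs ! a) (xs ! b)" and L="\<lambda>i j. Le c0 i (wv j)" and ?L0.0="\<lambda>i a. Le c0 i (xs ! a)",
        OF N exB exL nzw])
  then have "mpol_eval id c0 (bp J1) \<noteq> 0" by (simp add: evb minor_vec_def \<xi>_def)
  then have bJ1: "bp J1 \<noteq> 0" using mpol_eval_zero by metis
  obtain J0 where J0: "J0 \<subseteq> {..<?n}" "card J0 = 2 * m" "pf_poly m J0 \<noteq> 0" using pf_poly_nonzero[OF m] .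
  \<comment> \<open>The relation \<open>rank\<close> would make \<open>pf_poly m J0 * bp J1\<close>
    zero, a product of nonzero polynomials.\<close>
  have bJ0: "bp J0 \<noteq> 0"
  proof
    assume "bp J0 = 0"
    then have "pf_poly m J0 * bp J1 = 0" using rank[OF J0(1,2) J1(1,2)] by simp
    then show False using bJ1 J0(3) by simp
  qed
  have "pf_poly m K \<in> mpols_below ?n \<and> pf_poly m J0 dvd pf_poly m K * bp J0"
    if K: "K \<in> {K. K \<subseteq> {..<?n} \<and> card K = 2 * m}" for K
  proof
    have "pf_poly m K * bp J0 = pf_poly m J0 * bp K" using rank[OF J0(1,2), of K] K by simp
    then show "pf_poly m J0 dvd pf_poly m K * bp J0" by simp
  qed (rule pf_poly_mpols_below)
  from common_divisor_degree[OF pf_poly_mpols_below J0(3) bJ0 bpR this]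
  obtain q where q: "q \<in> mpols_below ?n" and "q dvd pf_poly m J0 \<and> (\<forall>K\<in>{K. K \<subseteq> {..<?n} \<and> card K = 2 * m}. q dvd pf_poly m K) \<and>
      total_degree (pf_poly m J0) \<le> total_degree q + total_degree (bp J0)"
    by (rule bexE)
  then have q2: "\<And>K. K \<subseteq> {..<?n} \<Longrightarrow> card K = 2 * m \<Longrightarrow> q dvd pf_poly m K"
    and q3: "total_degree (pf_poly m J0) \<le> total_degree q + total_degree (bp J0)" by simp_all
  have "m \<le> total_degree q + (mF + l)"
    using q3 total_degree_homogeneous[OF homogeneous_pf_poly J0(3)] total_degree_homogeneous[OF hb bJ0] by simp
  then have "real m \<le> real (total_degree q) + real mF + real l" by simp
  then have "lie_c s br G - lie_c s br FG \<le> real (total_degree q)"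
    using m mF dl by (simp add: lie_c_def field_simps)
  with q q2 show ?thesis by (rule that)
qed

end

section \<open>Hypersurfaces in the dual space\<close>

locale lie_algebra_basis_closed = lie_algebra_basis s br G xs
  for s :: "'k::{alg_closed_field, field_char_0} \<Rightarrow> 'a::ab_group_add \<Rightarrow> 'a" and br G xs
begin

lemma sym_alg_G: "sym_alg s xs G = mpols_below (length xs)"
  by (rule sym_alg_eq_mpols_below[OF xs])

abbreviation dual_eval :: "('a \<Rightarrow> 'k) \<Rightarrow> 'k mpol \<Rightarrow> 'k" where
  "dual_eval \<xi> f \<equiv> mpol_eval id (\<lambda>i. \<xi> (xs ! i)) f"

definition zeros :: "'k mpol \<Rightarrow> ('a \<Rightarrow> 'k) set" where
  "zeros f = {\<xi> \<in> dual_space s G. dual_eval \<xi> f = 0}"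

lemma dual_point:
  assumes "f \<in> mpols_below (length xs)"
  shows "restrict (point v) G \<in> dual_space s G" "dual_eval (restrict (point v) G) f = mpol_eval id v f"
proof -
  show "restrict (point v) G \<in> dual_space s G"
    by (rule restrict_dual_space(1)[OF lie_subalgebra_G linfun_point])
  have "point v (xs ! j) = v j" if "j < length xs" for j
  proof -
    have "point v (xs ! j) = (\<Sum>i<length xs. if i = j then v i else 0)"
      unfolding point_def using that by (intro sum.cong) (simp_all add: coord_basis)
    then show ?thesis using that by simp
  qed
  then show "dual_eval (restrict (point v) G) f = mpol_eval id v f"
    using xs_G by (intro mpol_eval_cong[OF assms]) simp
qed

lemma zariski_closed_zeros:
  assumes Z: "zariski_closed s G xs Z" and f: "f \<in> mpols_below (length xs)"
  shows "zariski_closed s G xs (Z \<inter> zeros f)"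
proof -
  obtain I where I: "I \<subseteq> sym_alg s xs G" "Z = {\<xi> \<in> dual_space s G. \<forall>f\<in>I. dual_eval \<xi> f = 0}"
    using Z by (auto simp: zariski_closed_def)
  then have "Z \<inter> zeros f = {\<xi> \<in> dual_space s G. \<forall>f\<in>insert f I. dual_eval \<xi> f = 0}"
    by (auto simp: zeros_def)
  then show ?thesis using I(1) f unfolding zariski_closed_def
    by (intro exI[of _ "insert f I"]) (auto simp: sym_alg_G)
qed

lemma zariski_closed_dual_space: "zariski_closed s G xs (dual_space s G)"
  unfolding zariski_closed_def by (intro exI[of _ "{}"]) auto

text \<open>In a proper decomposition each part misses a point of \<open>Z\<close>. Equations of the
  two parts that are nonzero at these points have a product vanishing on all of
  \<open>Z\<close>.\<close>

lemma irreducible_closedI: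
  assumes Z: "zariski_closed s G xs Z" "Z \<noteq> {}"
    and prime: "\<And>f g. f \<in> mpols_below (length xs) \<Longrightarrow> g \<in> mpols_below (length xs) \<Longrightarrow>
      (\<And>\<xi>. \<xi> \<in> Z \<Longrightarrow> dual_eval \<xi> (f * g) = 0) \<Longrightarrow>
      (\<forall>\<xi>\<in>Z. dual_eval \<xi> f = 0) \<or> (\<forall>\<xi>\<in>Z. dual_eval \<xi> g = 0)"
  shows "irreducible_closed s G xs Z"
  unfolding irreducible_closed_def
proof (intro conjI allI impI Z, rule ccontr)
  fix Z1 Z2
  assume Z12: "zariski_closed s G xs Z1 \<and> zariski_closed s G xs Z2 \<and> Z = Z1 \<union> Z2"
    and ne: "\<not> (Z = Z1 \<or> Z = Z2)"
  obtain I1 where I1: "I1 \<subseteq> sym_alg s xs G" "Z1 = {\<xi> \<in> dual_space s G. \<forall>f\<in>I1. dual_eval \<xi> f = 0}"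
    using Z12 unfolding zariski_closed_def by blast
  obtain I2 where I2: "I2 \<subseteq> sym_alg s xs G" "Z2 = {\<xi> \<in> dual_space s G. \<forall>f\<in>I2. dual_eval \<xi> f = 0}"
    using Z12 unfolding zariski_closed_def by blast
  have Zd: "Z \<subseteq> dual_space s G" using Z12 I1(2) I2(2) by blast
  obtain \<xi>1 where \<xi>1: "\<xi>1 \<in> Z" "\<xi>1 \<notin> Z1" using ne Z12 by blast
  obtain \<xi>2 where \<xi>2: "\<xi>2 \<in> Z" "\<xi>2 \<notin> Z2" using ne Z12 by blast
  obtain f where f: "f \<in> I1" "dual_eval \<xi>1 f \<noteq> 0" using \<xi>1 I1(2) Zd by blast
  obtain g where g: "g \<in> I2" "dual_eval \<xi>2 g \<noteq> 0" using \<xi>2 I2(2) Zd by blast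
  have fg: "f \<in> mpols_below (length xs)" "g \<in> mpols_below (length xs)"
    using f g I1(1) I2(1) sym_alg_G by auto
  have "dual_eval \<xi> (f * g) = 0" if "\<xi> \<in> Z" for \<xi>
  proof -
    have "dual_eval \<xi> f = 0 \<or> dual_eval \<xi> g = 0" using that Z12 I1(2) I2(2) f(1) g(1) by blast
    then show ?thesis by (auto simp: ring_hom_funD[OF eval_hom])
  qed
  from prime[OF fg this] show False using \<xi>1 \<xi>2 f g by blast
qed

lemma irreducible_closedD:
  assumes Z: "irreducible_closed s G xs Z" and fg: "f \<in> mpols_below (length xs)" "g \<in> mpols_below (length xs)"
    and 0: "\<And>\<xi>. \<xi> \<in> Z \<Longrightarrow> dual_eval \<xi> (f * g) = 0"
  shows "Z \<subseteq> zeros f \<or> Z \<subseteq> zeros g"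
proof -
  have Zc: "zariski_closed s G xs Z" using Z by (simp add: irreducible_closed_def)
  then have Zd: "Z \<subseteq> dual_space s G" unfolding zariski_closed_def by blast
  have "dual_eval \<xi> f = 0 \<or> dual_eval \<xi> g = 0" if "\<xi> \<in> Z" for \<xi>
    using 0[OF that] by (simp add: ring_hom_funD[OF eval_hom])
  then have "Z = (Z \<inter> zeros f) \<union> (Z \<inter> zeros g)" using Zd by (auto simp: zeros_def)
  then have "Z = Z \<inter> zeros f \<or> Z = Z \<inter> zeros g"
    using Z zariski_closed_zeros[OF Zc fg(1)] zariski_closed_zeros[OF Zc fg(2)]
    unfolding irreducible_closed_def by blast
  then show ?thesis by blast
qed

lemma vanishing_imp_zero:
  assumes f: "f \<in> mpols_below (length xs)" and 0: "\<And>\<xi>. \<xi> \<in> dual_space s G \<Longrightarrow> dual_eval \<xi> f = 0"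
  shows "f = 0"
  using mpols_below_eq_0[OF f] 0 dual_point[OF f] by metis

lemma irreducible_closed_dual_space: "irreducible_closed s G xs (dual_space s G)"
proof (rule irreducible_closedI[OF zariski_closed_dual_space])
  show "dual_space s G \<noteq> {}"
    using restrict_dual_space(1)[OF lie_subalgebra_G linfun_point] by blast
  fix f g :: "'k mpol"
  assume fg: "f \<in> mpols_below (length xs)" "g \<in> mpols_below (length xs)"
    "\<And>\<xi>. \<xi> \<in> dual_space s G \<Longrightarrow> dual_eval \<xi> (f * g) = 0"
  have "f * g = 0"
    by (rule vanishing_imp_zero[OF subring_setD(5)[OF subring_mpols_below fg(1,2)] fg(3)])
  then show "(\<forall>\<xi>\<in>dual_space s G. dual_eval \<xi> f = 0) \<or> (\<forall>\<xi>\<in>dual_space s G. dual_eval \<xi> g = 0)"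
    by (auto simp: mpol_eval_zero)
qed

lemma zeros_dvd:
  assumes q: "prime_in (mpols_below (length xs)) q" and g: "g \<in> mpols_below (length xs)"
    and 0: "\<And>\<xi>. \<xi> \<in> zeros q \<Longrightarrow> dual_eval \<xi> g = 0"
  shows "q dvd g"
proof (rule hypersurface_nullstellensatz[OF prime_imp_irreducible_mpols_below[OF q] g])
  fix v assume "mpol_eval id v q = 0"
  moreover have qR: "q \<in> mpols_below (length xs)" using q by (simp add: prime_in_def)
  ultimately have "dual_eval (restrict (point v) G) q = 0" by (simp only: dual_point(2)[OF qR])
  then have "restrict (point v) G \<in> zeros q"
    unfolding zeros_def using dual_point(1)[OF qR] by blast
  then have "dual_eval (restrict (point v) G) g = 0" by (rule 0)
  then show "mpol_eval id v g = 0" by (simp only: dual_point(2)[OF g])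
qed

lemma irreducible_closed_zeros:
  assumes q: "prime_in (mpols_below (length xs)) q"
  shows "irreducible_closed s G xs (zeros q)"
proof (rule irreducible_closedI)
  have qR: "q \<in> mpols_below (length xs)" using q by (simp add: prime_in_def)
  have "zeros q \<subseteq> dual_space s G" by (auto simp: zeros_def)
  then show "zariski_closed s G xs (zeros q)"
    using zariski_closed_zeros[OF zariski_closed_dual_space qR] by (simp add: Int_absorb1)
  show "zeros q \<noteq> {}"
  proof
    assume "zeros q = {}"
    then have "q dvd 1"
      by (intro zeros_dvd[OF q]) (use subring_setD(2)[OF subring_mpols_below] in auto)
    then show False
      using q dvd_in_mpols_below[OF subring_setD(2)[OF subring_mpols_below]] by (auto simp: prime_in_def unit_in_def)
  qed
  fix f g :: "'k mpol"
  assume fg: "f \<in> mpols_below (length xs)" "g \<in> mpols_below (length xs)"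
    "\<And>\<xi>. \<xi> \<in> zeros q \<Longrightarrow> dual_eval \<xi> (f * g) = 0"
  have fgR: "f * g \<in> mpols_below (length xs)" by (rule subring_setD(5)[OF subring_mpols_below fg(1,2)])
  have "q dvd f * g" by (rule zeros_dvd[OF q fgR fg(3)])
  then have "q dvd f \<or> q dvd g"
    using q fg(1,2) fgR dvd_in_mpols_below unfolding prime_in_def by blast
  then show "(\<forall>\<xi>\<in>zeros q. dual_eval \<xi> f = 0) \<or> (\<forall>\<xi>\<in>zeros q. dual_eval \<xi> g = 0)"
    by (auto simp: zeros_def ring_hom_funD[OF eval_hom] elim!: dvdE)
qed

text \<open>Suppose an irreducible closed set \<open>C 1\<close> lies strictly between the
  hypersurface and a larger one. Take a nonzero polynomial of least degree vanishing on it. By the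
  Nullstellensatz \<open>q\<close> divides it, and irreducibility forces the quotient to vanish on
  \<open>C 1\<close> as well, although its degree is smaller.\<close>

lemma codim_zeros_le:
  assumes q: "prime_in (mpols_below (length xs)) q"
  shows "codim_irreducible s G xs (zeros q) \<le> 1"
  unfolding codim_irreducible_def
proof (intro Sup_least, clarify)
  have qR: "q \<in> mpols_below (length xs)" using q by (simp add: prime_in_def)
  fix r C
  assume C0: "C 0 = zeros q" and C: "\<forall>i\<le>r. irreducible_closed s G xs (C i)" "\<forall>i<r. C i \<subset> C (Suc i)"
  have "r \<le> 1"
  proof (rule ccontr)
    assume "\<not> r \<le> 1"
    then have C1: "irreducible_closed s G xs (C 1)" "zeros q \<subset> C 1" "C 1 \<subset> C 2"
      and C2: "irreducible_closed s G xs (C 2)"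
      using C C0 by (auto simp: numeral_2_eq_2)
    have "C 2 \<subseteq> dual_space s G" using C2 unfolding irreducible_closed_def zariski_closed_def by blast
    then obtain \<xi> where \<xi>: "\<xi> \<in> dual_space s G" "\<xi> \<notin> C 1" using C1 by blast
    obtain I where I: "I \<subseteq> sym_alg s xs G" "C 1 = {\<xi> \<in> dual_space s G. \<forall>f\<in>I. dual_eval \<xi> f = 0}"
      using C1(1) unfolding irreducible_closed_def zariski_closed_def by (elim conjE exE)
    define P where "P f \<longleftrightarrow> f \<in> mpols_below (length xs) \<and> f \<noteq> 0 \<and> C 1 \<subseteq> zeros f" for f
    obtain f0 where f0: "f0 \<in> I" "dual_eval \<xi> f0 \<noteq> 0" using \<xi> I(2) by blast
    have "P f0"
      using f0 I sym_alg_G by (auto simp: P_def zeros_def mpol_eval_zero)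
    then have f: "P (arg_min total_degree P)" by (rule arg_min_natI)
    define f where "f = arg_min total_degree P"
    have min: "total_degree f \<le> total_degree g" if "P g" for g
      using arg_min_nat_le[of P g total_degree, OF that] by (simp add: f_def)
    have fR: "f \<in> mpols_below (length xs)" "f \<noteq> 0" "C 1 \<subseteq> zeros f" using f by (auto simp: P_def f_def)
    have "q dvd f"
      using C1(2) fR(3) by (intro zeros_dvd[OF q fR(1)]) (auto simp: zeros_def)
    then obtain g where g: "f = q * g" by (elim dvdE)
    have gnz: "g \<noteq> 0" "q \<noteq> 0" using g fR(2) by auto
    have gR: "g \<in> mpols_below (length xs)" using mpols_below_factor[of g q] fR g by (simp add: mult.commute)
    have "dual_eval \<xi> (q * g) = 0" if "\<xi> \<in> C 1" for \<xi> using that fR(3) g by (auto simp: zeros_def)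
    then have "C 1 \<subseteq> zeros q \<or> C 1 \<subseteq> zeros g" by (rule irreducible_closedD[OF C1(1) qR gR])
    then have "P g" using C1(2) gnz gR by (auto simp: P_def)
    then have "total_degree f \<le> total_degree g" by (rule min)
    then show False using total_degree_mult[OF gnz(2,1)] g prime_in_mpols_below_degree[OF q] by simp
  qed
  then show "enat r \<le> 1" by (simp add: one_enat_def)
qed

text \<open>The zeros of a prime divisor of \<open>q\<close> form an irreducible hypersurface of
  singular functionals, so the codimension is at most 1. It is at least 1 because regular
  functionals exist: each irreducible closed set of singular functionals is properly contained in
  the dual space.\<close>

lemma lie_singularI:
  assumes m: "dim G = lie_index s br G + 2 * m"
    and q: "q \<in> mpols_below (length xs)" "total_degree q > 0"
    and dvd: "\<And>J. J \<subseteq> {..<length xs} \<Longrightarrow> card J = 2 * m \<Longrightarrow> q dvd pf_poly m J"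
  shows "lie_singular s br G xs"
proof -
  let ?S = "{Z. irreducible_closed s G xs Z \<and> Z \<subseteq> dual_sing s br G}"
  obtain J0 where J0: "J0 \<subseteq> {..<length xs}" "card J0 = 2 * m" "pf_poly m J0 \<noteq> 0" using pf_poly_nonzero[OF m] .
  have "q \<noteq> 0" using dvd[OF J0(1,2)] J0(3) by auto
  then obtain p where p: "prime_in (mpols_below (length xs)) p" "p dvd q"
    using prime_divisor_mpols_below[OF q(1) _ q(2)] by blast
  have reg: "(dim (stabilizer br G \<xi>) = lie_index s br G) \<longleftrightarrow>
      (\<exists>J. J \<subseteq> {..<length xs} \<and> card J = 2 * m \<and> dual_eval \<xi> (pf_poly m J) \<noteq> 0)" if "\<xi> \<in> dual_space s G" for \<xi>
  proof -
    have "linfun s G \<xi>" using that by (simp add: dual_space_eq)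
    then have "stabilizer br G (point (\<lambda>i. \<xi> (xs ! i))) = stabilizer br G \<xi>"
      by (intro stabilizer_cong point_coord lie_subalgebra_G)
    then show ?thesis using regular_iff_pf_poly[OF m, of "\<lambda>i. \<xi> (xs ! i)"] by simp
  qed
  have "zeros p \<subseteq> dual_sing s br G"
  proof
    fix \<xi> assume \<xi>: "\<xi> \<in> zeros p"
    have "dual_eval \<xi> (pf_poly m J) = 0" if "J \<subseteq> {..<length xs}" "card J = 2 * m" for J
      using \<xi> dvd_trans[OF p(2) dvd[OF that]]
      by (auto simp: zeros_def ring_hom_funD[OF eval_hom] elim!: dvdE)
    then show "\<xi> \<in> dual_sing s br G"
      using \<xi> reg[of \<xi>] by (auto simp: zeros_def dual_sing_def dual_reg_def)
  qed
  then have pS: "zeros p \<in> ?S" using irreducible_closed_zeros[OF p(1)] by simp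
  have "codim s G xs (dual_sing s br G) \<le> codim_irreducible s G xs (zeros p)"
    unfolding codim_def by (rule INF_lower[OF pS])
  also have "\<dots> \<le> 1" by (rule codim_zeros_le[OF p(1)])
  finally have "codim s G xs (dual_sing s br G) \<le> 1" .
  moreover have "1 \<le> codim s G xs (dual_sing s br G)"
    unfolding codim_def
  proof (rule INF_greatest)
    fix Z assume Z: "Z \<in> ?S"
    obtain \<xi> where \<xi>: "linfun s G \<xi>" "dim (stabilizer br G \<xi>) = lie_index s br G"
      using lie_index_attained[OF lie_subalgebra_G] .
    have "restrict \<xi> G \<in> dual_space s G" "restrict \<xi> G \<notin> dual_sing s br G"
      using \<xi> restrict_dual_space[OF lie_subalgebra_G \<xi>(1)] by (auto simp: dual_sing_def dual_reg_def)
    moreover have "Z \<subseteq> dual_sing s br G" "dual_sing s br G \<subseteq> dual_space s G" using Z by (auto simp: dual_sing_def)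
    ultimately have lt: "Z \<subset> dual_space s G" by blast
    define C where "C i = (if i = 0 then Z else dual_space s G)" for i :: nat
    have "enat 1 \<in> {enat r |r. \<exists>C. C 0 = Z \<and> (\<forall>i\<le>r. irreducible_closed s G xs (C i)) \<and> (\<forall>i<r. C i \<subset> C (Suc i))}"
      using Z lt irreducible_closed_dual_space
      by (intro CollectI exI[of _ 1] exI[of _ C] conjI) (auto simp: C_def)
    then show "1 \<le> codim_irreducible s G xs Z"
      unfolding codim_irreducible_def one_enat_def by (rule Sup_upper)
  qed
  ultimately show ?thesis unfolding lie_singular_def by (rule order.antisym)
qed

lemma lie_c_semiradical_bound:
  assumes p: "fundamental_semi_invariant s br G xs p"
  shows "lie_c s br G - lie_c s br FG \<le> real (total_degree p)"
proof -
  obtain m where m: "dim G = lie_index s br G + 2 * m" using dim_index_even[OF lie_subalgebra_G] .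
  obtain q where q: "q \<in> mpols_below (length xs)"
    "\<And>J. J \<subseteq> {..<length xs} \<Longrightarrow> card J = 2 * m \<Longrightarrow> q dvd pf_poly m J"
    "lie_c s br G - lie_c s br FG \<le> real (total_degree q)"
    using common_divisor_of_pfaffians[OF m] by blast
  obtain J0 where J0: "J0 \<subseteq> {..<length xs}" "card J0 = 2 * m" "pf_poly m J0 \<noteq> 0" using pf_poly_nonzero[OF m] .
  have "\<forall>f\<in>principal_pfaffians s br G xs. q dvd f"
    unfolding pf_poly_dvd_iff[OF m] using q(2) by simp
  then have "q dvd p"
    using p q(1) by (simp add: fundamental_semi_invariant_def sym_alg_G)
  have "\<forall>f\<in>principal_pfaffians s br G xs. p dvd f"
    using p by (simp add: fundamental_semi_invariant_def)
  then have "p dvd pf_poly m J0"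
    unfolding pf_poly_dvd_iff[OF m] using J0(1,2) by simp
  then have "p \<noteq> 0" using J0(3) by auto
  with \<open>q dvd p\<close> have "total_degree q \<le> total_degree p"
    using total_degree_mult[of q] by (auto elim!: dvdE)
  then show ?thesis using q(3) by linarith
qed

text \<open>The common divisor \<open>q\<close> of the Pfaffians itself has degree 0, since
  otherwise its zeros would make the Lie algebra singular. The reverse inequality is monotonicity of
  \<open>lie_c\<close>.\<close>

lemma lie_c_semiradical_nonsingular:
  assumes "lie_nonsingular s br G xs"
  shows "lie_c s br G = lie_c s br FG"
proof -
  obtain m where m: "dim G = lie_index s br G + 2 * m" using dim_index_even[OF lie_subalgebra_G] .
  obtain q where q: "q \<in> mpols_below (length xs)"
    "\<And>J. J \<subseteq> {..<length xs} \<Longrightarrow> card J = 2 * m \<Longrightarrow> q dvd pf_poly m J"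
    "lie_c s br G - lie_c s br FG \<le> real (total_degree q)"
    using common_divisor_of_pfaffians[OF m] by blast
  have "total_degree q = 0" using lie_singularI[OF m q(1) _ q(2)] assms by auto
  then show ?thesis using q(3) lie_c_subalgebra_le[OF lie_subalgebra_semiradical] by simp
qed

end

section \<open>Commutative polarizations\<close>

context lie_algebra_char_0 begin

lemma lie_c_commutative:
  assumes H: "lie_subalgebra s br G H" and c: "lie_commutative br H"
  shows "lie_c s br H = real (dim H)"
proof -
  obtain \<xi> where \<xi>: "linfun s H \<xi>" "dim (stabilizer br H \<xi>) = lie_index s br H"
    using lie_index_attained[OF H] .
  have "stabilizer br H \<xi> = H"
    using c linfun_zero[OF lie_subalgebraD(1)[OF H] \<xi>(1)] by (auto simp: stabilizer_def lie_commutative_def)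
  then show ?thesis using \<xi>(2) by (simp add: lie_c_def)
qed

text \<open>A maximal isotropic subspace for \<open>\<xi>([\<cdot>,\<cdot>])\<close> contains the radical \<open>G(\<xi>)\<close>.\<close>

lemma semiradical_subset_polarization:
  assumes H: "commutative_polarization s br G H"
  shows "FG \<subseteq> H"
proof -
  have H': "lie_subalgebra s br G H" "lie_commutative br H" "real (dim H) = lie_c s br G"
    using H by (auto simp: commutative_polarization_def)
  note HD = lie_subalgebraD[OF H'(1)]
  have "stabilizer br G \<xi> \<subseteq> H" if "\<xi> \<in> dual_reg s br G" for \<xi>
  proof -
    have \<xi>: "linfun s G \<xi>" "dim (stabilizer br G \<xi>) = lie_index s br G"
      using that by (auto simp: dual_reg_def dual_space_eq)
    note alt = altform_coform[OF lie_subalgebra_G \<xi>(1)]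
    have N: "subspace (stabilizer br G \<xi>)" by (rule stabilizer_subspace[OF lie_subalgebra_G \<xi>(1)])
    have NG: "stabilizer br G \<xi> \<subseteq> G" by (auto simp: stabilizer_def)
    \<comment> \<open>Adding the radical to the isotropic subspace \<open>H\<close> keeps it
      isotropic. The bound for isotropic subspaces then gives \<open>dim K \<le> dim H\<close>, so
      nothing was added.\<close>
    define K where "K = {x + y |x y. x \<in> H \<and> y \<in> stabilizer br G \<xi>}"
    have K: "subspace K" unfolding K_def by (rule subspace_sums[OF HD(1) N])
    have KG: "K \<subseteq> G" using HD(2) NG subspace_add[OF subspace_G] by (auto simp: K_def)
    have HK: "H \<subseteq> K" using subspace_0[OF N] by (force simp: K_def)
    have NK: "stabilizer br G \<xi> \<subseteq> K" using subspace_0[OF HD(1)] by (force simp: K_def)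
    have "\<xi> (br u v) = 0" if uv: "u \<in> K" "v \<in> K" for u v
    proof -
      obtain x y x' y' where u: "u = x + y" "x \<in> H" "y \<in> stabilizer br G \<xi>"
        and v: "v = x' + y'" "x' \<in> H" "y' \<in> stabilizer br G \<xi>" using uv by (auto simp: K_def)
      have inG: "x \<in> G" "y \<in> G" "x' \<in> G" "y' \<in> G" "v \<in> G" using u v HD(2) NG uv KG by auto
      have "\<xi> (br u v) = \<xi> (br x v) + \<xi> (br y v)"
        using \<xi>(1) inG br_closed unfolding u(1) by (simp add: br_add_left linfun_def)
      also have "\<xi> (br y v) = 0" using u(3) inG by (simp add: stabilizer_def)
      also have "\<xi> (br x v) = \<xi> (br x x') + \<xi> (br x y')"
        using \<xi>(1) inG br_closed unfolding v(1) by (simp add: br_add_right linfun_def)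
      also have "\<xi> (br x x') = 0"
        using H'(2) u(2) v(2) linfun_zero[OF subspace_G \<xi>(1)] by (simp add: lie_commutative_def)
      also have "\<xi> (br x y') = 0"
        using altform_antisym[OF subspace_G alt inG(4,1)] v(3) inG by (simp add: stabilizer_def)
      finally show ?thesis by simp
    qed
    then have "radical K (coform \<xi>) = K" by (auto simp: radical_def)
    then have "dim K + dim K \<le> dim G + lie_index s br G"
      using dim_isotropic_radical[OF subspace_G fin_dim_G alt K KG] \<xi>(2) by (simp add: stabilizer_eq_radical)
    moreover have "real (2 * dim H) = real (dim G + lie_index s br G)"
      using H'(3) by (simp add: lie_c_def)
    then have "2 * dim H = dim G + lie_index s br G" by (rule of_nat_eq_iff[THEN iffD1])
    ultimately have "dim K \<le> dim H" by simp
    then have "H = K" by (rule subspace_eq_dim[OF K fin_dim_subset[OF fin_dim_G KG] HD(1) HK])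
    then show ?thesis using NK by simp
  qed
  then show ?thesis unfolding frobenius_semiradical_def by (intro span_minimal HD(1)) blast
qed

lemma commutative_polarization_iff:
  assumes c: "lie_c s br G = lie_c s br FG" and F: "lie_commutative br FG"
  shows "commutative_polarization s br G H \<longleftrightarrow> H = FG"
proof
  note FS = lie_subalgebra_semiradical
  show "commutative_polarization s br G H" if "H = FG"
    using that FS F c lie_c_commutative[OF FS F] by (simp add: commutative_polarization_def)
  assume H: "commutative_polarization s br G H"
  then have H': "lie_subalgebra s br G H" "real (dim H) = lie_c s br G"
    by (auto simp: commutative_polarization_def)
  have "real (dim H) = real (dim FG)" using H'(2) c lie_c_commutative[OF FS F] by simp
  then have "dim H \<le> dim FG" by simp
  then show "H = FG"
    using subspace_eq_dim[OF lie_subalgebraD(1,4)[OF H'(1)] subspace_semiradical semiradical_subset_polarization[OF H]] by simp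
qed

end

lemma sym_alg_mono: "W \<subseteq> W' \<Longrightarrow> sym_alg s xs W \<subseteq> sym_alg s xs W'"
  unfolding sym_alg_def by blast

section \<open>Coordinate spaces of finitely supported functions\<close>

text \<open>Used with two index types: natural numbers for the example Lie algebra, and exponent
  maps for spaces of polynomials in the dimension count at the end.\<close>

definition pm_scale :: "'k::field \<Rightarrow> ('b \<Rightarrow>\<^sub>0 'k) \<Rightarrow> ('b \<Rightarrow>\<^sub>0 'k)" where
  "pm_scale c = Poly_Mapping.map ((*) c)"

lemma lookup_pm_scale: "Poly_Mapping.lookup (pm_scale c v) i = c * Poly_Mapping.lookup v i"
  by (simp add: pm_scale_def map.rep_eq when_def)

lemma vector_space_pm_scale: "vector_space pm_scale"
  by unfold_locales (simp_all add: poly_mapping_eq_iff fun_eq_iff lookup_pm_scale lookup_add algebra_simps)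

definition supp_space :: "'b set \<Rightarrow> ('b \<Rightarrow>\<^sub>0 'k::field) set" where
  "supp_space K = {v. \<forall>i. i \<notin> K \<longrightarrow> Poly_Mapping.lookup v i = 0}"

lemma subspace_supp_space: "module.subspace pm_scale (supp_space K)"
proof -
  interpret vector_space pm_scale by (rule vector_space_pm_scale)
  show ?thesis by (rule subspaceI) (auto simp: supp_space_def lookup_add lookup_pm_scale)
qed

lemma lookup_sum_unit:
  assumes "finite K"
  shows "Poly_Mapping.lookup (\<Sum>j\<in>K. pm_scale (f j) (Poly_Mapping.single j 1)) i = (if i \<in> K then f i else 0)"
proof -
  have "Poly_Mapping.lookup (\<Sum>j\<in>K. pm_scale (f j) (Poly_Mapping.single j 1)) i = (\<Sum>j\<in>K. if j = i then f j else 0)"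
    unfolding lookup_sum by (intro sum.cong) (auto simp: lookup_pm_scale lookup_single when_def)
  then show ?thesis using assms by simp
qed

lemma supp_space_expand:
  assumes "finite K" "v \<in> supp_space K"
  shows "(\<Sum>j\<in>K. pm_scale (Poly_Mapping.lookup v j) (Poly_Mapping.single j 1)) = v"
  using assms by (intro poly_mapping_eqI) (auto simp: lookup_sum_unit supp_space_def)

lemma inj_unit_vector: "inj (\<lambda>i. Poly_Mapping.single i (1::'k::field))"
  by (rule injI) (metis lookup_single_eq lookup_single_not_eq zero_neq_one)

lemma basis_supp_space:
  assumes K: "finite K"
  defines "B \<equiv> (\<lambda>i. Poly_Mapping.single i (1::'k::field)) ` K"
  shows "\<not> module.dependent pm_scale B" "module.span pm_scale B = supp_space K" "card B = card K"
proof -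
  interpret vector_space pm_scale by (rule vector_space_pm_scale)
  have inj: "inj_on (\<lambda>i. Poly_Mapping.single i (1::'k)) K" using inj_unit_vector by (rule inj_on_subset) simp
  show "card B = card K" unfolding B_def using inj by (rule card_image)
  show "independent B"
  proof (rule independent_if_scalars_zero)
    show "finite B" using K by (simp add: B_def)
    fix f x assume 0: "(\<Sum>x\<in>B. pm_scale (f x) x) = 0" and "x \<in> B"
    then obtain i where i: "i \<in> K" "x = Poly_Mapping.single i 1" by (auto simp: B_def)
    have "(\<Sum>j\<in>K. pm_scale (f (Poly_Mapping.single j 1)) (Poly_Mapping.single j 1)) = 0"
      using 0 unfolding B_def by (simp add: sum.reindex[OF inj])
    then show "f x = 0"
      using lookup_sum_unit[OF K, of "\<lambda>j. f (Poly_Mapping.single j 1)" i] i by simp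
  qed
  show "span B = supp_space K"
  proof
    have "B \<subseteq> supp_space K" by (auto simp: B_def supp_space_def lookup_single when_def)
    then show "span B \<subseteq> supp_space K" using subspace_supp_space by (rule span_minimal)
    show "supp_space K \<subseteq> span B"
    proof
      fix v :: "'a \<Rightarrow>\<^sub>0 'k" assume "v \<in> supp_space K"
      then have "v = (\<Sum>j\<in>K. pm_scale (Poly_Mapping.lookup v j) (Poly_Mapping.single j 1))"
        using supp_space_expand[OF K] by metis
      moreover have "\<dots> \<in> span B" by (intro span_sum span_scale span_base) (simp add: B_def)
      ultimately show "v \<in> span B" by simp
    qed
  qed
qed

lemma dim_supp_space:
  "finite K \<Longrightarrow> vector_space.dim pm_scale (supp_space K :: ('b \<Rightarrow>\<^sub>0 'k::field) set) = card K"
  using vector_space.dim_span_eq_card_independent[OF vector_space_pm_scale basis_supp_space(1)[of K]]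
  by (simp add: basis_supp_space)

section \<open>An example with strict inequality\<close>

text \<open>
  The Borel subalgebra \<open>\<langle>h, e\<rangle>\<close> of \<open>sl\<^sub>2\<close> acting on the abelian Lie algebra with underlying space
  \<open>sl\<^sub>2 = \<langle>H, E, F\<rangle>\<close>. The basis vectors \<open>h, e, H, E, F\<close> have the indices \<open>0, \<dots>, 4\<close>, and the nonzero brackets are
  \<open>[h, e] = 2e\<close>, \<open>[h, E] = 2E\<close>, \<open>[h, F] = -2F\<close>, \<open>[e, H] = -2E\<close>, \<open>[e, F] = H\<close>.
\<close>

definition borel_br :: "(nat \<Rightarrow>\<^sub>0 'k::field) \<Rightarrow> (nat \<Rightarrow>\<^sub>0 'k) \<Rightarrow> (nat \<Rightarrow>\<^sub>0 'k)" where
  "borel_br u v = (let a = Poly_Mapping.lookup u; b = Poly_Mapping.lookup v in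
     Poly_Mapping.single 1 (2 * (a 0 * b 1 - a 1 * b 0)) +
     Poly_Mapping.single 2 (a 1 * b 4 - a 4 * b 1) +
     Poly_Mapping.single 3 (2 * (a 0 * b 3 - a 3 * b 0) - 2 * (a 1 * b 2 - a 2 * b 1)) +
     Poly_Mapping.single 4 (- 2 * (a 0 * b 4 - a 4 * b 0)))"

abbreviation "borel_alg \<equiv> supp_space {..<5::nat}"

abbreviation unit_vec :: "nat \<Rightarrow> (nat \<Rightarrow>\<^sub>0 'k::field)" where
  "unit_vec i \<equiv> Poly_Mapping.single i 1"

definition borel_basis :: "(nat \<Rightarrow>\<^sub>0 'k::field) list" where
  "borel_basis = map unit_vec [0..<5]"

lemma lookup_borel_br:
  "Poly_Mapping.lookup (borel_br u v) i =
    (if i = 1 then 2 * (Poly_Mapping.lookup u 0 * Poly_Mapping.lookup v 1 - Poly_Mapping.lookup u 1 * Poly_Mapping.lookup v 0)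
     else if i = 2 then Poly_Mapping.lookup u 1 * Poly_Mapping.lookup v 4 - Poly_Mapping.lookup u 4 * Poly_Mapping.lookup v 1
     else if i = 3 then 2 * (Poly_Mapping.lookup u 0 * Poly_Mapping.lookup v 3 - Poly_Mapping.lookup u 3 * Poly_Mapping.lookup v 0)
         - 2 * (Poly_Mapping.lookup u 1 * Poly_Mapping.lookup v 2 - Poly_Mapping.lookup u 2 * Poly_Mapping.lookup v 1)
     else if i = 4 then - 2 * (Poly_Mapping.lookup u 0 * Poly_Mapping.lookup v 4 - Poly_Mapping.lookup u 4 * Poly_Mapping.lookup v 0)
     else 0)"
  by (simp add: borel_br_def Let_def lookup_add lookup_single when_def)

lemma length_borel_basis: "length borel_basis = 5"
  by (simp add: borel_basis_def)

lemma nth_borel_basis: "i < 5 \<Longrightarrow> borel_basis ! i = unit_vec i"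
  by (simp add: borel_basis_def)

lemma set_borel_basis: "set borel_basis = unit_vec ` {..<5}"
  by (auto simp: borel_basis_def)

lemma ordered_basis_borel: "ordered_basis pm_scale borel_alg (borel_basis :: (nat \<Rightarrow>\<^sub>0 'k::field) list)"
  unfolding ordered_basis_def set_borel_basis
proof (intro conjI basis_supp_space)
  show "distinct (borel_basis :: (nat \<Rightarrow>\<^sub>0 'k) list)"
    unfolding borel_basis_def distinct_map by (auto intro: inj_on_subset[OF inj_unit_vector])
qed simp_all

lemma lie_algebra_borel: "lie_algebra pm_scale borel_br (borel_alg :: (nat \<Rightarrow>\<^sub>0 'k::field) set)"
proof -
  interpret vector_space pm_scale by (rule vector_space_pm_scale)
  show ?thesis
  proof unfold_locales
    show "subspace borel_alg" by (rule subspace_supp_space)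
    show "\<exists>B. finite B \<and> span B = (borel_alg :: (nat \<Rightarrow>\<^sub>0 'k) set)"
      using basis_supp_space(2)[of "{..<5::nat}"] by (metis finite_imageI finite_lessThan)
    fix x y z :: "nat \<Rightarrow>\<^sub>0 'k"
    show "borel_br x y \<in> borel_alg" by (auto simp: supp_space_def lookup_borel_br)
    show "borel_br (x + y) z = borel_br x z + borel_br y z"
      by (rule poly_mapping_eqI) (simp add: lookup_borel_br lookup_add algebra_simps)
    show "borel_br x (y + z) = borel_br x y + borel_br x z"
      by (rule poly_mapping_eqI) (simp add: lookup_borel_br lookup_add algebra_simps)
    show "borel_br (pm_scale c x) y = pm_scale c (borel_br x y)" for c
      by (rule poly_mapping_eqI) (simp add: lookup_borel_br lookup_pm_scale algebra_simps)
    show "borel_br x (pm_scale c y) = pm_scale c (borel_br x y)" for c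
      by (rule poly_mapping_eqI) (simp add: lookup_borel_br lookup_pm_scale algebra_simps)
    show "borel_br x x = 0"
      by (rule poly_mapping_eqI) (simp add: lookup_borel_br)
    show "borel_br x (borel_br y z) + borel_br y (borel_br z x) + borel_br z (borel_br x y) = 0"
      by (rule poly_mapping_eqI) (simp add: lookup_borel_br lookup_add algebra_simps)
  qed
qed

lemma sum_lessThan_5: "(\<Sum>i<(5::nat). f i) = f 0 + f 1 + f 2 + f 3 + (f 4 :: 'b::comm_monoid_add)"
  by (simp add: eval_nat_numeral add.assoc)

text \<open>The Pfaffian of an alternating 4 x 4 matrix; the factor 8 is
  \<open>2 ^ 2 * fact 2\<close>.\<close>

lemma mixpf_2:
  fixes B :: "nat \<Rightarrow> nat \<Rightarrow> 'r::comm_ring_1"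
  assumes anti: "\<And>j k. B j k = - B k j"
  shows "mixpf 2 0 B L = 8 * (B 0 1 * B 2 3 - B 0 2 * B 1 3 + B 0 3 * B 1 2)"
proof -
  have S: "{..<2 * 2 + 0} = insert 0 (insert 1 (insert 2 (insert (3::nat) {})))" by auto
  have a: "B (Suc 0) 0 = - B 0 (Suc 0)" "B (Suc (Suc 0)) 0 = - B 0 (Suc (Suc 0))"
    "B (Suc (Suc (Suc 0))) 0 = - B 0 (Suc (Suc (Suc 0)))"
    "B (Suc (Suc 0)) (Suc 0) = - B (Suc 0) (Suc (Suc 0))"
    "B (Suc (Suc (Suc 0))) (Suc 0) = - B (Suc 0) (Suc (Suc (Suc 0)))"
    "B (Suc (Suc (Suc 0))) (Suc (Suc 0)) = - B (Suc (Suc 0)) (Suc (Suc (Suc 0)))"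
    by (rule anti)+
  show ?thesis
    unfolding mixpf_def S
    by (simp add: sum_over_permutations_insert eval_nat_numeral sign_compose permutation_compose
        permutation_swap_id sign_swap_id transpose_def a algebra_simps)
qed

lemma (in lie_algebra) lie_algebra_subalgebra:
  assumes H: "lie_subalgebra s br G H"
  shows "lie_algebra s br H"
proof unfold_locales
  note HD = lie_subalgebraD[OF H]
  have G: "x \<in> G" if "x \<in> H" for x using that HD(2) by blast
  show "subspace H" by (rule HD(1))
  obtain B where B: "B \<subseteq> H" "independent B" "H \<subseteq> span B" using basis_exists[of H] by metis
  then show "\<exists>B. finite B \<and> span B = H"
    using independent_card_le(1)[OF HD(4) B(2,1)] span_subspace[OF B(1,3) HD(1)] by blast
  fix x y z assume x: "x \<in> H" and y: "y \<in> H"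
  show "br x y \<in> H" using HD(3) x y .
  show "br x x = 0" using br_self G x by blast
  show "br (s c x) y = s c (br x y)" "br x (s c y) = s c (br x y)" for c
    using br_scale_left br_scale_right G x y by blast+
  assume z: "z \<in> H"
  show "br (x + y) z = br x z + br y z" using br_add_left G x y z by blast
  show "br x (y + z) = br x y + br x z" using br_add_right G x y z by blast
  show "br x (br y z) + br y (br z x) + br z (br x y) = 0" using jacobi G x y z by blast
qed

definition borel_functional :: "(nat \<Rightarrow> 'k::field) \<Rightarrow> (nat \<Rightarrow>\<^sub>0 'k) \<Rightarrow> 'k" where
  "borel_functional c v = (\<Sum>i<5. Poly_Mapping.lookup v i * c i)"

lemma linfun_borel_functional: "linfun pm_scale V (borel_functional c)"
  by (simp add: linfun_def borel_functional_def lookup_add lookup_pm_scale sum_lessThan_5 algebra_simps)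

lemma borel_functional_br:
  "borel_functional c (borel_br u v) =
    (let a = Poly_Mapping.lookup u; b = Poly_Mapping.lookup v in
     2 * (a 0 * b 1 - a 1 * b 0) * c 1 + (a 1 * b 4 - a 4 * b 1) * c 2 +
     (2 * (a 0 * b 3 - a 3 * b 0) - 2 * (a 1 * b 2 - a 2 * b 1)) * c 3 - 2 * (a 0 * b 4 - a 4 * b 0) * c 4)"
  by (simp add: borel_functional_def sum_lessThan_5 lookup_borel_br Let_def algebra_simps)

text \<open>Half the differential at \<open>c\<close> of the invariant
  \<open>H\<^sup>2 + 4 E F\<close>; differentials of invariants stabilize the functional.\<close>

definition borel_stab_vec :: "(nat \<Rightarrow> 'k::field) \<Rightarrow> (nat \<Rightarrow>\<^sub>0 'k)" where
  "borel_stab_vec c = Poly_Mapping.single 2 (c 2) + Poly_Mapping.single 3 (2 * c 4) + Poly_Mapping.single 4 (2 * c 3)"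

lemma lookup_borel_stab_vec:
  "Poly_Mapping.lookup (borel_stab_vec c) i = (if i = 2 then c 2 else if i = 3 then 2 * c 4 else if i = 4 then 2 * c 3 else 0)"
  by (simp add: borel_stab_vec_def lookup_add lookup_single when_def)

lemma borel_stab_vec: "borel_stab_vec c \<in> stabilizer borel_br borel_alg (borel_functional c)"
  by (auto simp: stabilizer_def supp_space_def lookup_borel_stab_vec borel_functional_br Let_def algebra_simps)

lemma unit_vec_supp_space: "i \<in> K \<Longrightarrow> unit_vec i \<in> supp_space K"
  by (auto simp: supp_space_def lookup_single when_def)

lemma dim_stabilizer_borel_le:
  fixes c :: "nat \<Rightarrow> 'k::field_char_0"
  assumes c: "c 3 \<noteq> 0"
  shows "vector_space.dim pm_scale (stabilizer borel_br borel_alg (borel_functional c)) \<le> 1"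
proof -
  interpret vector_space pm_scale by (rule vector_space_pm_scale)
  have "x \<in> span {borel_stab_vec c}" if x: "x \<in> stabilizer borel_br borel_alg (borel_functional c)" for x
  proof -
    let ?a = "Poly_Mapping.lookup x"
    have xG: "x \<in> borel_alg" and eq: "borel_functional c (borel_br x (unit_vec i)) = 0" if "i < 5" for i
      using x that by (auto simp: stabilizer_def intro: unit_vec_supp_space)
    have 0: "?a 0 = 0" using eq[of 3] c by (simp add: borel_functional_br Let_def lookup_single when_def)
    have 1: "?a 1 = 0" using eq[of 2] c by (simp add: borel_functional_br Let_def lookup_single when_def)
    have "2 * (c 4 * ?a 4 - c 3 * ?a 3) = 0"
      using eq[of 0] 0 1 by (simp add: borel_functional_br Let_def lookup_single when_def algebra_simps del: single_one)
    then have 3: "c 3 * ?a 3 = c 4 * ?a 4" by simp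
    have 2: "2 * c 3 * ?a 2 = c 2 * ?a 4"
      using eq[of 1] 0 1 by (simp add: borel_functional_br Let_def lookup_single when_def algebra_simps)
    have "x = pm_scale (?a 4 / (2 * c 3)) (borel_stab_vec c)"
    proof (rule poly_mapping_eqI)
      fix i
      have "?a i = 0" if "i \<ge> 5" using that xG[of 0] by (auto simp: supp_space_def)
      then consider "i = 0" | "i = 1" | "i = 2" | "i = 3" | "i = 4" | "i \<ge> 5" "?a i = 0" by linarith
      then show "?a i = Poly_Mapping.lookup (pm_scale (?a 4 / (2 * c 3)) (borel_stab_vec c)) i"
        by cases (use 0 1 2 3 c in \<open>simp_all add: lookup_pm_scale lookup_borel_stab_vec field_simps\<close>)
    qed
    then show ?thesis by (metis span_base span_scale singletonI)
  qed
  then have "stabilizer borel_br borel_alg (borel_functional c) \<subseteq> span {borel_stab_vec c}" by blast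
  then have "dim (stabilizer borel_br borel_alg (borel_functional c)) \<le> card {borel_stab_vec c}"
    by (rule dim_le_card) simp
  then show ?thesis by simp
qed

lemma borel_locale:
  "lie_algebra_basis_closed pm_scale borel_br (borel_alg :: (nat \<Rightarrow>\<^sub>0 'k::{alg_closed_field, field_char_0}) set) borel_basis"
  unfolding lie_algebra_basis_closed_def lie_algebra_basis_def lie_algebra_char_0_def lie_algebra_basis_axioms_def
  by (intro conjI lie_algebra_borel ordered_basis_borel)

text \<open>The dimension 5 minus the index is even, so an index at most 1 must be 1.\<close>

lemma index_borel:
  "lie_index pm_scale borel_br (borel_alg :: (nat \<Rightarrow>\<^sub>0 'k::{alg_closed_field, field_char_0}) set) = 1"
proof -
  interpret lie_algebra_basis_closed pm_scale borel_br "borel_alg :: (nat \<Rightarrow>\<^sub>0 'k) set" borel_basis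
    by (rule borel_locale)
  let ?c = "\<lambda>i::nat. 1 :: 'k"
  have "lie_index pm_scale borel_br (borel_alg :: (nat \<Rightarrow>\<^sub>0 'k) set) \<le> 1"
    using lie_index_le[OF lie_subalgebra_G linfun_borel_functional[of _ ?c]] dim_stabilizer_borel_le[of ?c] by simp
  moreover obtain m where "dim (borel_alg :: (nat \<Rightarrow>\<^sub>0 'k) set) = lie_index pm_scale borel_br (borel_alg :: (nat \<Rightarrow>\<^sub>0 'k) set) + 2 * m"
    using dim_index_even[OF lie_subalgebra_G] by blast
  ultimately show ?thesis by (simp add: dim_supp_space) presburger
qed

text \<open>The functionals \<open>?d 3\<close>, \<open>?d 2\<close> and \<open>?d 4\<close> are
  regular since their coordinate at \<open>E\<close> is 1. Their stabilizing vectors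
  \<open>2F\<close>, \<open>H + 2F\<close> and \<open>2E + 2F\<close> span the abelian
  ideal.\<close>

lemma semiradical_borel:
  "supp_space {2, 3, 4} \<subseteq> frobenius_semiradical pm_scale borel_br (borel_alg :: (nat \<Rightarrow>\<^sub>0 'k::{alg_closed_field, field_char_0}) set)"
proof -
  interpret lie_algebra_basis_closed pm_scale borel_br "borel_alg :: (nat \<Rightarrow>\<^sub>0 'k) set" borel_basis
    by (rule borel_locale)
  have v: "borel_stab_vec c \<in> FG" if c: "c 3 \<noteq> 0" for c :: "nat \<Rightarrow> 'k"
  proof -
    have "dim (stabilizer borel_br borel_alg (borel_functional c)) = lie_index pm_scale borel_br (borel_alg :: (nat \<Rightarrow>\<^sub>0 'k) set)"
      using dim_stabilizer_borel_le[of c, OF c] lie_index_le[OF lie_subalgebra_G linfun_borel_functional[of _ c]] index_borel[where 'k='k]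
      by simp
    then show ?thesis
      using stabilizer_subset_semiradical[OF linfun_borel_functional] borel_stab_vec by blast
  qed
  let ?d = "\<lambda>j i::nat. (if i = 3 \<or> i = j then 1 else 0) :: 'k"
  have 4: "unit_vec 4 \<in> FG"
  proof -
    have "pm_scale (1 / 2) (borel_stab_vec (?d 3)) \<in> FG" by (intro subspace_scale subspace_semiradical v) simp
    also have "pm_scale (1 / 2) (borel_stab_vec (?d 3)) = unit_vec 4"
      by (rule poly_mapping_eqI) (simp add: lookup_pm_scale lookup_borel_stab_vec lookup_single when_def)
    finally show ?thesis .
  qed
  have 2: "unit_vec 2 \<in> FG"
  proof -
    have "borel_stab_vec (?d 2) - pm_scale 2 (unit_vec 4) \<in> FG"
      by (intro subspace_diff subspace_scale subspace_semiradical v 4) simp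
    also have "borel_stab_vec (?d 2) - pm_scale 2 (unit_vec 4) = unit_vec 2"
      by (rule poly_mapping_eqI) (simp add: lookup_minus lookup_pm_scale lookup_borel_stab_vec lookup_single when_def)
    finally show ?thesis .
  qed
  have 3: "unit_vec 3 \<in> FG"
  proof -
    have "pm_scale (1 / 2) (borel_stab_vec (?d 4) - pm_scale 2 (unit_vec 4)) \<in> FG"
      by (intro subspace_diff subspace_scale subspace_semiradical v 4) simp
    also have "pm_scale (1 / 2) (borel_stab_vec (?d 4) - pm_scale 2 (unit_vec 4)) = unit_vec 3"
      by (rule poly_mapping_eqI) (simp add: lookup_minus lookup_pm_scale lookup_borel_stab_vec lookup_single when_def)
    finally show ?thesis .
  qed
  have "span (unit_vec ` {2, 3, 4}) \<subseteq> FG"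
    using 2 3 4 by (intro span_minimal subspace_semiradical) auto
  then show ?thesis using basis_supp_space(2)[of "{2, 3, 4::nat}", where 'k='k] by simp
qed

text \<open>The commutative subalgebra spanned by \<open>H, E, F\<close> has the value 3.
  Monotonicity of \<open>lie_c\<close>, applied inside the semi-radical, gives the lower
  bound.\<close>

lemma lie_c_borel:
  fixes G :: "(nat \<Rightarrow>\<^sub>0 'k::{alg_closed_field, field_char_0}) set"
  defines "G \<equiv> borel_alg"
  shows "lie_c pm_scale borel_br G = 3" "lie_c pm_scale borel_br (frobenius_semiradical pm_scale borel_br G) \<ge> 3"
proof -
  interpret lie_algebra_basis_closed pm_scale borel_br G borel_basis
    unfolding G_def by (rule borel_locale)
  show "lie_c pm_scale borel_br G = 3"
    by (simp add: lie_c_def G_def dim_supp_space index_borel)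
  interpret F: lie_algebra_char_0 pm_scale borel_br FG
    unfolding lie_algebra_char_0_def by (rule lie_algebra_subalgebra[OF lie_subalgebra_semiradical])
  let ?H = "supp_space {2, 3, 4} :: (nat \<Rightarrow>\<^sub>0 'k) set"
  have c: "borel_br x y = 0" if "x \<in> ?H" "y \<in> ?H" for x y
    using that by (intro poly_mapping_eqI) (simp add: lookup_borel_br supp_space_def)
  have H: "lie_subalgebra pm_scale borel_br FG ?H"
    using semiradical_borel subspace_supp_space subspace_0[OF subspace_supp_space] c
    by (auto simp: lie_subalgebra_def G_def)
  have "lie_c pm_scale borel_br ?H = real (dim ?H)"
    using c by (intro F.lie_c_commutative[OF H]) (simp add: lie_commutative_def)
  then show "lie_c pm_scale borel_br FG \<ge> 3"
    using F.lie_c_subalgebra_le[OF H] by (simp add: dim_supp_space)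
qed

lemma lin_form_borel:
  assumes v: "v \<in> (borel_alg :: (nat \<Rightarrow>\<^sub>0 'k::{alg_closed_field, field_char_0}) set)"
  shows "lin_form pm_scale borel_basis v = (\<Sum>i<5. mconst (Poly_Mapping.lookup v i) * mvar i)"
proof -
  interpret lie_algebra_basis_closed pm_scale borel_br "borel_alg :: (nat \<Rightarrow>\<^sub>0 'k) set" borel_basis
    by (rule borel_locale)
  have "coord i v = Poly_Mapping.lookup v i" if i: "i < 5" for i
  proof -
    have "coord i v = coord i (\<Sum>j<5. pm_scale (Poly_Mapping.lookup v j) (unit_vec j))"
      using supp_space_expand[OF _ v] by simp
    also have "\<dots> = (\<Sum>j<5. Poly_Mapping.lookup v j * coord i (unit_vec j))"
      by (rule linfun_sum[OF subspace_G linfun_coord]) (simp add: unit_vec_supp_space)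
    also have "\<dots> = (\<Sum>j<5. if j = i then Poly_Mapping.lookup v j else 0)"
      using coord_basis i by (intro sum.cong) (auto simp: length_borel_basis nth_borel_basis[symmetric])
    finally show ?thesis using i by simp
  qed
  then show ?thesis by (simp add: lin_form_eq length_borel_basis)
qed

lemma mvar_neq_0: "mvar i \<noteq> (0 :: 'k::comm_ring_1 mpol)"
  by (metis lookup_single_eq lookup_zero mvar_def zero_neq_one)

lemma total_degree_mvar: "total_degree (mvar i :: 'k::comm_ring_1 mpol) = 1"
  by (rule total_degree_homogeneous[OF homogeneous_mvar mvar_neq_0])

lemma irreducible_in_mvar:
  assumes "i < n"
  shows "irreducible_in (mpols_below n) (mvar i :: 'k::field mpol)"
  unfolding irreducible_in_def
proof (intro conjI ballI impI mvar_mpols_below assms mvar_neq_0)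
  show "\<not> unit_in (mpols_below n) (mvar i :: 'k mpol)" by (simp add: unit_in_mpols_below total_degree_mvar)
  fix g h :: "'k mpol" assume gh: "mvar i = g * h"
  then have nz: "g \<noteq> 0" "h \<noteq> 0" using mvar_neq_0[of i, where 'k='k] by auto
  have "total_degree g + total_degree h = 1" using total_degree_mult[OF nz] gh total_degree_mvar[of i, where 'k='k] by simp
  then show "unit_in (mpols_below n) g \<or> unit_in (mpols_below n) h"
    using nz by (auto simp: unit_in_mpols_below)
qed

text \<open>Where \<open>E\<close> vanishes, the stabilizer contains the plane of \<open>H\<close>
  and \<open>E\<close>, so the functional is singular and every Pfaffian is divisible by the prime
  \<open>E\<close>. Conversely, two of the Pfaffians are multiples of \<open>E\<^sup>2\<close> and
  \<open>E H\<close>, whose common divisors divide \<open>E\<close>.\<close>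

lemma fundamental_borel:
  "fundamental_semi_invariant pm_scale borel_br (borel_alg :: (nat \<Rightarrow>\<^sub>0 'k::{alg_closed_field, field_char_0}) set) borel_basis (mvar 3)"
proof -
  interpret lie_algebra_basis_closed pm_scale borel_br "borel_alg :: (nat \<Rightarrow>\<^sub>0 'k) set" borel_basis
    by (rule borel_locale)
  let ?R = "mpols_below 5 :: 'k mpol set"
  let ?E = "mvar 3 :: 'k mpol" and ?H = "mvar 2 :: 'k mpol"
  have len: "length (borel_basis :: (nat \<Rightarrow>\<^sub>0 'k) list) = 5" by (rule length_borel_basis)
  have m: "dim (borel_alg :: (nat \<Rightarrow>\<^sub>0 'k) set) = lie_index pm_scale borel_br (borel_alg :: (nat \<Rightarrow>\<^sub>0 'k) set) + 2 * 2"
    by (simp add: dim_supp_space index_borel)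
  note pf = pf_poly_dvd_iff[OF m, unfolded len]
  have irr: "irreducible_in ?R ?E" by (rule irreducible_in_mvar) simp
  have prm: "prime_in ?R ?E" by (rule irreducible_imp_prime_in[OF factorial_mpols_below irr])
  have dvd: "?E dvd pf_poly 2 J" if J: "J \<subseteq> {..<5}" "card J = 2 * 2" for J
  proof (rule hypersurface_nullstellensatz[OF irr])
    show "pf_poly 2 J \<in> ?R" using pf_poly_mpols_below[of 2 J] by (simp add: len)
    fix v assume "mpol_eval id v ?E = 0"
    then have v3: "v 3 = 0" by (simp add: mpol_eval_mvar[OF ring_hom_fun_id])
    have p: "point v x = borel_functional v x" if "x \<in> borel_alg" for x
      using that by (simp add: eval_lin_form[symmetric] lin_form_borel borel_functional_def ring_hom_fun_sum[OF eval_hom]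
          ring_hom_funD[OF eval_hom] mpol_eval_mconst[OF ring_hom_fun_id] mpol_eval_mvar[OF ring_hom_fun_id])
    then have st: "stabilizer borel_br borel_alg (point v) = stabilizer borel_br borel_alg (borel_functional v)"
      by (rule stabilizer_cong[OF _ lie_subalgebra_G])
    have "supp_space {2, 3} \<subseteq> stabilizer borel_br borel_alg (borel_functional v)"
      using v3 by (auto simp: stabilizer_def supp_space_def borel_functional_br Let_def)
    then have "dim (supp_space {2, 3::nat} :: (nat \<Rightarrow>\<^sub>0 'k) set) \<le> dim (stabilizer borel_br borel_alg (borel_functional v))"
      by (rule dim_mono_fin[rotated]) (rule fin_dim_subset[OF fin_dim_G], auto simp: stabilizer_def)
    then have "dim (stabilizer borel_br borel_alg (point v)) \<noteq> lie_index pm_scale borel_br (borel_alg :: (nat \<Rightarrow>\<^sub>0 'k) set)"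
      by (simp add: st dim_supp_space index_borel)
    then show "mpol_eval id v (pf_poly 2 J) = 0"
      using regular_iff_pf_poly[OF m, of v] J by (simp add: len)
  qed
  have br: "borel_br x y \<in> borel_alg" for x y :: "nat \<Rightarrow>\<^sub>0 'k"
    by (auto simp: supp_space_def lookup_borel_br)
  note lf = lin_form_borel[OF br] 
  have neg: "mconst (- c) = (- mconst c :: 'k mpol)" for c
    using ring_hom_fun_diff[OF ring_hom_fun_mconst, of 0 c] by (simp add: ring_hom_funD(1)[OF ring_hom_fun_mconst])
  have num: "mconst (numeral w) = (numeral w :: 'k mpol)" "mconst 1 = (1 :: 'k mpol)" for w
    by (simp_all add: mconst_def)
  have anti: "lin_form pm_scale borel_basis (borel_br x y) = - lin_form pm_scale borel_basis (borel_br y x)" for x y :: "nat \<Rightarrow>\<^sub>0 'k"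
  proof -
    have "Poly_Mapping.lookup (borel_br x y) i = - Poly_Mapping.lookup (borel_br y x) i" for i
      by (simp add: lookup_borel_br algebra_simps)
    then show ?thesis by (simp add: lf neg sum_negf)
  qed
  have pf2: "pf_poly 2 J = 8 * (M 0 1 * M 2 3 - M 0 2 * M 1 3 + M 0 3 * M 1 2)"
    if "M = (\<lambda>a b. lin_form pm_scale borel_basis (borel_br (minor_vec J a) (minor_vec J b)))" for J M
    unfolding pf_poly_def that by (rule mixpf_2[OF anti])
  have s1: "sorted_list_of_set {0, 1, 2, 3::nat} = [0, 1, 2, 3]"
    using sorted_list_of_set.idem_if_sorted_distinct[of "[0, 1, 2, 3::nat]"] by simp
  have s2: "sorted_list_of_set {0, 1, 3, 4::nat} = [0, 1, 3, 4]"
    using sorted_list_of_set.idem_if_sorted_distinct[of "[0, 1, 3, 4::nat]"] by simp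
  have 0: "mconst 0 = (0 :: 'k mpol)" by (rule ring_hom_funD(1)[OF ring_hom_fun_mconst])
  have nb: "borel_basis ! 0 = unit_vec 0" "borel_basis ! Suc 0 = unit_vec 1" "borel_basis ! 2 = unit_vec 2"
    "borel_basis ! 3 = unit_vec 3" "borel_basis ! 4 = unit_vec 4"
    by (simp_all add: nth_borel_basis del: single_one)
  have pf1: "pf_poly 2 {0, 1, 2, 3} = mconst (- 32) * (?E * ?E)"
  proof -
    have "pf_poly 2 {0, 1, 2, 3} = 8 * - (mconst 2 * ?E * (mconst 2 * ?E))"
      unfolding pf2[OF refl] minor_vec_def s1
      by (simp add: nb lf sum_lessThan_5 lookup_borel_br lookup_single when_def 0 neg mult_ac del: single_one)
    then show ?thesis by (simp add: neg num algebra_simps)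
  qed
  have pf3: "pf_poly 2 {0, 1, 3, 4} = mconst (- 16) * (?E * ?H)"
  proof -
    have "pf_poly 2 {0, 1, 3, 4} = 8 * - (mconst 2 * ?E * (mconst 1 * ?H))"
      unfolding pf2[OF refl] minor_vec_def s2
      by (simp add: nb lf sum_lessThan_5 lookup_borel_br lookup_single when_def 0 neg mult_ac del: single_one)
    then show ?thesis by (simp add: neg num algebra_simps)
  qed
  have "q dvd ?E" if q: "q \<in> ?R" "\<And>J. J \<subseteq> {..<5} \<Longrightarrow> card J = 2 * 2 \<Longrightarrow> q dvd pf_poly 2 J" for q
  proof -
    have cancel: "q dvd f" if "q dvd mconst c * f" "c \<noteq> 0" for c and f :: "'k mpol"
    proof -
      have "q dvd mconst (1 / c) * (mconst c * f)" using that(1) by (rule dvd_mult)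
      also have "mconst (1 / c) * (mconst c * f) = f"
        using that(2) by (simp add: mult.assoc[symmetric] ring_hom_funD[OF ring_hom_fun_mconst, symmetric])
      finally show ?thesis .
    qed
    have "q dvd ?E * ?E"
      by (rule cancel[of "- 32"], unfold pf1[symmetric], rule q(2)) simp_all
    have "q dvd ?E * ?H"
      by (rule cancel[of "- 16"], unfold pf3[symmetric], rule q(2)) simp_all
    obtain r where r: "?E * ?E = q * r" using \<open>q dvd ?E * ?E\<close> by (elim dvdE)
    obtain t where t: "?E * ?H = q * t" using \<open>q dvd ?E * ?H\<close> by (elim dvdE)
    have qnz: "q \<noteq> 0" "r \<noteq> 0" using r mvar_neq_0[of 3, where 'k='k] by auto
    have EE: "?E * ?E \<in> ?R" by (intro subring_setD(5)[OF subring_mpols_below] mvar_mpols_below) simp_all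
    have rR: "r \<in> ?R" using mpols_below_factor[of r q 5] EE r qnz by (simp add: mult.commute)
    \<comment> \<open>With \<open>E * E = q * r\<close> and \<open>E * H = q * t\<close> one gets
      \<open>r * H = E * t\<close>. Since \<open>E\<close> is prime and does not divide
      \<open>H\<close>, it divides \<open>r\<close> and cancels against one factor of
      \<open>E * E\<close>.\<close>
    have "q * (r * ?H) = q * (?E * t)"
      using r t by (metis (no_types, lifting) mult.assoc mult.left_commute)
    then have rH: "r * ?H = ?E * t" using qnz by simp
    have HR: "?H \<in> ?R" by (rule mvar_mpols_below) simp
    have "dvd_in ?R ?E (r * ?H)"
      using rH subring_setD(5)[OF subring_mpols_below rR HR] by (simp add: dvd_in_mpols_below)
    then have "dvd_in ?R ?E r \<or> dvd_in ?R ?E ?H" using prm rR HR by (simp add: prime_in_def)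
    moreover have "\<not> dvd_in ?R ?E ?H"
    proof
      assume "dvd_in ?R ?E ?H"
      then obtain g where "?H = ?E * g" by (auto simp: dvd_in_def)
      then have "mpol_eval id (\<lambda>i. if i = 2 then 1 else 0) ?H = mpol_eval id (\<lambda>i. if i = 2 then 1 else 0) (?E * g)" by simp
      then show False by (simp add: ring_hom_funD[OF eval_hom] mpol_eval_mvar[OF ring_hom_fun_id])
    qed
    ultimately obtain r' where "r = ?E * r'" by (auto simp: dvd_in_def)
    then have "?E * ?E = ?E * (q * r')" using r by (simp add: mult_ac)
    then have "?E = q * r'" using mvar_neq_0[of 3, where 'k='k] by simp
    then show ?thesis by simp
  qed
  then show ?thesis
    unfolding fundamental_semi_invariant_def sym_alg_G pf
    using dvd by (auto simp: len mvar_mpols_below)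
qed

section \<open>Partial derivatives and the derivation property of the Poisson bracket\<close>

lemma lookup_mpol_deriv:
  "Poly_Mapping.lookup (mpol_deriv i f) m =
     of_nat (Poly_Mapping.lookup m i + 1) * Poly_Mapping.lookup f (m + Poly_Mapping.single i 1)"
proof -
  have "Poly_Mapping.lookup (Poly_Mapping.single (m' - Poly_Mapping.single i 1)
        (of_nat (Poly_Mapping.lookup m' i) * Poly_Mapping.lookup f m')) m =
      (if m' = m + Poly_Mapping.single i 1 then of_nat (Poly_Mapping.lookup m i + 1) * Poly_Mapping.lookup f (m + Poly_Mapping.single i 1) else 0)" for m'
  proof (cases "Poly_Mapping.lookup m' i = 0")
    case True
    then have "m' \<noteq> m + Poly_Mapping.single i 1" by (auto simp: lookup_add)
    then show ?thesis using True by simp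
  next
    case False
    have "m' - Poly_Mapping.single i 1 = m \<longleftrightarrow> m' = m + Poly_Mapping.single i 1"
      using False by (force simp: poly_mapping_eq_iff fun_eq_iff lookup_minus lookup_add lookup_single when_def)
    then show ?thesis by (auto simp: lookup_single lookup_add when_def)
  qed
  then have "Poly_Mapping.lookup (mpol_deriv i f) m = (\<Sum>m'\<in>Poly_Mapping.keys f.
      if m' = m + Poly_Mapping.single i 1 then of_nat (Poly_Mapping.lookup m i + 1) * Poly_Mapping.lookup f (m + Poly_Mapping.single i 1) else 0)"
    by (simp add: mpol_deriv_def lookup_sum)
  then show ?thesis by (simp add: not_in_keys_iff_lookup_eq_zero)
qed

lemma mpol_deriv_add: "mpol_deriv i (f + g) = mpol_deriv i f + mpol_deriv i g"
  by (rule poly_mapping_eqI) (simp add: lookup_mpol_deriv lookup_add algebra_simps)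

lemma mpol_deriv_zero: "mpol_deriv i 0 = 0"
  by (simp add: mpol_deriv_def)

lemma mpol_deriv_sum: "mpol_deriv i (sum f I) = (\<Sum>j\<in>I. mpol_deriv i (f j))"
  by (induction I rule: infinite_finite_induct) (simp_all add: mpol_deriv_zero mpol_deriv_add)

lemma mpol_deriv_single:
  "mpol_deriv i (Poly_Mapping.single m c) =
     Poly_Mapping.single (m - Poly_Mapping.single i 1) (of_nat (Poly_Mapping.lookup m i) * c)"
  by (cases "c = 0") (simp_all add: mpol_deriv_def)

lemma mpol_deriv_mconst: "mpol_deriv i (mconst c) = 0"
  by (simp add: mconst_def mpol_deriv_single)

lemma mpol_deriv_mvar: "mpol_deriv i (mvar j) = (if i = j then 1 else 0)"
  by (auto simp: mvar_def mpol_deriv_single lookup_single when_def)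

text \<open>The two sides could differ only where the subtraction of exponents is truncated, and
  there the factor \<open>of_nat\<close> is zero.\<close>

lemma mpol_deriv_mult_single:
  "mpol_deriv i (Poly_Mapping.single a c * Poly_Mapping.single b d) =
     mpol_deriv i (Poly_Mapping.single a c) * Poly_Mapping.single b d +
     Poly_Mapping.single a c * mpol_deriv i (Poly_Mapping.single b d)"
proof -
  let ?e = "Poly_Mapping.single i (1::nat)"
  have 1: "Poly_Mapping.single (a - ?e + b) (of_nat (Poly_Mapping.lookup a i) * c * d) =
      Poly_Mapping.single (a + b - ?e) (of_nat (Poly_Mapping.lookup a i) * c * d)"
  proof (cases "Poly_Mapping.lookup a i = 0")
    case False
    then have "a - ?e + b = a + b - ?e"
      by (intro poly_mapping_eqI) (auto simp: lookup_minus lookup_add lookup_single when_def)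
    then show ?thesis by simp
  qed simp
  have 2: "Poly_Mapping.single (a + (b - ?e)) (c * (of_nat (Poly_Mapping.lookup b i) * d)) =
      Poly_Mapping.single (a + b - ?e) (c * (of_nat (Poly_Mapping.lookup b i) * d))"
  proof (cases "Poly_Mapping.lookup b i = 0")
    case False
    then have "a + (b - ?e) = a + b - ?e"
      by (intro poly_mapping_eqI) (auto simp: lookup_minus lookup_add lookup_single when_def)
    then show ?thesis by simp
  qed simp
  show ?thesis
    unfolding mult_single mpol_deriv_single 1 2 single_add[symmetric]
    by (simp add: lookup_add algebra_simps)
qed

lemma mpol_deriv_mult: "mpol_deriv i (f * g) = mpol_deriv i f * g + f * mpol_deriv i g"
proof -
  let ?s = "\<lambda>f m. Poly_Mapping.single m (Poly_Mapping.lookup f m)"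
  let ?f = "\<Sum>m\<in>Poly_Mapping.keys f. ?s f m" and ?g = "\<Sum>m\<in>Poly_Mapping.keys g. ?s g m"
  have "mpol_deriv i (?f * ?g) = mpol_deriv i ?f * ?g + ?f * mpol_deriv i ?g"
    by (simp add: sum_product mpol_deriv_sum mpol_deriv_mult_single sum.distrib)
  then show ?thesis by (simp only: sum_single_lookup)
qed

lemma lookup_mvar_mult:
  "Poly_Mapping.lookup (mvar i * g) m =
    (if Poly_Mapping.lookup m i = 0 then 0 else Poly_Mapping.lookup g (m - Poly_Mapping.single i 1))"
proof -
  let ?e = "Poly_Mapping.single i (1::nat)"
  have eq: "?e + m' = m \<longleftrightarrow> Poly_Mapping.lookup m i \<noteq> 0 \<and> m' = m - ?e" for m'
    by (force simp: poly_mapping_eq_iff fun_eq_iff lookup_minus lookup_add lookup_single when_def)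
  have e: "mvar i * g = (\<Sum>m'\<in>Poly_Mapping.keys g. Poly_Mapping.single (?e + m') (Poly_Mapping.lookup g m'))"
    by (subst sum_single_lookup[of g, symmetric]) (simp add: mvar_def sum_distrib_left mult_single)
  have "Poly_Mapping.lookup (mvar i * g) m =
      (\<Sum>m'\<in>Poly_Mapping.keys g. if m' = m - ?e then (if Poly_Mapping.lookup m i = 0 then 0 else Poly_Mapping.lookup g (m - ?e)) else 0)"
    unfolding e lookup_sum
    by (intro sum.cong refl) (auto simp: lookup_single when_def eq[unfolded One_nat_def])
  then show ?thesis by (simp add: not_in_keys_iff_lookup_eq_zero)
qed

lemma lookup_mconst_mult: "Poly_Mapping.lookup (mconst c * g) m = c * Poly_Mapping.lookup g m"
proof -
  have "mconst c * g = (\<Sum>m'\<in>Poly_Mapping.keys g. Poly_Mapping.single m' (c * Poly_Mapping.lookup g m'))"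
    by (subst sum_single_lookup[of g, symmetric]) (simp add: mconst_def sum_distrib_left mult_single)
  then have "Poly_Mapping.lookup (mconst c * g) m = (\<Sum>m'\<in>Poly_Mapping.keys g. if m' = m then c * Poly_Mapping.lookup g m else 0)"
    by (simp add: lookup_sum lookup_single when_def)
  then show ?thesis by (simp add: not_in_keys_iff_lookup_eq_zero)
qed

lemma poisson_add_left: "poisson s br xs (f + g) h = poisson s br xs f h + poisson s br xs g h"
  by (simp add: poisson_def mpol_deriv_add algebra_simps sum.distrib)

lemma poisson_mult_left: "poisson s br xs (f * g) h = poisson s br xs f h * g + f * poisson s br xs g h"
  by (simp add: poisson_def mpol_deriv_mult algebra_simps sum.distrib sum_distrib_left)

lemma poisson_mconst_left: "poisson s br xs (mconst c) h = 0"
  by (simp add: poisson_def mpol_deriv_mconst)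

lemma mpol_subalgebra_sym_alg: "mpol_subalgebra (sym_alg s xs W)"
  unfolding mpol_subalgebra_def sym_alg_def by (auto simp: subset_iff)

lemma mpol_subalgebra_poisson_center: "mpol_subalgebra (poisson_center s br G xs)"
  using mpol_subalgebra_sym_alg[of s xs G]
  by (auto simp: mpol_subalgebra_def poisson_center_def poisson_add_left poisson_mult_left poisson_mconst_left subset_iff)

lemma mpol_eval_in_subalgebra:
  assumes A: "mpol_subalgebra A" and f: "\<And>i. i < n \<Longrightarrow> f i \<in> A" and P: "P \<in> mpols_below n"
  shows "mpol_eval mconst f P \<in> A"
proof -
  have c: "mconst c \<in> A" for c using A by (auto simp: mpol_subalgebra_def)
  have "(\<Prod>i\<in>Poly_Mapping.keys m. f i ^ Poly_Mapping.lookup m i) \<in> A" if "m \<in> Poly_Mapping.keys P" for m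
  proof (rule mpol_subalgebra_prod[OF A])
    fix i assume "i \<in> Poly_Mapping.keys m"
    then have "f i \<in> A" using that P f by (auto simp: mpols_below_def)
    then have "(\<Prod>_<Poly_Mapping.lookup m i. f i) \<in> A" by (intro mpol_subalgebra_prod[OF A])
    then show "f i ^ Poly_Mapping.lookup m i \<in> A" by simp
  qed
  then show ?thesis unfolding mpol_eval_def
    using A c by (intro mpol_subalgebra_sum[OF A]) (auto simp: mpol_subalgebra_def)
qed

lemma eval_mpol_eval: "mpol_eval id v (mpol_eval mconst f P) = mpol_eval id (\<lambda>i. mpol_eval id v (f i)) P"
  by (simp add: mpol_eval_def[of mconst] ring_hom_fun_sum[OF eval_hom] ring_hom_fun_prod[OF eval_hom]
      ring_hom_funD[OF eval_hom] ring_hom_fun_power[OF eval_hom] mpol_eval_mconst[OF ring_hom_fun_id])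
     (simp add: mpol_eval_def)

section \<open>The Poisson center of the example\<close>

text \<open>The exponent of the monomial \<open>H\<^sup>a (E F)\<^sup>b\<close>.\<close>

definition inv_mon :: "nat \<Rightarrow> nat \<Rightarrow> (nat \<Rightarrow>\<^sub>0 nat)" where
  "inv_mon a b = Poly_Mapping.single 2 a + Poly_Mapping.single 3 b + Poly_Mapping.single 4 b"

lemma lookup_inv_mon:
  "Poly_Mapping.lookup (inv_mon a b) i = (if i = 2 then a else if i = 3 \<or> i = 4 then b else 0)"
  by (simp add: inv_mon_def lookup_add lookup_single when_def)

lemma structure_matrix_borel:
  assumes "i < 5" "j < 5"
  shows "structure_matrix pm_scale borel_br (borel_basis :: (nat \<Rightarrow>\<^sub>0 'k::{alg_closed_field, field_char_0}) list) i j =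
    (\<Sum>k<5. mconst (Poly_Mapping.lookup (borel_br (unit_vec i) (unit_vec j)) k) * mvar k)"
  unfolding structure_matrix_def nth_borel_basis[OF assms(1)] nth_borel_basis[OF assms(2)]
  by (rule lin_form_borel) (auto simp: supp_space_def lookup_borel_br)

lemma poisson_borel_mvar:
  fixes f :: "'k::{alg_closed_field, field_char_0} mpol"
  assumes "j < 5"
  shows "poisson pm_scale borel_br borel_basis f (mvar j) =
    (\<Sum>i<5. (\<Sum>k<5. mconst (Poly_Mapping.lookup (borel_br (unit_vec i) (unit_vec j)) k) * mvar k) * mpol_deriv i f)"
proof -
  have "poisson pm_scale borel_br borel_basis f (mvar j) =
      (\<Sum>i<5. \<Sum>l<5. if l = j then structure_matrix pm_scale borel_br borel_basis i j * mpol_deriv i f else 0)"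
    unfolding poisson_def length_borel_basis by (intro sum.cong refl) (simp add: mpol_deriv_mvar)
  then show ?thesis using assms by (simp add: structure_matrix_borel)
qed

lemma sym_alg_borel: "sym_alg pm_scale borel_basis (borel_alg :: (nat \<Rightarrow>\<^sub>0 'k::field) set) = mpols_below 5"
  using vector_space.sym_alg_eq_mpols_below[OF vector_space_pm_scale ordered_basis_borel, where 'a='k]
  by (simp add: length_borel_basis)

context
  fixes f :: "'k::{alg_closed_field, field_char_0} mpol"
  assumes f: "f \<in> poisson_center pm_scale borel_br borel_alg borel_basis"
begin

lemma center_mpols_below: "f \<in> mpols_below 5"
  using f by (simp add: poisson_center_def sym_alg_borel)

lemma center_poisson_mvar: "j < 5 \<Longrightarrow> poisson pm_scale borel_br borel_basis f (mvar j) = 0"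
  using f by (simp add: poisson_center_def sym_alg_borel mvar_mpols_below)

text \<open>The brackets with \<open>E\<close> and \<open>H\<close> show that \<open>f\<close> does
  not depend on \<open>h\<close> and \<open>e\<close>. What remains of the brackets with
  \<open>h\<close> and \<open>e\<close> are the last two equations.\<close>

lemma center_equations:
  shows "mpol_deriv 0 f = 0" "mpol_deriv 1 f = 0" "mvar 3 * mpol_deriv 3 f = mvar 4 * mpol_deriv 4 f"
    "mconst 2 * (mvar 3 * mpol_deriv 2 f) = mvar 2 * mpol_deriv 4 f"
proof -
  have 0: "mconst 0 = (0 :: 'k mpol)" "mconst 1 = (1 :: 'k mpol)" "mconst 2 = (2 :: 'k mpol)" by (simp_all add: mconst_def)
  have neg: "mconst (- c) = (- mconst c :: 'k mpol)" for c
    using ring_hom_fun_diff[OF ring_hom_fun_mconst, of 0 c] by (simp add: 0)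
  note eq = center_poisson_mvar[unfolded poisson_borel_mvar sum_lessThan_5]
  have S: "poisson pm_scale borel_br borel_basis f (mvar 3) = 2 * mvar 3 * mpol_deriv 0 f"
    "poisson pm_scale borel_br borel_basis f (mvar 2) = - 2 * mvar 3 * mpol_deriv 1 f"
    "poisson pm_scale borel_br borel_basis f (mvar 0) = - 2 * mvar 1 * mpol_deriv 1 f - 2 * mvar 3 * mpol_deriv 3 f + 2 * mvar 4 * mpol_deriv 4 f"
    "poisson pm_scale borel_br borel_basis f (mvar 1) = 2 * mvar 1 * mpol_deriv 0 f + 2 * mvar 3 * mpol_deriv 2 f - mvar 2 * mpol_deriv 4 f"
    by (simp_all add: poisson_borel_mvar sum_lessThan_5 lookup_borel_br lookup_single when_def 0 neg algebra_simps del: single_one)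
  have two: "(2 :: 'k mpol) \<noteq> 0" by simp
  show d0: "mpol_deriv 0 f = 0" using S(1) center_poisson_mvar[of 3] mvar_neq_0[of 3, where 'k='k] by simp
  show d1: "mpol_deriv 1 f = 0" using S(2) center_poisson_mvar[of 2] mvar_neq_0[of 3, where 'k='k] by simp
  have "2 * (mvar 3 * mpol_deriv 3 f) = 2 * (mvar 4 * mpol_deriv 4 f)"
    using S(3) center_poisson_mvar[of 0] d1 by (simp add: algebra_simps)
  then show "mvar 3 * mpol_deriv 3 f = mvar 4 * mpol_deriv 4 f" using two mult_cancel_left[of "2 :: 'k mpol"] by blast
  show "mconst 2 * (mvar 3 * mpol_deriv 2 f) = mvar 2 * mpol_deriv 4 f"
    using S(4) center_poisson_mvar[of 1] d0 by (simp add: 0 algebra_simps)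
qed

lemma lookup_euler: "Poly_Mapping.lookup (mvar i * mpol_deriv i g) m = of_nat (Poly_Mapping.lookup m i) * Poly_Mapping.lookup (g :: 'k mpol) m"
proof (cases "Poly_Mapping.lookup m i = 0")
  case False
  then have "m - Poly_Mapping.single i 1 + Poly_Mapping.single i 1 = m"
    by (intro poly_mapping_eqI) (auto simp: lookup_minus lookup_add lookup_single when_def)
  then show ?thesis using False
    by (simp add: lookup_mvar_mult lookup_mpol_deriv lookup_minus)
qed (simp add: lookup_mvar_mult)

text \<open>The operator \<open>mvar i * mpol_deriv i\<close> multiplies a monomial by its exponent
  at \<open>i\<close>. Thus the exponents at \<open>h\<close> and \<open>e\<close> vanish and those
  at \<open>E\<close> and \<open>F\<close> coincide.\<close>

lemma center_key:
  assumes m: "Poly_Mapping.lookup f m \<noteq> 0"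
  shows "m = inv_mon (Poly_Mapping.lookup m 2) (Poly_Mapping.lookup m 3)"
proof (rule poly_mapping_eqI)
  fix i
  have 0: "Poly_Mapping.lookup m 0 = 0" "Poly_Mapping.lookup m 1 = 0"
    using lookup_euler[of 0 f m] lookup_euler[of 1 f m] m by (simp_all add: center_equations center_equations(2)[unfolded One_nat_def])
  have "of_nat (Poly_Mapping.lookup m 3) * Poly_Mapping.lookup f m = of_nat (Poly_Mapping.lookup m 4) * Poly_Mapping.lookup f m"
    using lookup_euler[of 3 f m] lookup_euler[of 4 f m] unfolding center_equations(3) by (rule subst)
  then have 34: "Poly_Mapping.lookup m 4 = Poly_Mapping.lookup m 3" using m by simp
  have "Poly_Mapping.lookup m i = 0" if "i \<ge> 5"
    using center_mpols_below m that by (fastforce simp: mpols_below_def in_keys_iff)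
  then consider "i = 0" | "i = 1" | "i = 2" | "i = 3" | "i = 4" | "i \<ge> 5" "Poly_Mapping.lookup m i = 0" by linarith
  then show "Poly_Mapping.lookup m i = Poly_Mapping.lookup (inv_mon (Poly_Mapping.lookup m 2) (Poly_Mapping.lookup m 3)) i"
    by cases (use 0 34 in \<open>simp_all add: lookup_inv_mon\<close>)
qed

text \<open>Coefficients of the fourth equation of \<open>center_equations\<close> at monomials that
  have one more \<open>E\<close> than \<open>F\<close>.\<close>

lemma center_recursion:
  "Poly_Mapping.lookup f (inv_mon 1 b) = 0"
  "2 * of_nat (a + 2) * Poly_Mapping.lookup f (inv_mon (a + 2) b) = of_nat (b + 1) * Poly_Mapping.lookup f (inv_mon a (b + 1))"
proof -
  have L: "Poly_Mapping.lookup (mconst 2 * (mvar 3 * mpol_deriv 2 f)) (inv_mon a b + Poly_Mapping.single 3 1) =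
      2 * of_nat (a + 1) * Poly_Mapping.lookup f (inv_mon (a + 1) b)" for a b
  proof -
    have "inv_mon a b + Poly_Mapping.single 2 1 = inv_mon (a + 1) b"
      by (rule poly_mapping_eqI) (simp add: lookup_inv_mon lookup_add lookup_single when_def)
    then show ?thesis
      by (simp add: lookup_mconst_mult lookup_mvar_mult lookup_add lookup_mpol_deriv lookup_inv_mon)
  qed
  have "Poly_Mapping.lookup (mvar 2 * mpol_deriv 4 f) (inv_mon 0 b + Poly_Mapping.single 3 1) = 0"
    by (simp add: lookup_mvar_mult lookup_add lookup_inv_mon lookup_single)
  then show "Poly_Mapping.lookup f (inv_mon 1 b) = 0"
    using L[of 0 b] by (simp add: center_equations)
  have e: "inv_mon (a + 1) b + Poly_Mapping.single 3 1 - Poly_Mapping.single 2 1 = inv_mon a b + Poly_Mapping.single 3 1"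
    "inv_mon a b + Poly_Mapping.single 3 1 + Poly_Mapping.single 4 1 = inv_mon a (b + 1)"
    by (rule poly_mapping_eqI, simp add: lookup_inv_mon lookup_add lookup_minus lookup_single when_def)+
  have "Poly_Mapping.lookup (mvar 2 * mpol_deriv 4 f) (inv_mon (a + 1) b + Poly_Mapping.single 3 1) =
      of_nat (b + 1) * Poly_Mapping.lookup f (inv_mon a (b + 1))"
    unfolding lookup_mvar_mult e(1) lookup_mpol_deriv e(2)
    by (simp add: lookup_add lookup_inv_mon lookup_single)
  then show "2 * of_nat (a + 2) * Poly_Mapping.lookup f (inv_mon (a + 2) b) = of_nat (b + 1) * Poly_Mapping.lookup f (inv_mon a (b + 1))"
    using L[of "a + 1" b] by (simp add: center_equations)
qed

text \<open>A central element is determined by its coefficients at the powers of \<open>E F\<close>,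
  because the recursion lowers the exponent of \<open>H\<close> by 2 and excludes the exponent
  1.\<close>

lemma center_eq_0:
  assumes "\<And>b. Poly_Mapping.lookup f (inv_mon 0 b) = 0"
  shows "f = 0"
proof (rule poly_mapping_eqI)
  fix m
  have "Poly_Mapping.lookup f (inv_mon a b) = 0" for a b
  proof (induction a arbitrary: b rule: less_induct)
    case (less a)
    consider "a = 0" | "a = 1" | a' where "a = a' + 2" by (metis One_nat_def add_2_eq_Suc' not0_implies_Suc)
    then show ?case
    proof cases
      case 3
      then have "2 * of_nat (a' + 2) * Poly_Mapping.lookup f (inv_mon a b) = 0"
        using center_recursion(2)[of a' b] less.IH[of a' "b + 1"] by simp
      moreover have "of_nat (2 * (a' + 2)) \<noteq> (0 :: 'k)" by (subst of_nat_eq_0_iff) simp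
      then have "2 * of_nat (a' + 2) \<noteq> (0 :: 'k)" unfolding of_nat_mult of_nat_numeral .
      ultimately show ?thesis by (metis mult_eq_0_iff)
    qed (use assms center_recursion(1) in simp_all)
  qed
  then show "Poly_Mapping.lookup f m = Poly_Mapping.lookup 0 m"
    using center_key[of m] by (metis lookup_zero)
qed

end

text \<open>The invariant quadratic polynomial \<open>H\<^sup>2 + 4 E F\<close>; the coefficient 4
  is forced by \<open>center_recursion\<close> with \<open>a = 0\<close> and
  \<open>b = 0\<close>.\<close>

definition casimir :: "'k::field mpol" where
  "casimir = mvar 2 * mvar 2 + mconst 4 * (mvar 3 * mvar 4)"

lemma casimir_center:
  "casimir \<in> poisson_center pm_scale borel_br (borel_alg :: (nat \<Rightarrow>\<^sub>0 'k::{alg_closed_field, field_char_0}) set) borel_basis"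
proof -
  have c: "mconst 0 = (0 :: 'k mpol)" "mconst 1 = (1 :: 'k mpol)" "mconst (numeral w) = (numeral w :: 'k mpol)" for w
    by (simp_all add: mconst_def)
  have neg: "mconst (- c) = (- mconst c :: 'k mpol)" for c
    using ring_hom_fun_diff[OF ring_hom_fun_mconst, of 0 c] by (simp add: c)
  have d: "mpol_deriv i (numeral w) = (0 :: 'k mpol)" for i w
    using mpol_deriv_mconst[of i "numeral w :: 'k"] by (simp add: c)
  have R: "(casimir :: 'k mpol) \<in> mpols_below 5"
    unfolding casimir_def by (intro subring_setD(3,5)[OF subring_mpols_below] mvar_mpols_below mconst_mpols_below) simp_all
  have "poisson pm_scale borel_br borel_basis (casimir :: 'k mpol) g = 0" for g
  proof -
    have "(\<Sum>i<5. structure_matrix pm_scale borel_br borel_basis i j * mpol_deriv i (casimir :: 'k mpol)) = 0" if "j < 5" for j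
    proof -
      from that consider "j = 0" | "j = 1" | "j = 2" | "j = 3" | "j = 4" by linarith
      then show ?thesis
        by cases (simp_all add: sum_lessThan_5 structure_matrix_borel lookup_borel_br lookup_single when_def c neg
            casimir_def mpol_deriv_add mpol_deriv_mult mpol_deriv_mvar mpol_deriv_mconst d algebra_simps del: single_one)
    qed
    then have "(\<Sum>j<5. (\<Sum>i<5. structure_matrix pm_scale borel_br borel_basis i j * mpol_deriv i (casimir :: 'k mpol)) * mpol_deriv j g) = 0"
      by simp
    then show ?thesis unfolding poisson_def length_borel_basis by (subst sum.swap) (simp add: sum_distrib_right)
  qed
  then show ?thesis
    using R by (simp add: poisson_center_def sym_alg_borel)
qed

text \<open>The polynomial takes every value \<open>t\<close>, for instance at \<open>H = 0\<close>,
  \<open>E = 1\<close>, \<open>F = t / 4\<close>, so a relation would be a polynomial in one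
  variable vanishing everywhere.\<close>

lemma alg_independent_casimir: "alg_independent 1 (\<lambda>_. casimir :: 'k::field_char_0 mpol)"
  unfolding alg_independent_def
proof (intro ballI impI)
  fix P :: "'k mpol" assume P: "P \<in> mpols_below 1" and 0: "mpol_eval mconst (\<lambda>_. casimir) P = 0"
  show "P = 0"
  proof (rule mpols_below_eq_0[OF P])
    fix v :: "nat \<Rightarrow> 'k"
    let ?p = "\<lambda>i::nat. if i = 3 then 1 else if i = 4 then v 0 / 4 else 0"
    have "mpol_eval id ?p casimir = v 0"
      by (simp add: casimir_def ring_hom_funD[OF eval_hom] mpol_eval_mvar[OF ring_hom_fun_id] mpol_eval_mconst[OF ring_hom_fun_id])
    then have "mpol_eval id (\<lambda>_. v 0) P = mpol_eval id ?p (mpol_eval mconst (\<lambda>_. casimir) P)"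
      unfolding eval_mpol_eval by simp
    also have "\<dots> = 0" by (simp add: 0 mpol_eval_zero)
    finally show "mpol_eval id v P = 0"
      using mpol_eval_cong[OF P, of v "\<lambda>_. v 0" id] by simp
  qed
qed

text \<open>A dimension count produces a relation between \<open>f 0\<close> and \<open>f 1\<close>.
  Polynomials in two variables with both exponents at most \<open>D + 1\<close> have
  \<open>(D + 2) * (D + 2)\<close> coefficients. Their values have degree at most
  \<open>(D + 1) * D\<close>, and by \<open>center_eq_0\<close> such a value is zero once its
  coefficients at the powers of \<open>E F\<close> vanish, which amounts to fewer linear
  conditions.\<close>

lemma not_alg_independent_center:
  fixes f :: "nat \<Rightarrow> 'k::{alg_closed_field, field_char_0} mpol"
  assumes f: "\<And>i. i < 2 \<Longrightarrow> f i \<in> poisson_center pm_scale borel_br borel_alg borel_basis" and r: "r \<ge> 2"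
  shows "\<not> alg_independent r f"
proof
  assume ind: "alg_independent r f"
  interpret vector_space "pm_scale :: 'k \<Rightarrow> 'k mpol \<Rightarrow> 'k mpol" by (rule vector_space_pm_scale)
  define D where "D = total_degree (f 0) + total_degree (f 1)"
  define k where "k = (\<lambda>(i, j). Poly_Mapping.single 0 i + Poly_Mapping.single (1::nat) (j::nat))"
  define K where "K = k ` ({..D + 1} \<times> {..D + 1})"
  have lk: "Poly_Mapping.lookup (k (i, j)) l = (if l = 0 then i else if l = 1 then j else 0)" for i j l
    by (simp add: k_def lookup_add lookup_single when_def)
  have "inj k"
  proof (rule injI)
    fix x y assume e: "k x = k y"
    show "x = y" using arg_cong[OF e, of "\<lambda>m. Poly_Mapping.lookup m 0"] arg_cong[OF e, of "\<lambda>m. Poly_Mapping.lookup m 1"]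
      by (cases x; cases y) (simp add: lk)
  qed
  then have cK: "card K = (D + 2) * (D + 2)" "finite K"
    unfolding K_def by (simp_all add: card_image inj_on_subset)
  let ?V = "supp_space K :: 'k mpol set"
  have VR: "P \<in> mpols_below 2" if "P \<in> ?V" for P
  proof -
    have "Poly_Mapping.keys m \<subseteq> {..<2}" if "m \<in> K" for m
      using that by (auto simp: K_def in_keys_iff lk split: if_splits)
    moreover have "Poly_Mapping.keys P \<subseteq> K" using that by (auto simp: supp_space_def in_keys_iff)
    ultimately show ?thesis by (auto simp: mpols_below_def)
  qed
  let ?L = "\<lambda>b P. Poly_Mapping.lookup (mpol_eval mconst f P) (inv_mon 0 b)"
  have scale: "pm_scale c P = mconst c * P" for c and P :: "'k mpol"
    by (rule poly_mapping_eqI) (simp add: lookup_pm_scale lookup_mconst_mult)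
  have lin: "linfun pm_scale ?V (?L b)" for b
    by (simp add: linfun_def mpol_eval_add[OF ring_hom_fun_mconst] scale mpol_eval_mult[OF ring_hom_fun_mconst]
        mpol_eval_mconst[OF ring_hom_fun_mconst] lookup_add lookup_mconst_mult)
  have V: "subspace ?V" "fin_dim pm_scale ?V"
    using subspace_supp_space basis_supp_space(2)[OF cK(2)] cK(2) by (auto simp: fin_dim_def intro!: exI[of _ "(\<lambda>i. Poly_Mapping.single i 1) ` K"])
  \<comment> \<open>One condition for each power of \<open>E F\<close> with exponent from 0 to
    \<open>(D + 1) * D\<close>; higher powers exceed the degree of the value.\<close>
  let ?l = "(D + 1) * D + 1"
  let ?W = "{P\<in>?V. \<forall>b. b < ?l \<longrightarrow> ?L b P = 0}"
  have "dim ?V \<le> dim ?W + ?l" by (rule dim_kernels_ge[OF V lin])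
  moreover have "dim ?V = (D + 2) * (D + 2)" by (simp add: dim_supp_space cK)
  ultimately have "dim ?W \<noteq> 0" by (simp add: algebra_simps)
  have "\<not> ?W \<subseteq> {0}"
  proof
    assume "?W \<subseteq> {0}"
    then have "?W \<subseteq> span {}" by simp
    then have "dim ?W \<le> card ({} :: 'k mpol set)" by (rule dim_le_card) simp
    then show False using \<open>dim ?W \<noteq> 0\<close> by simp
  qed
  then obtain P where P: "P \<in> ?V" "\<And>b. b < ?l \<Longrightarrow> ?L b P = 0" "P \<noteq> 0" by blast
  have deg: "degree (wgrade (\<lambda>_. 1) (mpol_eval mconst f P)) \<le> (D + 1) * D"
  proof -
    have m: "degree (wgrade (\<lambda>_. 1) (monomial_value f m)) \<le> (D + 1) * D" if mK: "m \<in> K" for m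
    proof -
      obtain i j where ij: "m = k (i, j)" "i \<le> D + 1" "j \<le> D + 1"
        using mK unfolding K_def by blast
      have "monomial_value f m = f 0 ^ i * f 1 ^ j"
        by (simp add: ij(1) k_def monomial_value_add) (simp add: monomial_value_def)
      then have "degree (wgrade (\<lambda>_. 1) (monomial_value f m)) =
          degree (wgrade (\<lambda>_. 1) (f 0) ^ i * wgrade (\<lambda>_. 1) (f 1) ^ j)"
        by (simp add: ring_hom_funD[OF wgrade_hom] ring_hom_fun_power[OF wgrade_hom])
      also have "\<dots> \<le> total_degree (f 0) * i + total_degree (f 1) * j"
        by (intro order.trans[OF degree_mult_le] add_mono) (simp_all add: total_degree_eq degree_power_le)
      also have "\<dots> \<le> total_degree (f 0) * (D + 1) + total_degree (f 1) * (D + 1)"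
        using ij by (intro add_mono mult_le_mono) simp_all
      finally show ?thesis by (simp add: D_def algebra_simps)
    qed
    have "mpol_eval mconst f P = (\<Sum>m\<in>K. mconst (Poly_Mapping.lookup P m) * monomial_value f m)"
      using P(1) cK(2) by (intro mpol_eval_superset) (auto simp: supp_space_def in_keys_iff ring_hom_funD[OF ring_hom_fun_mconst])
    then have "wgrade (\<lambda>_. 1) (mpol_eval mconst f P) =
        (\<Sum>m\<in>K. wgrade (\<lambda>_. 1) (mconst (Poly_Mapping.lookup P m)) * wgrade (\<lambda>_. 1) (monomial_value f m))"
      by (simp add: ring_hom_fun_sum[OF wgrade_hom] ring_hom_funD[OF wgrade_hom])
    moreover have "degree (wgrade (\<lambda>_. 1) (mconst c :: 'k mpol)) = 0" for c
      using total_degree_mconst[of c] by (simp only: total_degree_eq)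
    ultimately show ?thesis
      using m cK(2) by (auto intro!: degree_sum_le order.trans[OF degree_mult_le])
  qed
  have "mpol_eval mconst f P \<in> poisson_center pm_scale borel_br borel_alg borel_basis"
    by (rule mpol_eval_in_subalgebra[OF mpol_subalgebra_poisson_center f VR[OF P(1)]])
  then have "mpol_eval mconst f P = 0"
  proof (rule center_eq_0)
    fix b
    show "?L b P = 0"
    proof (cases "b < ?l")
      case False
      have "wdeg (\<lambda>_. 1) (inv_mon 0 b) \<ge> b"
      proof -
        have "b = (\<Sum>i\<in>{3::nat} \<inter> Poly_Mapping.keys (inv_mon 0 b). Poly_Mapping.lookup (inv_mon 0 b) i)"
          by (cases "b = 0") (simp_all add: in_keys_iff lookup_inv_mon Int_insert_left)
        also have "\<dots> \<le> wdeg (\<lambda>_. 1) (inv_mon 0 b)"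
          unfolding wdeg_def by (simp, intro sum_mono2) auto
        finally show ?thesis .
      qed
      then have "\<not> wdeg (\<lambda>_. 1) (inv_mon 0 b) \<le> (D + 1) * D" using False by simp
      then have "inv_mon 0 b \<notin> Poly_Mapping.keys (mpol_eval mconst f P)"
        using deg degree_wgrade_le_iff by blast
      then show ?thesis by (simp add: in_keys_iff)
    qed (rule P(2))
  qed
  moreover have "P \<in> mpols_below r" using VR[OF P(1)] r by (force simp: mpols_below_def)
  ultimately show False using ind P(3) unfolding alg_independent_def by blast
qed

lemma trdeg_borel:
  "trdeg (poisson_center pm_scale borel_br (borel_alg :: (nat \<Rightarrow>\<^sub>0 'k::{alg_closed_field, field_char_0}) set) borel_basis) = 1"
  unfolding trdeg_def
proof (rule cSup_eq_maximum)
  show "1 \<in> {r. \<exists>f. (\<forall>i<r. f i \<in> poisson_center pm_scale borel_br (borel_alg :: (nat \<Rightarrow>\<^sub>0 'k) set) borel_basis) \<and> alg_independent r f}"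
    using casimir_center alg_independent_casimir by (intro CollectI exI[of _ "\<lambda>_. casimir"]) simp
  fix r
  assume "r \<in> {r. \<exists>f. (\<forall>i<r. f i \<in> poisson_center pm_scale borel_br (borel_alg :: (nat \<Rightarrow>\<^sub>0 'k) set) borel_basis) \<and> alg_independent r f}"
  then obtain f where f: "\<forall>i<r. f i \<in> poisson_center pm_scale borel_br (borel_alg :: (nat \<Rightarrow>\<^sub>0 'k) set) borel_basis" "alg_independent r f"
    by blast
  show "r \<le> 1"
  proof (rule ccontr)
    assume "\<not> r \<le> 1"
    then have "r \<ge> 2" by simp
    with f(1) have "\<not> alg_independent r f" by (intro not_alg_independent_center) auto
    then show False using f(2) by simp
  qed
qed

theorem theorem22:
  fixes s :: "'k::{alg_closed_field, field_char_0} \<Rightarrow> 'a::ab_group_add \<Rightarrow> 'a"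
    and br :: "'a \<Rightarrow> 'a \<Rightarrow> 'a"
    and G :: "'a set"
  assumes "lie_algebra s br G"
  shows
    "(\<forall>H. lie_subalgebra s br G H \<longrightarrow> lie_c s br H \<le> lie_c s br G)
   \<and> (\<forall>xs. ordered_basis s G xs \<and> trdeg (poisson_center s br G xs) = lie_index s br G \<longrightarrow>
        (\<forall>p. fundamental_semi_invariant s br G xs p \<longrightarrow>
           lie_c s br G - lie_c s br (frobenius_semiradical s br G) \<le> real (total_degree p))
      \<and> (lie_nonsingular s br G xs \<longrightarrow>
           lie_c s br G = lie_c s br (frobenius_semiradical s br G)
         \<and> (\<forall>A. complete_poisson_commutative s br xs (frobenius_semiradical s br G) A \<longrightarrow>
              complete_poisson_commutative s br xs G A)
         \<and> (lie_commutative br (frobenius_semiradical s br G) \<longrightarrow>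
              (\<forall>H. commutative_polarization s br G H \<longleftrightarrow> H = frobenius_semiradical s br G))))
   \<and> (\<exists>(s' :: 'k \<Rightarrow> (nat \<Rightarrow>\<^sub>0 'k) \<Rightarrow> (nat \<Rightarrow>\<^sub>0 'k)) br' G' xs p.
        lie_algebra s' br' G'
      \<and> ordered_basis s' G' xs
      \<and> trdeg (poisson_center s' br' G' xs) = lie_index s' br' G'
      \<and> fundamental_semi_invariant s' br' G' xs p
      \<and> lie_c s' br' G' - lie_c s' br' (frobenius_semiradical s' br' G') < real (total_degree p))"
proof -
  interpret lie_algebra_char_0 s br G
    using assms by (simp add: lie_algebra_char_0_def)
  have semiradical: "\<forall>xs. ordered_basis s G xs \<and> trdeg (poisson_center s br G xs) = lie_index s br G \<longrightarrow>
        (\<forall>p. fundamental_semi_invariant s br G xs p \<longrightarrow>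
           lie_c s br G - lie_c s br (frobenius_semiradical s br G) \<le> real (total_degree p))
      \<and> (lie_nonsingular s br G xs \<longrightarrow>
           lie_c s br G = lie_c s br (frobenius_semiradical s br G)
         \<and> (\<forall>A. complete_poisson_commutative s br xs (frobenius_semiradical s br G) A \<longrightarrow>
              complete_poisson_commutative s br xs G A)
         \<and> (lie_commutative br (frobenius_semiradical s br G) \<longrightarrow>
              (\<forall>H. commutative_polarization s br G H \<longleftrightarrow> H = frobenius_semiradical s br G)))"
  proof (intro allI impI)
    fix xs assume "ordered_basis s G xs \<and> trdeg (poisson_center s br G xs) = lie_index s br G"
    then interpret lie_algebra_basis_closed s br G xs
      by unfold_locales simp
    have complete: "complete_poisson_commutative s br xs G A"
      if "lie_nonsingular s br G xs" "complete_poisson_commutative s br xs FG A" for A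
      using that(2) sym_alg_mono[OF semiradical_subset, of s xs] lie_c_semiradical_nonsingular[OF that(1)]
      by (auto simp: complete_poisson_commutative_def)
    show "(\<forall>p. fundamental_semi_invariant s br G xs p \<longrightarrow> lie_c s br G - lie_c s br FG \<le> real (total_degree p))
      \<and> (lie_nonsingular s br G xs \<longrightarrow> lie_c s br G = lie_c s br FG
         \<and> (\<forall>A. complete_poisson_commutative s br xs FG A \<longrightarrow> complete_poisson_commutative s br xs G A)
         \<and> (lie_commutative br FG \<longrightarrow> (\<forall>H. commutative_polarization s br G H \<longleftrightarrow> H = FG)))"
      using lie_c_semiradical_bound lie_c_semiradical_nonsingular complete commutative_polarization_iff
      by simp
  qed
  \<comment> \<open>The difference is at most 0, while the fundamental semi-invariant
    \<open>E\<close> has degree 1.\<close>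
  have strict: "lie_c pm_scale borel_br (borel_alg :: (nat \<Rightarrow>\<^sub>0 'k) set) -
      lie_c pm_scale borel_br (frobenius_semiradical pm_scale borel_br (borel_alg :: (nat \<Rightarrow>\<^sub>0 'k) set)) <
      real (total_degree (mvar 3 :: 'k mpol))"
    using lie_c_borel[where 'k='k] by (simp add: total_degree_mvar)
  show ?thesis
  proof (intro conjI semiradical allI impI)
    show "lie_c s br H \<le> lie_c s br G" if "lie_subalgebra s br G H" for H
      using that by (rule lie_c_subalgebra_le)
    show "\<exists>(s' :: 'k \<Rightarrow> (nat \<Rightarrow>\<^sub>0 'k) \<Rightarrow> (nat \<Rightarrow>\<^sub>0 'k)) br' G' xs p.
        lie_algebra s' br' G'
      \<and> ordered_basis s' G' xs
      \<and> trdeg (poisson_center s' br' G' xs) = lie_index s' br' G'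
      \<and> fundamental_semi_invariant s' br' G' xs p
      \<and> lie_c s' br' G' - lie_c s' br' (frobenius_semiradical s' br' G') < real (total_degree p)"
      using lie_algebra_borel ordered_basis_borel trdeg_borel[where 'k='k, folded index_borel[where 'k='k]]
        fundamental_borel strict by blast
  qed
qed

end
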